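(* Let $\Gamma$ be a finite group that is nilpotent of class $\le n$ (for an integer $n\ge 1$), and let $r\ge \max\{4^{n+1},20\}$ be an integer. Then the following assertions are equivalent: (i) For some Cayley graph $G$ of $\Gamma$, the $r$-local covering $G_r$ of $G$ has at least two ends that are separated by at most two vertices (i.e. there are two distinct ends of $G_r$ and a set $Y$ of at most two vertices of $G_r$ such that the two ends lie in distinct components of $G_r-Y$). (ii) Some Cayley graph of $\Gamma$ has an $r$-local separator of size at most $2$ (that is, an $r$-local cutvertex or an $r$-local $2$-separator), and $\Gamma$ has order $>r$. (iii) $\Gamma$ is isomorphic to $C_i\times C_j$ for some $i>r$ and $j\in\{1,2\}$, where $C_m$ denotes the cyclic group of order $m$.
   Context: Conventions: A generating set $S$ of a group $\Gamma$ does not contain the neutral element $\mathbb{I}$ and is closed under inverses. The Cayley graph $\mathrm{Cay}(\Gamma,S)$ is the simple graph with vertex set $\Gamma$ and edge set $\{\{g,gs\}: g\in\Gamma, s\in S\}$. Two group elements $a,b$ are equivalent, $a\equiv b$, if $a=b$ or $a=b^{-1}$. Iterated commutators: in the free group on $g,h$ define the words $[g,h]_1:=gh^{-1}g^{-1}h$ and, for $n\ge 2$, $[g,h]_n$ the reduced form of $g\,[g,h]_{n-1}^{-1}\,g^{-1}\,[g,h]_{n-1}$. A group $\Gamma$ is nilpotent of class $\le n$ if $[g,h]_n$ evaluates to $\mathbb{I}$ in $\Gamma$ for all $g,h\in\Gamma$ with $g\not\equiv h$. Balls: for a vertex $v$ of a graph $G$ and $r\in\mathbb{N}$, the ball $B_r(v)$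 is the subgraph of $G$ consisting of all vertices and edges lying on closed walks in $G$ of length at most $r$ passing through $v$. A vertex $v$ is an $r$-local cutvertex if $B_r(v)-v$ is disconnected. Local 2-separators: for distinct vertices $v_0,v_1$, let $N(\{v_0,v_1\})$ be the set of vertices outside $\{v_0,v_1\}$ adjacent to $v_0$ or $v_1$. The connectivity graph $C_r(v_0,v_1)$ has vertex set $N(\{v_0,v_1\})$, two vertices $a,b$ being adjacent if for some $i\in\{0,1\}$ they lie in the same component of $B_r(v_i)-v_0-v_1$. The set $\{v_0,v_1\}$ is an $r$-local $2$-separator if $C_r(v_0,v_1)$ is disconnected and the distance between $v_0$ and $v_1$ in $G$ is at most $r/2$. Local covering: for a connected graph $G$ (viewed as a 1-complex) and a base vertex $v_0$, the $r$-local covering $p_r\colon G_r\to G$ is the covering graph of $G$ corresponding to the (normal) subgroup of the fundamental group $\pi_1(G,v_0)$ generated by the classes of closed walks of the form $WCW^{-1}$, where $C$ is a closed walk of length at most $r$ and $W$ is a walk from $v_0$ to a vertex of $C$. Ends of a graph are the usual equivalence classes of rays. *)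

theory Defs
  imports "HOL-Algebra.Algebra"
begin

fun iter_comm :: "('a, 'b) monoid_scheme \<Rightarrow> nat \<Rightarrow> 'a \<Rightarrow> 'a \<Rightarrow> 'a" where
  "iter_comm G 0 g h = \<one>\<^bsub>G\<^esub>"
| "iter_comm G (Suc 0) g h = g \<otimes>\<^bsub>G\<^esub> inv\<^bsub>G\<^esub> h \<otimes>\<^bsub>G\<^esub> inv\<^bsub>G\<^esub> g \<otimes>\<^bsub>G\<^esub> h"
| "iter_comm G (Suc (Suc k)) g h =
     g \<otimes>\<^bsub>G\<^esub> inv\<^bsub>G\<^esub> (iter_comm G (Suc k) g h) \<otimes>\<^bsub>G\<^esub> inv\<^bsub>G\<^esub> g
       \<otimes>\<^bsub>G\<^esub> iter_comm G (Suc k) g h"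

definition nilpotent_class_le :: "('a, 'b) monoid_scheme \<Rightarrow> nat \<Rightarrow> bool" where
  "nilpotent_class_le G n \<longleftrightarrow>
     (\<forall>g\<in>carrier G. \<forall>h\<in>carrier G. g \<noteq> h \<and> g \<noteq> inv\<^bsub>G\<^esub> h \<longrightarrow> iter_comm G n g h = \<one>\<^bsub>G\<^esub>)"

type_synonym 'v graph = "'v set \<times> 'v set set"

definition verts :: "'v graph \<Rightarrow> 'v set" where "verts G = fst G"
definition edges :: "'v graph \<Rightarrow> 'v set set" where "edges G = snd G"

definition adj :: "'v graph \<Rightarrow> 'v \<Rightarrow> 'v \<Rightarrow> bool" where
  "adj G x y \<longleftrightarrow> x \<noteq> y \<and> x \<in> verts G \<and> y \<in> verts G \<and> {x, y} \<in> edges G"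

definition walk :: "'v graph \<Rightarrow> 'v list \<Rightarrow> bool" where
  "walk G w \<longleftrightarrow> w \<noteq> [] \<and> set w \<subseteq> verts G \<and> (\<forall>i. Suc i < length w \<longrightarrow> adj G (w ! i) (w ! Suc i))"

definition walk_len :: "'v list \<Rightarrow> nat" where "walk_len w = length w - 1"

definition closed_walk :: "'v graph \<Rightarrow> 'v list \<Rightarrow> bool" where
  "closed_walk G w \<longleftrightarrow> walk G w \<and> hd w = last w"

definition reachable :: "'v graph \<Rightarrow> 'v \<Rightarrow> 'v \<Rightarrow> bool" where
  "reachable G x y \<longleftrightarrow> (\<exists>w. walk G w \<and> hd w = x \<and> last w = y)"

definition connected_graph :: "'v graph \<Rightarrow> bool" where
  "connected_graph G \<longleftrightarrow> (\<forall>x\<in>verts G. \<forall>y\<in>verts G. reachable G x y)"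

definition delete_verts :: "'v graph \<Rightarrow> 'v set \<Rightarrow> 'v graph" where
  "delete_verts G Xs = (verts G - Xs, {ed \<in> edges G. ed \<inter> Xs = {}})"

definition ball_graph :: "'v graph \<Rightarrow> nat \<Rightarrow> 'v \<Rightarrow> 'v graph" where
  "ball_graph G r v =
    ({x. \<exists>w. closed_walk G w \<and> walk_len w \<le> r \<and> v \<in> set w \<and> x \<in> set w},
     {{w ! i, w ! Suc i} | w i. closed_walk G w \<and> walk_len w \<le> r \<and> v \<in> set w \<and> i < walk_len w})"

definition local_cutvertex :: "'v graph \<Rightarrow> nat \<Rightarrow> 'v \<Rightarrow> bool" where
  "local_cutvertex G r v \<longleftrightarrow> v \<in> verts G \<and> \<not> connected_graph (delete_verts (ball_graph G r v) {v})"

definition nbhd2 :: "'v graph \<Rightarrow> 'v \<Rightarrow> 'v \<Rightarrow> 'v set" where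
  "nbhd2 G v0 v1 = {x \<in> verts G - {v0, v1}. adj G x v0 \<or> adj G x v1}"

definition connectivity_graph :: "'v graph \<Rightarrow> nat \<Rightarrow> 'v \<Rightarrow> 'v \<Rightarrow> 'v graph" where
  "connectivity_graph G r v0 v1 =
    (nbhd2 G v0 v1,
     {{a, b} | a b. a \<in> nbhd2 G v0 v1 \<and> b \<in> nbhd2 G v0 v1 \<and> a \<noteq> b \<and>
        (\<exists>v\<in>{v0, v1}. reachable (delete_verts (ball_graph G r v) {v0, v1}) a b)})"

definition local_2_separator :: "'v graph \<Rightarrow> nat \<Rightarrow> 'v \<Rightarrow> 'v \<Rightarrow> bool" where
  "local_2_separator G r v0 v1 \<longleftrightarrow>
     v0 \<in> verts G \<and> v1 \<in> verts G \<and> v0 \<noteq> v1 \<and>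
     \<not> connected_graph (connectivity_graph G r v0 v1) \<and>
     (\<exists>w. walk G w \<and> hd w = v0 \<and> last w = v1 \<and> 2 * walk_len w \<le> r)"

definition has_local_separator_le2 :: "'v graph \<Rightarrow> nat \<Rightarrow> bool" where
  "has_local_separator_le2 G r \<longleftrightarrow>
     (\<exists>v. local_cutvertex G r v) \<or> (\<exists>v0 v1. local_2_separator G r v0 v1)"

definition cayley_gen_set :: "('a, 'b) monoid_scheme \<Rightarrow> 'a set \<Rightarrow> bool" where
  "cayley_gen_set G S \<longleftrightarrow> S \<subseteq> carrier G \<and> \<one>\<^bsub>G\<^esub> \<notin> S \<and>
     (\<forall>s\<in>S. inv\<^bsub>G\<^esub> s \<in> S) \<and> generate G S = carrier G"

definition cayley_graph :: "('a, 'b) monoid_scheme \<Rightarrow> 'a set \<Rightarrow> 'a graph" where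
  "cayley_graph G S = (carrier G, {{g, g \<otimes>\<^bsub>G\<^esub> s} | g s. g \<in> carrier G \<and> s \<in> S})"

text \<open>Vertices of the covering are classes of walks from the base vertex v0, where two walks
  are identified if they differ by the normal subgroup of the fundamental group generated by
  (conjugates of) closed walks of length at most r.  Combinatorially, this is the equivalence
  generated by inserting/deleting a backtrack u w u, or a closed walk of length at most r, at
  some point of the walk.\<close>

definition walk_move :: "'v graph \<Rightarrow> nat \<Rightarrow> 'v list \<Rightarrow> 'v list \<Rightarrow> bool" where
  "walk_move G r W W' \<longleftrightarrow>
     (\<exists>Pa u Pb w. W = Pa @ [u] @ Pb \<and> W' = Pa @ [u, w, u] @ Pb \<and> adj G u w) \<or>
     (\<exists>Pa u Pb Cw. W = Pa @ [u] @ Pb \<and> W' = Pa @ Cw @ Pb \<and> closed_walk G Cw \<and> hd Cw = u \<and> walk_len Cw \<le> r)"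

definition walk_from :: "'v graph \<Rightarrow> 'v \<Rightarrow> 'v list \<Rightarrow> bool" where
  "walk_from G v0 W \<longleftrightarrow> walk G W \<and> hd W = v0"

definition homotopy_rel :: "'v graph \<Rightarrow> nat \<Rightarrow> 'v \<Rightarrow> ('v list \<times> 'v list) set" where
  "homotopy_rel G r v0 =
     {(W, W'). walk_from G v0 W \<and> walk_from G v0 W' \<and> (walk_move G r W W' \<or> walk_move G r W' W)}\<^sup>*"

definition walk_class :: "'v graph \<Rightarrow> nat \<Rightarrow> 'v \<Rightarrow> 'v list \<Rightarrow> 'v list set" where
  "walk_class G r v0 W = {W'. (W, W') \<in> homotopy_rel G r v0}"

definition local_covering :: "'v graph \<Rightarrow> nat \<Rightarrow> 'v \<Rightarrow> 'v list set graph" where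
  "local_covering G r v0 =
    ({walk_class G r v0 W | W. walk_from G v0 W},
     {{walk_class G r v0 W, walk_class G r v0 (W @ [y])} | W y. walk_from G v0 W \<and> adj G (last W) y})"

definition ray :: "'v graph \<Rightarrow> (nat \<Rightarrow> 'v) \<Rightarrow> bool" where
  "ray G f \<longleftrightarrow> inj f \<and> (\<forall>i. adj G (f i) (f (Suc i)))"

definition same_end :: "'v graph \<Rightarrow> (nat \<Rightarrow> 'v) \<Rightarrow> (nat \<Rightarrow> 'v) \<Rightarrow> bool" where
  "same_end G f g \<longleftrightarrow>
     (\<forall>Xs. finite Xs \<longrightarrow> (\<exists>N. \<forall>k\<ge>N. \<forall>l\<ge>N. f k \<notin> Xs \<and> g l \<notin> Xs \<and>
         reachable (delete_verts G Xs) (f k) (g l)))"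

definition two_ends_separated_le2 :: "'v graph \<Rightarrow> bool" where
  "two_ends_separated_le2 G \<longleftrightarrow>
     (\<exists>f g Ys. ray G f \<and> ray G g \<and> \<not> same_end G f g \<and>
        Ys \<subseteq> verts G \<and> finite Ys \<and> card Ys \<le> 2 \<and>
        (\<exists>N. \<forall>k\<ge>N. \<forall>l\<ge>N. f k \<notin> Ys \<and> g l \<notin> Ys \<and>
             \<not> reachable (delete_verts G Ys) (f k) (g l)))"

end

(*
  The r-local covering of Cay(G, S) is the Cayley graph of the group H presented by S and all
  relators of G of length at most r.  As r \<ge> 4^(n+1), the words [g, h]_n with g, h products of at
  most two generators are among these relators, so [g, h]_n = 1 holds in H for such g, h.

  If at most two vertices Y of Cay(H, S) separate two ends, then H acts on a nested family of
  minimal cuts (those that are crossed by the fewest minimal cuts), as on the edges of a tree with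
  finite edge stabilisers.  By Serre's lemma some g in S or SS is hyperbolic.  If w^-1 g w
  preserves the pair of ends of the axis of g, then so does w; unravelling [g, s]_n = 1 therefore
  shows that every s in S, hence H, preserves this pair, and [s, g]_n = 1 excludes that s swaps
  its members.  Now some s in S has infinite order, <s> has finite index, and every coset of <s>
  runs from one end to the other, so it meets Y: the index is at most two.  Hence H is
  Z or Z x C_2 and G is as in (iii), where i > r because a power of s of length at most r is trivial
  in H if it is trivial in G.

  For a local separator, the edges between its lift Y in Cay(H, S) and one class A of its
  neighbours meet every closed walk of length at most r an even number of times.  The parity of
  the number of these edges on a walk thus depends only on the endpoints, so Y separates
  Cay(H, S).  A vertex-transitive graph of degree at least three has no separator of
  size at most two that splits off a finite part, so both sides are infinite.
*)
theory Submission
  imports Defs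
begin

section \<open>Nested thin cuts\<close>

no_notation (ASCII) subset_mset (infix "<#" 50)

text \<open>Nilpotency is not known to pass from \<open>G\<close> to the covering group: an identity
  of \<open>G\<close> carries over only where it is a short relator. For entries of lengths at most
  2 and 1, the word \<open>[g, h]_n\<close> has length at most
  \<open>10 * 2 ^ (n - 1) \<le> 4 ^ (n + 1)\<close>, so what is available are finitely many Engel
  identities between a generator and a product of at most two generators. This dictates the proof:
  the hyperbolic element has to be found among such products, and the stabiliser of its axis has to
  be reached by unravelling single commutators, since no structure theorem on nilpotent groups
  applies.

  Cuts are minimised twice because cuts with the smallest boundary may still cross. Both the
  boundary size and the number of crossing cuts are submodular, and the second count drops strictly
  when a crossing pair is replaced by two opposite corners.

  The tree is never built. Inclusion of nested cuts replaces the order of its edges, and ends are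
  families of vertex sets, on which the group acts by translation. Separators are vertex sets while
  cuts are measured by arcs; as \<open>S\<close> is finite, finiteness of one gives finiteness of
  the other.\<close>

definition boundary :: "('v \<times> 'v) set \<Rightarrow> 'v set \<Rightarrow> ('v \<times> 'v) set" where
  "boundary D U = {(x, y) \<in> D. x \<in> U \<and> y \<notin> U}"

definition connected_in :: "('v \<times> 'v) set \<Rightarrow> 'v set \<Rightarrow> bool" where
  "connected_in D U \<longleftrightarrow> (\<forall>x\<in>U. \<forall>y\<in>U. (x, y) \<in> (D \<inter> U \<times> U)\<^sup>*)"

lemma boundary_subset: "boundary D U \<subseteq> D"
  by (auto simp: boundary_def)

lemma rtrancl_crosses_boundary:
  assumes "(a, b) \<in> D\<^sup>*" "a \<in> U" "b \<notin> U"
  shows "boundary D U \<noteq> {}"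
proof
  assume "boundary D U = {}"
  then have step: "x \<in> U \<longrightarrow> y \<in> U" if "(x, y) \<in> D" for x y
    using that by (auto simp: boundary_def)
  from assms(1) have "a \<in> U \<longrightarrow> b \<in> U"
    by (induction rule: rtrancl_induct) (use step in auto)
  with assms show False by blast
qed

lemma connected_in_crosses:
  assumes "connected_in D W" "x \<in> W \<inter> U" "y \<in> W - U"
  shows "\<exists>p\<in>W. \<exists>q\<in>W. (p, q) \<in> boundary D U"
proof -
  have "(x, y) \<in> (D \<inter> W \<times> W)\<^sup>*"
    using assms by (auto simp: connected_in_def)
  then have "boundary (D \<inter> W \<times> W) U \<noteq> {}"
    using assms by (intro rtrancl_crosses_boundary[of x y]) auto
  then show ?thesis by (auto simp: boundary_def)
qed

text \<open>A path uses only finitely many arcs, and every set that separates its ends has one of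
  them in its boundary. So finiteness of a family of cuts can be checked arc by arc.\<close>

lemma rtrancl_finite_support:
  assumes "(a, b) \<in> D\<^sup>*"
  shows "\<exists>Q. finite Q \<and> Q \<subseteq> D \<and> (a, b) \<in> Q\<^sup>*"
  using assms
proof induction
  case base
  show ?case by (rule exI[of _ "{}"]) auto
next
  case (step y z)
  then obtain Q where Q: "finite Q" "Q \<subseteq> D" "(a, y) \<in> Q\<^sup>*" by blast
  have "(a, y) \<in> (insert (y, z) Q)\<^sup>*"
    using Q(3) rtrancl_mono[of Q "insert (y, z) Q"] by blast
  then have "(a, z) \<in> (insert (y, z) Q)\<^sup>*" by (rule rtrancl_into_rtrancl) auto
  with Q step show ?case by (intro exI[of _ "insert (y, z) Q"]) auto
qed

text \<open>Connectivity of both sides is what makes these families finite: on a two-way infinite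
  path, adding far tails to a half-line gives infinitely many sets with two boundary arcs. The size
  is bounded rather than fixed, which suits an induction that deletes arcs.\<close>

definition cuts_through :: "('v \<times> 'v) set \<Rightarrow> 'v set \<Rightarrow> nat \<Rightarrow> 'v \<Rightarrow> 'v \<Rightarrow> 'v set set" where
  "cuts_through D V k a b = {U. U \<subseteq> V \<and> a \<in> U \<and> b \<in> V - U \<and> connected_in D U
     \<and> connected_in D (V - U) \<and> finite (boundary D U) \<and> card (boundary D U) \<le> k}"

text \<open>Induction on the boundary size: delete the given arc; every such cut crosses a fixed path
  that joins the ends of the arc in the rest, unless the arc was a bridge.\<close>

lemma finite_cuts_through:
  assumes "sym D" "D \<subseteq> V \<times> V" "(a, b) \<in> D"
  shows "finite (cuts_through D V k a b)"
  using assms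
proof (induction k arbitrary: D a b)
  case 0
  have "cuts_through D V 0 a b = {}"
    using 0 by (auto simp: boundary_def cuts_through_def)
  then show ?case by simp
next
  case (Suc k)
  define D' where "D' = D - {(a, b), (b, a)}"
  have symD': "sym D'" using Suc.prems(1) by (auto simp: D'_def sym_def)
  have subD': "D' \<subseteq> V \<times> V" using Suc.prems(2) by (auto simp: D'_def)
  have red: "U \<subseteq> V" "a \<in> U" "b \<notin> U" "connected_in D' U" "connected_in D' (V - U)"
      "finite (boundary D' U)" "card (boundary D' U) \<le> k"
    if U: "U \<in> cuts_through D V (Suc k) a b" for U
  proof -
    show U': "U \<subseteq> V" "a \<in> U" "b \<notin> U" using U by (auto simp: cuts_through_def)
    have "D' \<inter> U \<times> U = D \<inter> U \<times> U" "D' \<inter> (V - U) \<times> (V - U) = D \<inter> (V - U) \<times> (V - U)"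
      using U' by (auto simp: D'_def)
    then show "connected_in D' U" "connected_in D' (V - U)"
      using U by (simp_all add: connected_in_def cuts_through_def)
    have 2: "boundary D' U = boundary D U - {(a, b)}"
      using U' by (auto simp: D'_def boundary_def)
    have 3: "(a, b) \<in> boundary D U" using U' Suc.prems by (auto simp: boundary_def)
    have 4: "finite (boundary D U)" "card (boundary D U) \<le> Suc k"
      using U by (simp_all add: cuts_through_def)
    show "finite (boundary D' U)" using 2 4 by simp
    show "card (boundary D' U) \<le> k" using 2 3 4 by (simp add: card_Diff_singleton)
  qed
  show ?case
  proof (cases "(a, b) \<in> D'\<^sup>*")
    case True
    obtain Q where Q: "finite Q" "Q \<subseteq> D'" "(a, b) \<in> Q\<^sup>*"
      using rtrancl_finite_support[OF True] by (elim exE conjE)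
    have "cuts_through D V (Suc k) a b \<subseteq> (\<Union>p\<in>Q. cuts_through D' V k (fst p) (snd p))"
    proof
      fix U assume U: "U \<in> cuts_through D V (Suc k) a b"
      then have "boundary Q U \<noteq> {}"
        using rtrancl_crosses_boundary[OF Q(3) red(2,3)[OF U]] by simp
      then obtain x y where xy: "(x, y) \<in> Q" "x \<in> U" "y \<notin> U" by (auto simp: boundary_def)
      then have "U \<in> cuts_through D' V k x y"
        using red[OF U] Q(2) subD' by (auto simp: cuts_through_def)
      then show "U \<in> (\<Union>p\<in>Q. cuts_through D' V k (fst p) (snd p))"
        using xy(1) by (intro UN_I[of "(x, y)"]) simp_all
    qed
    moreover have "finite (cuts_through D' V k (fst p) (snd p))" if "p \<in> Q" for p
      using Suc.IH[OF symD' subD', of "fst p" "snd p"] that Q(2) by auto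
    then have "finite (\<Union>p\<in>Q. cuts_through D' V k (fst p) (snd p))"
      using Q(1) by (intro finite_UN_I)
    ultimately show ?thesis by (rule finite_subset)
  next
    case False
    have "U = {x\<in>V. (a, x) \<in> D'\<^sup>*}" if U: "U \<in> cuts_through D V (Suc k) a b" for U
    proof -
      note c = red[OF U]
      have "(a, x) \<in> D'\<^sup>*" if "x \<in> U" for x
      proof -
        have "(a, x) \<in> (D' \<inter> U \<times> U)\<^sup>*" using c(2,4) that by (auto simp: connected_in_def)
        then show ?thesis using rtrancl_mono[of "D' \<inter> U \<times> U" D'] by blast
      qed
      moreover have "(a, x) \<notin> D'\<^sup>*" if "x \<in> V - U" for x
      proof
        assume 1: "(a, x) \<in> D'\<^sup>*"
        have "b \<in> V" using Suc.prems by auto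
        then have "(x, b) \<in> (D' \<inter> (V-U) \<times> (V-U))\<^sup>*"
          using c(3,5) that by (auto simp: connected_in_def)
        then have "(x, b) \<in> D'\<^sup>*" using rtrancl_mono[of "D' \<inter> (V-U) \<times> (V-U)" D'] by blast
        with 1 show False using False by (meson rtrancl_trans)
      qed
      ultimately show ?thesis using c(1) by blast
    qed
    then have "cuts_through D V (Suc k) a b \<subseteq> {{x\<in>V. (a, x) \<in> D'\<^sup>*}}" by blast
    then show ?thesis by (rule finite_subset) simp
  qed
qed

section \<open>Thin and optimal cuts\<close>

definition cut :: "('v \<times> 'v) set \<Rightarrow> 'v set \<Rightarrow> 'v set \<Rightarrow> bool" where
  "cut D V U \<longleftrightarrow> U \<subseteq> V \<and> infinite U \<and> infinite (V - U) \<and> finite (boundary D U)"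

definition thin :: "('v \<times> 'v) set \<Rightarrow> 'v set \<Rightarrow> 'v set \<Rightarrow> bool" where
  "thin D V U \<longleftrightarrow> cut D V U \<and> (\<forall>W. cut D V W \<longrightarrow> card (boundary D U) \<le> card (boundary D W))"

definition nested :: "'v set \<Rightarrow> 'v set \<Rightarrow> 'v set \<Rightarrow> bool" where
  "nested V A B \<longleftrightarrow> A \<subseteq> B \<or> B \<subseteq> A \<or> A \<inter> B = {} \<or> V \<subseteq> A \<union> B"

definition crossing :: "('v \<times> 'v) set \<Rightarrow> 'v set \<Rightarrow> 'v set \<Rightarrow> 'v set set" where
  "crossing D V U = {W. thin D V W \<and> \<not> nested V U W}"

text \<open>The second minimisation, which singles out a nested family of thin cuts. Since
  \<open>card\<close> is 0 on infinite sets, it relies on \<open>finite_crossing\<close>.\<close>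

definition optimal :: "('v \<times> 'v) set \<Rightarrow> 'v set \<Rightarrow> 'v set \<Rightarrow> bool" where
  "optimal D V U \<longleftrightarrow> thin D V U \<and>
     (\<forall>W. thin D V W \<longrightarrow> card (crossing D V U) \<le> card (crossing D V W))"

text \<open>A connected undirected graph as a symmetric relation. An edge is a pair of opposite
  arcs, of which only the one leaving a set belongs to its boundary; passing to the complement
  reverses the boundary arcs and keeps their number.\<close>

locale connected_relation =
  fixes D :: "('v \<times> 'v) set" and V :: "'v set"
  assumes sym: "sym D" and sub: "D \<subseteq> V \<times> V"
    and conn: "\<And>x y. x \<in> V \<Longrightarrow> y \<in> V \<Longrightarrow> (x, y) \<in> D\<^sup>*"
begin

lemma boundary_Compl: "U \<subseteq> V \<Longrightarrow> boundary D (V - U) = (boundary D U)\<inverse>"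
  using sym sub by (auto simp: boundary_def sym_def)

lemma cut_Compl: "cut D V U \<Longrightarrow> cut D V (V - U)"
  by (auto simp: cut_def boundary_Compl double_diff)

lemma card_boundary_Compl: "U \<subseteq> V \<Longrightarrow> card (boundary D (V - U)) = card (boundary D U)"
  by (simp add: boundary_Compl)

lemma thin_Compl: "thin D V U \<Longrightarrow> thin D V (V - U)"
  using cut_Compl card_boundary_Compl unfolding thin_def by (metis cut_def)

lemma thin_subset: "thin D V U \<Longrightarrow> U \<subseteq> V"
  by (simp add: thin_def cut_def)

lemma thin_finite_boundary: "thin D V U \<Longrightarrow> finite (boundary D U)"
  by (simp add: thin_def cut_def)

lemma thin_card_eq: "thin D V U \<Longrightarrow> thin D V W \<Longrightarrow> card (boundary D U) = card (boundary D W)"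
  by (simp add: thin_def le_antisym)

lemma exists_thin: "cut D V U \<Longrightarrow> \<exists>W. thin D V W"
  using exists_least_iff[of "\<lambda>n. \<exists>W. cut D V W \<and> card (boundary D W) = n"]
  unfolding thin_def by (metis not_le)

lemma exists_optimal: "cut D V U \<Longrightarrow> \<exists>W. optimal D V W"
  using exists_thin[of U] exists_least_iff[of "\<lambda>n. \<exists>W. thin D V W \<and> card (crossing D V W) = n"]
  unfolding optimal_def by (metis not_le)

lemma boundary_nonempty: "U \<subseteq> V \<Longrightarrow> U \<noteq> {} \<Longrightarrow> U \<noteq> V \<Longrightarrow> boundary D U \<noteq> {}"
  using conn rtrancl_crosses_boundary by (metis psubset_imp_ex_mem psubsetI subset_iff DiffE ex_in_conv)

text \<open>If \<open>U\<close> fell apart, its boundary would be the disjoint union of those of a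
  component and of the rest. Both are nonempty because the graph is connected, so both are smaller;
  but one of the pieces is infinite and would be a smaller cut.\<close>

lemma thin_connected:
  assumes U: "thin D V U"
  shows "connected_in D U"
proof (rule ccontr)
  assume "\<not> connected_in D U"
  then obtain x y where xy: "x \<in> U" "y \<in> U" "(x, y) \<notin> (D \<inter> U \<times> U)\<^sup>*"
    by (auto simp: connected_in_def)
  define C where "C = {z\<in>U. (x, z) \<in> (D \<inter> U \<times> U)\<^sup>*}"
  have closed: "w \<in> C" if "z \<in> C" "w \<in> U" "(z, w) \<in> D" for z w
    using that unfolding C_def by (auto intro: rtrancl_into_rtrancl)
  have closed': "w \<in> C" if "z \<in> C" "w \<in> U" "(w, z) \<in> D" for z w
    using closed that sym by (auto simp: sym_def)
  have UV: "U \<subseteq> V" "U \<noteq> V" "infinite U" "infinite (V - U)" "finite (boundary D U)"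
    using U by (auto simp: thin_def cut_def)
  have CU: "C \<subseteq> U" "C \<noteq> {}" "U - C \<noteq> {}" using xy by (auto simp: C_def)
  have "p \<in> boundary D U \<longleftrightarrow> p \<in> boundary D C \<union> boundary D (U - C)" for p
    using closed[of "fst p" "snd p"] closed'[of "snd p" "fst p"] CU(1)
    by (cases p) (auto simp: boundary_def)
  then have eq: "boundary D U = boundary D C \<union> boundary D (U - C)" by blast
  have disj: "boundary D C \<inter> boundary D (U - C) = {}" by (auto simp: boundary_def)
  have ne: "boundary D C \<noteq> {}" "boundary D (U - C) \<noteq> {}"
    using boundary_nonempty[of C] boundary_nonempty[of "U - C"] CU UV by auto
  have fin: "finite (boundary D C)" "finite (boundary D (U - C))" using eq UV(5) by auto
  have "card (boundary D U) = card (boundary D C) + card (boundary D (U - C))"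
    using eq disj fin by (simp add: card_Un_disjoint)
  moreover have "card (boundary D C) > 0" "card (boundary D (U - C)) > 0"
    using ne fin by (auto simp: card_gt_0_iff)
  ultimately have lt: "card (boundary D C) < card (boundary D U)"
      "card (boundary D (U - C)) < card (boundary D U)" by auto
  have "infinite (V - C)" "infinite (V - (U - C))"
    using UV(4) CU(1) by (meson Diff_mono finite_subset order_refl, meson Diff_mono Diff_subset finite_subset order_refl)
  moreover have "infinite C \<or> infinite (U - C)" using UV(3) CU(1) finite_Diff2 by blast
  ultimately have "cut D V C \<or> cut D V (U - C)"
    using fin CU UV(1) by (auto simp: cut_def)
  then show False using lt U by (auto simp: thin_def not_le[symmetric])
qed

lemma thin_in_cuts_through:
  assumes "thin D V U" "thin D V W" "a \<in> W" "b \<in> V - W"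
  shows "W \<in> cuts_through D V (card (boundary D U)) a b"
  using assms thin_connected[OF assms(2)] thin_connected[OF thin_Compl[OF assms(2)]]
    thin_card_eq[OF assms(1,2)]
  by (simp add: cuts_through_def thin_subset thin_finite_boundary)

lemma finite_thin_through:
  assumes "(a, b) \<in> D"
  shows "finite {W. thin D V W \<and> a \<in> W \<and> b \<notin> W}"
proof (cases "\<exists>U. thin D V U")
  case True
  then obtain U where U: "thin D V U" by blast
  have "{W. thin D V W \<and> a \<in> W \<and> b \<notin> W} \<subseteq> cuts_through D V (card (boundary D U)) a b"
    using thin_in_cuts_through[OF U] assms sub by blast
  then show ?thesis using finite_cuts_through[OF sym sub assms] finite_subset by blast
qed auto

lemma finite_thin_separating:
  assumes "x \<in> V" "y \<in> V"
  shows "finite {W. thin D V W \<and> x \<in> W \<and> y \<notin> W}"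
proof -
  obtain Q where Q: "finite Q" "Q \<subseteq> D" "(x, y) \<in> Q\<^sup>*"
    using rtrancl_finite_support conn assms by metis
  have "{W. thin D V W \<and> x \<in> W \<and> y \<notin> W} \<subseteq> (\<Union>p\<in>Q. {W. thin D V W \<and> fst p \<in> W \<and> snd p \<notin> W})"
  proof
    fix W assume W: "W \<in> {W. thin D V W \<and> x \<in> W \<and> y \<notin> W}"
    then have "boundary Q W \<noteq> {}" using rtrancl_crosses_boundary[OF Q(3)] by simp
    then obtain p where "p \<in> boundary Q W" by blast
    then show "W \<in> (\<Union>p\<in>Q. {W. thin D V W \<and> fst p \<in> W \<and> snd p \<notin> W})"
      using W by (intro UN_I[of p]) (auto simp: boundary_def)
  qed
  moreover have "finite (\<Union>p\<in>Q. {W. thin D V W \<and> fst p \<in> W \<and> snd p \<notin> W})"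
    using Q finite_thin_through by (intro finite_UN_I) auto
  ultimately show ?thesis by (rule finite_subset)
qed

text \<open>A thin cut that crosses \<open>U\<close> must separate two endpoints of the boundary of \<open>U\<close>: otherwise
  one of its connected sides would avoid that boundary but meet both sides of \<open>U\<close>.\<close>

lemma finite_crossing:
  assumes U: "thin D V U"
  shows "finite (crossing D V U)"
proof -
  define P where "P = fst ` boundary D U \<union> snd ` boundary D U"
  have P: "finite P" "P \<subseteq> V"
    using thin_finite_boundary[OF U] sub by (auto simp: P_def boundary_def)
  have "crossing D V U \<subseteq> (\<Union>x\<in>P. \<Union>y\<in>P. {W. thin D V W \<and> x \<in> W \<and> y \<notin> W})"
  proof
    fix W assume "W \<in> crossing D V U"
    then have W: "thin D V W" "\<not> nested V U W" by (auto simp: crossing_def)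
    have UW: "U \<subseteq> V" "W \<subseteq> V" using U W thin_subset by auto
    obtain x1 x2 x3 x4 where x: "x1 \<in> W \<inter> U" "x2 \<in> W - U" "x3 \<in> (V - W) \<inter> U" "x4 \<in> (V - W) - U"
      using W(2) UW unfolding nested_def by blast
    have "\<exists>p\<in>W. \<exists>q\<in>W. (p, q) \<in> boundary D U"
      using connected_in_crosses[OF thin_connected[OF W(1)] x(1,2)] .
    moreover have "\<exists>p\<in>V-W. \<exists>q\<in>V-W. (p, q) \<in> boundary D U"
      using connected_in_crosses[OF thin_connected[OF thin_Compl[OF W(1)]] x(3,4)] .
    ultimately show "W \<in> (\<Union>x\<in>P. \<Union>y\<in>P. {W. thin D V W \<and> x \<in> W \<and> y \<notin> W})"
    proof (elim bexE)
      fix p q p' q'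
      assume "p \<in> W" "(p, q) \<in> boundary D U" "p' \<in> V - W" "(p', q') \<in> boundary D U"
      moreover from this have "p \<in> P" "p' \<in> P" unfolding P_def by force+
      ultimately show ?thesis using W(1) by blast
    qed
  qed
  moreover have "finite (\<Union>x\<in>P. \<Union>y\<in>P. {W. thin D V W \<and> x \<in> W \<and> y \<notin> W})"
    using P finite_thin_separating by (intro finite_UN_I) auto
  ultimately show ?thesis by (rule finite_subset)
qed

lemma nested_Compl_right: "A \<subseteq> V \<Longrightarrow> B \<subseteq> V \<Longrightarrow> nested V A (V - B) \<longleftrightarrow> nested V A B"
  by (auto simp: nested_def)

lemma nested_Compl_left: "A \<subseteq> V \<Longrightarrow> B \<subseteq> V \<Longrightarrow> nested V (V - A) B \<longleftrightarrow> nested V A B"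
  by (auto simp: nested_def)

lemma crossing_Compl: "thin D V U \<Longrightarrow> crossing D V (V - U) = crossing D V U"
  by (auto simp: crossing_def nested_Compl_left thin_subset)

lemma optimal_Compl: "optimal D V U \<Longrightarrow> optimal D V (V - U)"
  by (simp add: optimal_def crossing_Compl thin_Compl)

text \<open>Boundary size is submodular: the sizes for the two opposite corners add up to at most
  twice the minimum, while each of them is at least the minimum.\<close>

lemma thin_corners:
  assumes A: "thin D V A" and B: "thin D V B"
    and inf: "infinite (A \<inter> B)" "infinite (V - (A \<union> B))"
  shows "thin D V (A \<inter> B) \<and> thin D V (A \<union> B)"
proof -
  have AB: "A \<subseteq> V" "B \<subseteq> V" "finite (boundary D A)" "finite (boundary D B)"
    using A B by (auto simp: thin_subset thin_finite_boundary)
  have un: "boundary D (A \<inter> B) \<union> boundary D (A \<union> B) \<subseteq> boundary D A \<union> boundary D B"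
    and int: "boundary D (A \<inter> B) \<inter> boundary D (A \<union> B) \<subseteq> boundary D A \<inter> boundary D B"
    by (auto simp: boundary_def)
  have fin: "finite (boundary D (A \<inter> B))" "finite (boundary D (A \<union> B))"
    using un AB by (meson Un_subset_iff finite_UnI finite_subset)+
  have "card (boundary D (A \<inter> B)) + card (boundary D (A \<union> B))
      = card (boundary D (A \<inter> B) \<union> boundary D (A \<union> B)) + card (boundary D (A \<inter> B) \<inter> boundary D (A \<union> B))"
    using fin by (rule card_Un_Int)
  also have "\<dots> \<le> card (boundary D A \<union> boundary D B) + card (boundary D A \<inter> boundary D B)"
    using un int AB by (intro add_mono card_mono) auto
  also have "\<dots> = card (boundary D A) + card (boundary D B)"
    using AB card_Un_Int by metis
  finally have le: "card (boundary D (A \<inter> B)) + card (boundary D (A \<union> B))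
      \<le> card (boundary D A) + card (boundary D B)" .
  have "infinite (A \<union> B)" "infinite (V - (A \<inter> B))"
    using inf by (meson finite_subset inf_le1 le_supI1, meson Diff_mono finite_subset inf_le1 le_supI1 order_refl)
  then have c: "cut D V (A \<inter> B)" "cut D V (A \<union> B)"
    using fin inf AB by (auto simp: cut_def)
  have "card (boundary D A) \<le> card (boundary D (A \<inter> B))" "card (boundary D A) \<le> card (boundary D (A \<union> B))"
    "card (boundary D B) = card (boundary D A)"
    using A c thin_card_eq[OF B A] by (auto simp: thin_def)
  then have "card (boundary D (A \<inter> B)) = card (boundary D A)" "card (boundary D (A \<union> B)) = card (boundary D A)"
    using le by auto
  then show ?thesis using c A by (auto simp: thin_def)
qed

text \<open>A cut crossing one of the corners crosses \<open>A\<close> or \<open>B\<close>, and a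
  cut crossing both corners crosses both \<open>A\<close> and \<open>B\<close>. The inequality is
  strict because \<open>B\<close> crosses \<open>A\<close> but neither corner.\<close>

lemma crossing_corners:
  assumes A: "thin D V A" and B: "thin D V B" and AB: "\<not> nested V A B"
    and inf: "infinite (A \<inter> B)" "infinite (V - (A \<union> B))"
  shows "card (crossing D V (A \<inter> B)) + card (crossing D V (A \<union> B))
       < card (crossing D V A) + card (crossing D V B)"
proof -
  have AV: "A \<subseteq> V" "B \<subseteq> V" using A B thin_subset by auto
  have n1: "nested V (A \<inter> B) W" "nested V (A \<union> B) W" if "nested V A W" "nested V B W" for W
    using that AB AV unfolding nested_def by blast+
  have n2: "nested V (A \<inter> B) W \<or> nested V (A \<union> B) W" if "nested V A W \<or> nested V B W" for W
    using that AV unfolding nested_def by blast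
  let ?X = "crossing D V"
  have thins: "thin D V (A \<inter> B)" "thin D V (A \<union> B)" using thin_corners[OF A B inf] by auto
  have fin: "finite (?X A)" "finite (?X B)" "finite (?X (A \<inter> B))" "finite (?X (A \<union> B))"
    using finite_crossing A B thins by auto
  have un: "?X (A \<inter> B) \<union> ?X (A \<union> B) \<subseteq> ?X A \<union> ?X B" using n1 by (auto simp: crossing_def)
  have int: "?X (A \<inter> B) \<inter> ?X (A \<union> B) \<subseteq> ?X A \<inter> ?X B" using n2 by (auto simp: crossing_def)
  have "B \<in> ?X A" "B \<notin> ?X (A \<inter> B)" "B \<notin> ?X (A \<union> B)"
    using AB B by (auto simp: crossing_def nested_def)
  then have "card (?X (A \<inter> B) \<union> ?X (A \<union> B)) < card (?X A \<union> ?X B)"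
    using un fin by (intro psubset_card_mono) auto
  moreover have "card (?X (A \<inter> B) \<inter> ?X (A \<union> B)) \<le> card (?X A \<inter> ?X B)"
    using int fin by (intro card_mono) auto
  ultimately show ?thesis
    using card_Un_Int[OF fin(1,2)] card_Un_Int[OF fin(3,4)] by linarith
qed

lemma optimal_nested_aux:
  assumes "optimal D V A" "optimal D V B" "infinite (A \<inter> B)" "infinite (V - (A \<union> B))"
  shows "nested V A B"
proof (rule ccontr)
  assume n: "\<not> nested V A B"
  have t: "thin D V A" "thin D V B" using assms by (auto simp: optimal_def)
  have "thin D V (A \<inter> B)" "thin D V (A \<union> B)" using thin_corners[OF t assms(3,4)] by auto
  then have "card (crossing D V A) \<le> card (crossing D V (A \<inter> B))"
    "card (crossing D V B) \<le> card (crossing D V (A \<union> B))"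
    using assms(1,2) by (auto simp: optimal_def)
  then show False using crossing_corners[OF t n assms(3,4)] by linarith
qed

text \<open>If one of the two opposite corners is finite, then \<open>A - B\<close> and
  \<open>B - A\<close> are both infinite, since \<open>A\<close>, \<open>B\<close> and their
  complements are. The uncrossing argument then applies with \<open>B\<close> replaced by its
  complement.\<close>

theorem optimal_nested:
  assumes A: "optimal D V A" and B: "optimal D V B"
  shows "nested V A B"
proof (cases "infinite (A \<inter> B) \<and> infinite (V - (A \<union> B))")
  case True
  then show ?thesis using optimal_nested_aux assms by blast
next
  case False
  have AV: "A \<subseteq> V" "B \<subseteq> V" and inf: "infinite A" "infinite B" "infinite (V - A)" "infinite (V - B)"
    using A B by (auto simp: optimal_def thin_def cut_def)
  have "A = (A \<inter> B) \<union> (A - B)" "B = (A \<inter> B) \<union> (B - A)" "V - A = (V - (A \<union> B)) \<union> (B - A)"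
    "V - B = (V - (A \<union> B)) \<union> (A - B)" using AV by auto
  then have "infinite (A - B) \<and> infinite (B - A)"
    using False inf by (metis finite_UnI)
  moreover have "A - B = A \<inter> (V - B)" "B - A = V - (A \<union> (V - B))" using AV by auto
  ultimately have "nested V A (V - B)"
    using optimal_nested_aux[OF A optimal_Compl[OF B]] by simp
  then show ?thesis using nested_Compl_right AV by blast
qed

end

section \<open>Cayley graphs and hyperbolic elements\<close>

context group
begin

section \<open>Left translates of subsets\<close>

lemma mem_l_coset_iff:
  assumes "x \<in> carrier G" "A \<subseteq> carrier G"
  shows "y \<in> x <# A \<longleftrightarrow> y \<in> carrier G \<and> inv x \<otimes> y \<in> A"
proof
  assume "y \<in> x <# A"
  then obtain a where "a \<in> A" "y = x \<otimes> a" by (auto simp: l_coset_def)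
  then show "y \<in> carrier G \<and> inv x \<otimes> y \<in> A" using assms by (auto simp: m_assoc[symmetric])
next
  assume y: "y \<in> carrier G \<and> inv x \<otimes> y \<in> A"
  then have "y = x \<otimes> (inv x \<otimes> y)" using assms by (simp add: m_assoc[symmetric])
  then show "y \<in> x <# A" using y by (auto simp: l_coset_def)
qed

lemma mult_mem_l_coset_iff:
  assumes "x \<in> carrier G" "A \<subseteq> carrier G" "y \<in> carrier G"
  shows "x \<otimes> y \<in> x <# A \<longleftrightarrow> y \<in> A"
  using assms by (simp add: mem_l_coset_iff m_assoc[symmetric])

lemma l_coset_Compl:
  assumes "x \<in> carrier G" "A \<subseteq> carrier G"
  shows "x <# (carrier G - A) = carrier G - (x <# A)"
  using assms by (auto simp: mem_l_coset_iff)

lemma l_coset_mono_iff: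
  assumes "x \<in> carrier G" "A \<subseteq> carrier G" "B \<subseteq> carrier G"
  shows "x <# A \<subseteq> x <# B \<longleftrightarrow> A \<subseteq> B"
proof
  assume sub: "x <# A \<subseteq> x <# B"
  show "A \<subseteq> B"
  proof
    fix a assume "a \<in> A"
    moreover from this have "a \<in> carrier G" using assms by blast
    ultimately show "a \<in> B"
      using sub assms mult_mem_l_coset_iff[of x A a] mult_mem_l_coset_iff[of x B a] by blast
  qed
qed (auto simp: l_coset_def)

lemma l_coset_eq_iff:
  assumes "x \<in> carrier G" "A \<subseteq> carrier G" "B \<subseteq> carrier G"
  shows "x <# A = x <# B \<longleftrightarrow> A = B"
  using l_coset_mono_iff[OF assms] l_coset_mono_iff[OF assms(1,3,2)] by auto

lemma l_coset_psubset_iff: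
  assumes "x \<in> carrier G" "A \<subseteq> carrier G" "B \<subseteq> carrier G"
  shows "x <# A \<subset> x <# B \<longleftrightarrow> A \<subset> B"
  using l_coset_mono_iff[OF assms] l_coset_eq_iff[OF assms] by auto

lemma l_coset_inv_cancel:
  assumes "x \<in> carrier G" "A \<subseteq> carrier G"
  shows "x <# (inv x <# A) = A" "inv x <# (x <# A) = A"
  using assms by (auto simp: lcos_m_assoc lcos_mult_one)

lemma inv_l_coset_subset_iff:
  assumes "x \<in> carrier G" "A \<subseteq> carrier G" "B \<subseteq> carrier G"
  shows "inv x <# A \<subseteq> B \<longleftrightarrow> A \<subseteq> x <# B"
  using l_coset_mono_iff[of x "inv x <# A" B] assms l_coset_inv_cancel l_coset_subset_G by simp

lemma inv_l_coset_eq_iff: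
  assumes "x \<in> carrier G" "A \<subseteq> carrier G" "B \<subseteq> carrier G"
  shows "inv x <# A = B \<longleftrightarrow> A = x <# B"
  using assms l_coset_inv_cancel by auto

lemma inv_l_coset_psubset_iff:
  assumes "x \<in> carrier G" "A \<subseteq> carrier G" "B \<subseteq> carrier G"
  shows "inv x <# A \<subset> B \<longleftrightarrow> A \<subset> x <# B"
  using inv_l_coset_subset_iff[OF assms] inv_l_coset_eq_iff[OF assms] by auto

lemma inj_on_mult_left: "x \<in> carrier G \<Longrightarrow> inj_on ((\<otimes>) x) (carrier G)"
  by (auto simp: inj_on_def)

lemma l_coset_image: "x <# A = (\<otimes>) x ` A"
  by (auto simp: l_coset_def)

lemma finite_l_coset_iff:
  assumes "x \<in> carrier G" "A \<subseteq> carrier G"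
  shows "finite (x <# A) \<longleftrightarrow> finite A"
  unfolding l_coset_image using inj_on_mult_left[OF assms(1)] assms(2)
  by (meson finite_image_iff inj_on_subset)

end

section \<open>Left translation of cuts in a Cayley graph\<close>

locale cayley_group = group G for G (structure) +
  fixes S :: "'a set"
  assumes gens_finite: "finite S" and gens_sub: "S \<subseteq> carrier G"
    and gens_inv: "s \<in> S \<Longrightarrow> inv s \<in> S" and gens_generate: "generate G S = carrier G"
begin

lemma gens_closed [simp]: "s \<in> S \<Longrightarrow> s \<in> carrier G"
  using gens_sub by blast

text \<open>Generators act on the right, so left translations are automorphisms of the graph and
  permute its thin and its optimal cuts.\<close>

definition arcs :: "('a \<times> 'a) set" where
  "arcs = {(x, x \<otimes> s) | x s. x \<in> carrier G \<and> s \<in> S}"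

lemma arcs_mem: "(x, y) \<in> arcs \<longleftrightarrow> x \<in> carrier G \<and> y \<in> carrier G \<and> inv x \<otimes> y \<in> S"
proof
  assume "x \<in> carrier G \<and> y \<in> carrier G \<and> inv x \<otimes> y \<in> S"
  moreover from this have "y = x \<otimes> (inv x \<otimes> y)" by (simp add: m_assoc[symmetric])
  ultimately show "(x, y) \<in> arcs" unfolding arcs_def by blast
qed (auto simp: arcs_def m_assoc[symmetric])

lemma arcs_translate:
  assumes "z \<in> carrier G" "x \<in> carrier G" "y \<in> carrier G"
  shows "(z \<otimes> x, z \<otimes> y) \<in> arcs \<longleftrightarrow> (x, y) \<in> arcs"
proof -
  have "inv (z \<otimes> x) \<otimes> (z \<otimes> y) = inv x \<otimes> y"
    using assms by (simp add: inv_mult_group m_assoc) (simp add: m_assoc[symmetric])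
  then show ?thesis using assms by (simp add: arcs_mem)
qed

lemma arcs_rtrancl: "x \<in> generate G S \<Longrightarrow> y \<in> carrier G \<Longrightarrow> (y, y \<otimes> x) \<in> arcs\<^sup>*"
proof (induction arbitrary: y rule: generate.induct)
  case (incl h)
  then show ?case by (intro r_into_rtrancl) (auto simp: arcs_def)
next
  case (inv h)
  then show ?case using gens_inv[of h] by (intro r_into_rtrancl) (auto simp: arcs_def)
next
  case (eng h1 h2)
  have h: "h1 \<in> carrier G" "h2 \<in> carrier G" using eng.hyps gens_generate by auto
  have "(y, y \<otimes> h1) \<in> arcs\<^sup>*" "(y \<otimes> h1, y \<otimes> h1 \<otimes> h2) \<in> arcs\<^sup>*"
    using eng h by auto
  then show ?case using eng.prems h by (simp add: m_assoc)
qed auto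

sublocale arcs: connected_relation arcs "carrier G"
proof
  show "sym arcs"
  proof (rule symI)
    fix x y assume "(x, y) \<in> arcs"
    then have xy: "x \<in> carrier G" "y \<in> carrier G" "inv x \<otimes> y \<in> S" by (auto simp: arcs_mem)
    then have "inv y \<otimes> x \<in> S" using gens_inv[OF xy(3)] by (simp add: inv_mult_group)
    then show "(y, x) \<in> arcs" using xy by (simp add: arcs_mem)
  qed
  show "arcs \<subseteq> carrier G \<times> carrier G" by (auto simp: arcs_mem)
  fix x y assume xy: "x \<in> carrier G" "y \<in> carrier G"
  then have "(x, x \<otimes> (inv x \<otimes> y)) \<in> arcs\<^sup>*"
    using gens_generate by (intro arcs_rtrancl) auto
  then show "(x, y) \<in> arcs\<^sup>*" using xy by (simp add: m_assoc[symmetric])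
qed

abbreviation "bd \<equiv> boundary arcs"
abbreviation "thin_cut \<equiv> thin arcs (carrier G)"
abbreviation "optimal_cut \<equiv> optimal arcs (carrier G)"

lemma boundary_l_coset:
  assumes "x \<in> carrier G" "A \<subseteq> carrier G"
  shows "bd (x <# A) = map_prod ((\<otimes>) x) ((\<otimes>) x) ` bd A"
proof (intro equalityI subsetI)
  fix p assume "p \<in> bd (x <# A)"
  then obtain u v where p: "p = (u, v)" "(u, v) \<in> arcs" "u \<in> x <# A" "v \<notin> x <# A"
    by (auto simp: boundary_def)
  then have uv: "u \<in> carrier G" "v \<in> carrier G" by (auto simp: arcs_mem)
  have e: "u = x \<otimes> (inv x \<otimes> u)" "v = x \<otimes> (inv x \<otimes> v)"
    using uv assms by (auto simp: m_assoc[symmetric])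
  then have "(inv x \<otimes> u, inv x \<otimes> v) \<in> arcs"
    using p(2) arcs_translate[of x "inv x \<otimes> u" "inv x \<otimes> v"] uv assms(1) by simp
  then have "(inv x \<otimes> u, inv x \<otimes> v) \<in> bd A"
    using p uv assms by (auto simp: boundary_def mem_l_coset_iff)
  then have "map_prod ((\<otimes>) x) ((\<otimes>) x) (inv x \<otimes> u, inv x \<otimes> v) \<in> map_prod ((\<otimes>) x) ((\<otimes>) x) ` bd A"
    by (rule imageI)
  then show "p \<in> map_prod ((\<otimes>) x) ((\<otimes>) x) ` bd A" using e p(1) by simp
next
  fix p assume "p \<in> map_prod ((\<otimes>) x) ((\<otimes>) x) ` bd A"
  then obtain u v where p: "p = (x \<otimes> u, x \<otimes> v)" "(u, v) \<in> arcs" "u \<in> A" "v \<notin> A"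
    by (auto simp: boundary_def)
  then have uv: "u \<in> carrier G" "v \<in> carrier G" by (auto simp: arcs_mem)
  show "p \<in> bd (x <# A)"
    using p uv assms by (simp add: boundary_def arcs_translate mult_mem_l_coset_iff)
qed

lemma card_boundary_l_coset:
  assumes "x \<in> carrier G" "A \<subseteq> carrier G"
  shows "card (bd (x <# A)) = card (bd A)"
    and "finite (bd (x <# A)) \<longleftrightarrow> finite (bd A)"
proof -
  have "inj_on (map_prod ((\<otimes>) x) ((\<otimes>) x)) (carrier G \<times> carrier G)"
    using inj_on_mult_left[OF assms(1)] by (intro map_prod_inj_on)
  moreover have "bd A \<subseteq> carrier G \<times> carrier G"
    using arcs.sub boundary_subset by fast
  ultimately have "inj_on (map_prod ((\<otimes>) x) ((\<otimes>) x)) (bd A)" by (rule inj_on_subset)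
  then show "card (bd (x <# A)) = card (bd A)" "finite (bd (x <# A)) \<longleftrightarrow> finite (bd A)"
    unfolding boundary_l_coset[OF assms] by (auto simp: card_image finite_image_iff)
qed

lemma cut_l_coset:
  assumes "x \<in> carrier G" "cut arcs (carrier G) A"
  shows "cut arcs (carrier G) (x <# A)"
  using assms finite_l_coset_iff[of x A] finite_l_coset_iff[of x "carrier G - A"]
    card_boundary_l_coset[of x A] l_coset_subset_G[of A x]
  by (auto simp: cut_def l_coset_Compl)

lemma thin_l_coset:
  assumes "x \<in> carrier G" "thin_cut A"
  shows "thin_cut (x <# A)"
  using assms cut_l_coset[of x A] card_boundary_l_coset[of x A] by (simp add: thin_def cut_def)

lemma nested_l_coset:
  assumes "x \<in> carrier G" "A \<subseteq> carrier G" "B \<subseteq> carrier G"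
  shows "nested (carrier G) (x <# A) (x <# B) \<longleftrightarrow> nested (carrier G) A B"
proof -
  have "A \<inter> B = {} \<longleftrightarrow> A \<subseteq> carrier G - B" "carrier G \<subseteq> A \<union> B \<longleftrightarrow> carrier G - A \<subseteq> B"
    using assms by auto
  moreover have "(x <# A) \<inter> (x <# B) = {} \<longleftrightarrow> x <# A \<subseteq> x <# (carrier G - B)"
    "carrier G \<subseteq> (x <# A) \<union> (x <# B) \<longleftrightarrow> x <# (carrier G - A) \<subseteq> x <# B"
    using assms by (auto simp: l_coset_Compl mem_l_coset_iff)
  ultimately show ?thesis using assms by (simp add: nested_def l_coset_mono_iff)
qed

lemma crossing_l_coset:
  assumes "x \<in> carrier G" "thin_cut A"
  shows "card (crossing arcs (carrier G) (x <# A)) = card (crossing arcs (carrier G) A)"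
proof -
  have A: "A \<subseteq> carrier G" using assms(2) by (rule arcs.thin_subset)
  have "bij_betw (\<lambda>B. x <# B) (crossing arcs (carrier G) A) (crossing arcs (carrier G) (x <# A))"
  proof (rule bij_betwI')
    fix B C assume "B \<in> crossing arcs (carrier G) A" "C \<in> crossing arcs (carrier G) A"
    then show "(x <# B = x <# C) = (B = C)"
      using assms(1) by (auto simp: crossing_def l_coset_eq_iff arcs.thin_subset)
  next
    fix B assume "B \<in> crossing arcs (carrier G) A"
    then show "x <# B \<in> crossing arcs (carrier G) (x <# A)"
      using assms A by (auto simp: crossing_def nested_l_coset arcs.thin_subset thin_l_coset)
  next
    fix C assume C: "C \<in> crossing arcs (carrier G) (x <# A)"
    then have thinC: "thin_cut C" by (simp add: crossing_def)
    have C': "C \<subseteq> carrier G" using thinC by (rule arcs.thin_subset)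
    have sub: "inv x <# C \<subseteq> carrier G" using C' assms(1) by (simp add: l_coset_subset_G)
    have e: "x <# (inv x <# C) = C" using l_coset_inv_cancel assms(1) C' by blast
    have "thin_cut (inv x <# C)" using thin_l_coset thinC assms(1) by simp
    moreover have "\<not> nested (carrier G) A (inv x <# C)"
      using nested_l_coset[OF assms(1) A sub] C e by (simp add: crossing_def)
    ultimately have "inv x <# C \<in> crossing arcs (carrier G) A" by (simp add: crossing_def)
    then show "\<exists>B\<in>crossing arcs (carrier G) A. C = x <# B" using e by metis
  qed
  then show ?thesis by (simp add: bij_betw_same_card)
qed

lemma optimal_l_coset:
  assumes "x \<in> carrier G" "optimal_cut A"
  shows "optimal_cut (x <# A)"
  using assms by (simp add: optimal_def thin_l_coset crossing_l_coset)

lemma optimal_subset: "optimal_cut A \<Longrightarrow> A \<subseteq> carrier G"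
  by (simp add: optimal_def arcs.thin_subset)

definition stabilizer :: "'a set \<Rightarrow> 'a set" where
  "stabilizer A = {x \<in> carrier G. x <# A = A}"

text \<open>The stabilizer permutes the finitely many boundary arcs freely.\<close>

lemma finite_stabilizer:
  assumes "thin_cut A"
  shows "finite (stabilizer A)"
proof -
  have A: "A \<subseteq> carrier G" "finite (bd A)" "A \<noteq> {}" "A \<noteq> carrier G"
    using assms by (auto simp: thin_def cut_def)
  then obtain a b where ab: "(a, b) \<in> bd A"
    using arcs.boundary_nonempty[of A] by fast
  then have a: "a \<in> carrier G" using A by (auto simp: boundary_def)
  have "(\<lambda>x. x \<otimes> a) ` stabilizer A \<subseteq> fst ` bd A"
  proof
    fix y assume "y \<in> (\<lambda>x. x \<otimes> a) ` stabilizer A"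
    then obtain x where x: "x \<in> carrier G" "x <# A = A" "y = x \<otimes> a" by (auto simp: stabilizer_def)
    have "map_prod ((\<otimes>) x) ((\<otimes>) x) (a, b) \<in> bd A"
      using boundary_l_coset[OF x(1) A(1)] ab x(2) by (metis imageI)
    then show "y \<in> fst ` bd A" using x(3) by force
  qed
  moreover have "inj_on (\<lambda>x. x \<otimes> a) (stabilizer A)"
    using a by (auto simp: inj_on_def stabilizer_def)
  ultimately show ?thesis using A(2) by (meson finite_imageD finite_imageI finite_subset)
qed

section \<open>Serre's lemma for the tree of optimal cuts\<close>

definition short_elts :: "'a set" where
  "short_elts = S \<union> {s \<otimes> t | s t. s \<in> S \<and> t \<in> S}"

lemma short_elts_closed: "x \<in> short_elts \<Longrightarrow> x \<in> carrier G"
  by (auto simp: short_elts_def)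

lemma gens_short: "s \<in> S \<Longrightarrow> s \<in> short_elts"
  by (auto simp: short_elts_def)

text \<open>Think of optimal cuts as oriented tree edges, each pointing to its own side. Siblings
  are distinct edges that point away from a common vertex: their sides are disjoint and no further
  edge lies between them.\<close>

definition siblings :: "'a set \<Rightarrow> 'a set \<Rightarrow> bool" where
  "siblings A B \<longleftrightarrow> A \<subset> carrier G - B \<and>
     \<not> (\<exists>E. optimal_cut E \<and> A \<subset> E \<and> E \<subset> carrier G - B)"

lemma siblings_l_coset:
  assumes "x \<in> carrier G" "A \<subseteq> carrier G" "B \<subseteq> carrier G" "siblings A B"
  shows "siblings (x <# A) (x <# B)"
proof -
  have B: "carrier G - B \<subseteq> carrier G" by blast
  have "\<not> (optimal_cut E \<and> x <# A \<subset> E \<and> E \<subset> carrier G - (x <# B))" for E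
  proof
    assume E: "optimal_cut E \<and> x <# A \<subset> E \<and> E \<subset> carrier G - (x <# B)"
    then have EG: "E \<subseteq> carrier G" by (simp add: optimal_subset)
    let ?E = "inv x <# E"
    have sub: "?E \<subseteq> carrier G" using EG assms(1) by (simp add: l_coset_subset_G)
    have e: "x <# ?E = E" using EG assms(1) l_coset_inv_cancel by blast
    have "optimal_cut ?E" using optimal_l_coset E assms(1) by simp
    moreover have "A \<subset> ?E" using E e l_coset_psubset_iff[OF assms(1,2) sub] by simp
    moreover have "?E \<subset> carrier G - B"
      using E e l_coset_psubset_iff[OF assms(1) sub B] assms by (simp add: l_coset_Compl)
    ultimately show False using assms(4) by (auto simp: siblings_def)
  qed
  then show ?thesis
    using assms l_coset_psubset_iff[OF assms(1,2) B] by (simp add: siblings_def l_coset_Compl)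
qed

lemma siblings_sym:
  assumes "A \<subseteq> carrier G" "B \<subseteq> carrier G" "siblings A B"
  shows "siblings B A"
proof -
  have "\<not> (optimal_cut E \<and> B \<subset> E \<and> E \<subset> carrier G - A)" for E
  proof
    assume E: "optimal_cut E \<and> B \<subset> E \<and> E \<subset> carrier G - A"
    then have "optimal_cut (carrier G - E)" "A \<subset> carrier G - E" "carrier G - E \<subset> carrier G - B"
      using assms optimal_subset[of E] by (auto simp: arcs.optimal_Compl)
    then show False using assms(3) by (auto simp: siblings_def)
  qed
  then show ?thesis using assms by (auto simp: siblings_def)
qed

text \<open>All edges start at the vertex where \<open>B\<close> starts. A cut \<open>E\<close>
  between \<open>A\<close> and the complement of \<open>C\<close> is nested with \<open>B\<close>,
  so it would come between \<open>A\<close> and the complement of \<open>B\<close>, or between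
  \<open>B\<close> and the complement of \<open>C\<close>, unless it violates disjointness
  outright.\<close>

lemma siblings_trans:
  assumes A: "optimal_cut A" and B: "optimal_cut B" and C: "optimal_cut C"
    and AB: "siblings A B" and BC: "siblings B C"
  shows "A = C \<or> siblings A C"
proof -
  have sub: "A \<subseteq> carrier G" "B \<subseteq> carrier G" "C \<subseteq> carrier G"
    using A B C by (auto simp: optimal_subset)
  have ne: "A \<noteq> {}" "B \<noteq> {}" "C \<noteq> {}"
    using A B C by (auto simp: optimal_def thin_def cut_def)
  have no1: "\<And>E. optimal_cut E \<Longrightarrow> A \<subset> E \<Longrightarrow> E \<subset> carrier G - B \<Longrightarrow> False"
    and AB': "A \<subset> carrier G - B" using AB by (auto simp: siblings_def)
  have no2: "\<And>E. optimal_cut E \<Longrightarrow> C \<subset> E \<Longrightarrow> E \<subset> carrier G - B \<Longrightarrow> False"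
    and CB': "C \<subset> carrier G - B"
    using siblings_sym[OF sub(2,3) BC] by (auto simp: siblings_def)
  have n: "\<not> A \<subset> C" using no1[OF C] CB' by blast
  have n': "\<not> C \<subset> A" using no2[OF A] AB' by blast
  have "\<not> carrier G \<subseteq> A \<union> C" using AB' CB' ne(2) sub(2) by blast
  moreover have "nested (carrier G) A C" using arcs.optimal_nested A C by blast
  ultimately have AC: "A = C \<or> A \<inter> C = {}" using n n' by (auto simp: nested_def)
  have "siblings A C" if ac: "A \<inter> C = {}"
  proof -
    have 1: "A \<subset> carrier G - C"
    proof -
      have "A \<noteq> carrier G - C" using AB' CB' sub ne(2) by blast
      then show ?thesis using ac sub by blast
    qed
    have "\<not> (optimal_cut E \<and> A \<subset> E \<and> E \<subset> carrier G - C)" for E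
    proof
      assume E: "optimal_cut E \<and> A \<subset> E \<and> E \<subset> carrier G - C"
      then have nes: "nested (carrier G) B E" using arcs.optimal_nested B by blast
      consider "E \<subseteq> B" | "B \<subset> E" | "B \<inter> E = {}" "E \<noteq> carrier G - B" | "E = carrier G - B"
        | "carrier G \<subseteq> B \<union> E"
        using nes by (auto simp: nested_def)
      then show False
      proof cases
        case 1
        then show False using E AB' ne(1) by blast
      next
        case 2
        then show False using E BC by (auto simp: siblings_def)
      next
        case 3
        then show False using E no1[of E] sub optimal_subset[of E] by blast
      next
        case 4
        then show False using E CB' ne(3) by blast
      next
        case 5
        then show False using E CB' ne(3) by blast
      qed
    qed
    then show ?thesis using 1 by (auto simp: siblings_def)
  qed
  then show ?thesis using AC by blast
qed

text \<open>Letters are added in front because the group acts on cuts from the left: the translate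
  by \<open>s \<otimes> x\<close> is the translate by \<open>s\<close> of the one already known for
  \<open>x\<close>.\<close>

lemma generate_induct_left [consumes 1, case_names one mult]:
  assumes "x \<in> carrier G" "P \<one>"
    and step: "\<And>s x. s \<in> S \<Longrightarrow> x \<in> carrier G \<Longrightarrow> P x \<Longrightarrow> P (s \<otimes> x)"
  shows "P x"
proof -
  have "\<forall>y\<in>carrier G. P y \<longrightarrow> P (x \<otimes> y)" if "x \<in> generate G S" for x
    using that
  proof (induction rule: generate.induct)
    case (inv h)
    then show ?case using step gens_inv by blast
  next
    case (eng h1 h2)
    then have "h1 \<in> carrier G" "h2 \<in> carrier G" using gens_generate by auto
    then show ?case using eng.IH by (auto simp: m_assoc)
  qed (use step in auto)
  then show ?thesis using assms(1,2) gens_generate by force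
qed

text \<open>A group acting on a tree without inversions, all of whose generators and products of two
  generators are elliptic, fixes a vertex (Serre).  Here \<open>W\<close> is the last cut, of those met before
  the midpoints, on the way from \<open>\<one>\<close> to its neighbours, and the siblings of \<open>W\<close> are the tree
  edges at the vertex that turns out to be fixed.\<close>

theorem exists_short_hyperbolic:
  assumes opt: "optimal_cut E0"
  shows "\<exists>g\<in>short_elts. \<exists>E. optimal_cut E \<and> g <# E \<subset> E"
proof (rule ccontr)
  assume "\<not> ?thesis"
  then have nh: "\<not> g <# E \<subset> E" if "g \<in> short_elts" "optimal_cut E" for g E using that by blast
  have nh1: "\<not> s <# E \<subset> E" "\<not> E \<subset> s <# E" if "s \<in> S" "optimal_cut E" for s E
  proof -
    show "\<not> s <# E \<subset> E" using nh gens_short that by blast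
    show "\<not> E \<subset> s <# E"
      using nh[of "inv s" E] that gens_inv gens_short inv_l_coset_psubset_iff[of s E E]
      by (auto simp: optimal_subset)
  qed
  \<comment> \<open>Here the products of two generators enter: such an inclusion would make
    \<open>inv t \<otimes> s\<close> hyperbolic.\<close>
  have nh2: "\<not> s <# E \<subset> t <# E" if "s \<in> S" "t \<in> S" "optimal_cut E" for s t E
  proof
    assume "s <# E \<subset> t <# E"
    then have "inv t <# (s <# E) \<subset> E"
      using inv_l_coset_psubset_iff[of t "s <# E" E] that by (simp add: optimal_subset l_coset_subset_G)
    moreover have "inv t <# (s <# E) = (inv t \<otimes> s) <# E"
      using that by (simp add: lcos_m_assoc optimal_subset)
    moreover have "inv t \<otimes> s \<in> short_elts" using that gens_inv by (auto simp: short_elts_def)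
    ultimately show False using nh that(3) by metis
  qed
  \<comment> \<open>As \<open>s <# W\<close> is the image of the edge \<open>W\<close>, disjointness
    places \<open>W\<close> in the first half of the tree path from \<one> to \<open>s\<close>. The
    midpoint is included: there \<open>s <# W\<close> is the complement of \<open>W\<close>.\<close>
  define M where "M = {W. optimal_cut W \<and> \<one> \<in> W \<and> (\<exists>s\<in>S. s \<notin> W \<and> W \<inter> (s <# W) = {})}"
  have dich: "W \<inter> (s <# W) = {} \<or> carrier G \<subseteq> W \<union> (s <# W)"
    if W: "optimal_cut W" "\<one> \<in> W" "s \<in> S" "s \<notin> W" for s W
  proof -
    have "nested (carrier G) W (s <# W)"
      using arcs.optimal_nested optimal_l_coset W by simp
    moreover have "s \<in> s <# W"
      using W mult_mem_l_coset_iff[of s W \<one>] by (simp add: optimal_subset)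
    ultimately show ?thesis using nh1[OF W(3,1)] W(4) by (auto simp: nested_def)
  qed
  text \<open>Reflecting a cut behind the midpoint gives one before it.\<close>
  have flip: "inv s <# (carrier G - W) \<in> M \<and> inv s <# (carrier G - W) \<subseteq> W"
    if W: "optimal_cut W" "\<one> \<in> W" "s \<in> S" "s \<notin> W" "carrier G \<subseteq> W \<union> (s <# W)" for s W
  proof -
    let ?W = "inv s <# (carrier G - W)"
    have WG: "W \<subseteq> carrier G" using W(1) by (rule optimal_subset)
    have 1: "?W \<subseteq> W" using W WG inv_l_coset_subset_iff[of s "carrier G - W" W] by auto
    have 2: "s <# ?W = carrier G - W" using W l_coset_inv_cancel[of s "carrier G - W"] by simp
    have 3: "optimal_cut ?W" using W by (simp add: optimal_l_coset arcs.optimal_Compl)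
    have 4: "\<one> \<in> ?W" using W by (simp add: mem_l_coset_iff)
    show ?thesis using 1 2 3 4 W(3,4) by (auto simp: M_def)
  qed
  have "E0 \<subseteq> carrier G" "E0 \<noteq> {}" "E0 \<noteq> carrier G"
    using opt by (auto simp: optimal_def thin_def cut_def)
  then obtain a b where ab: "a \<in> E0" "b \<notin> E0" "(a, b) \<in> arcs"
    using arcs.boundary_nonempty[of E0] by (auto simp: boundary_def)
  have "M \<noteq> {}"
  proof -
    let ?W = "inv a <# E0" and ?s = "inv a \<otimes> b"
    have ab': "a \<in> carrier G" "b \<in> carrier G" "?s \<in> S" using ab by (auto simp: arcs_mem)
    have "optimal_cut ?W" using opt ab' by (simp add: optimal_l_coset)
    moreover have "\<one> \<in> ?W" using ab ab' opt by (simp add: mem_l_coset_iff optimal_subset)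
    moreover have "?s \<notin> ?W"
      using ab ab' opt mult_mem_l_coset_iff[of "inv a" E0 b] by (simp add: optimal_subset)
    ultimately show ?thesis using dich[of ?W ?s] flip[of ?W ?s] ab'(3) by (auto simp: M_def)
  qed
  moreover have "finite M"
  proof -
    have "M \<subseteq> (\<Union>s\<in>S. {W. thin_cut W \<and> \<one> \<in> W \<and> s \<notin> W})" by (auto simp: M_def optimal_def)
    moreover have "finite (\<Union>s\<in>S. {W. thin_cut W \<and> \<one> \<in> W \<and> s \<notin> W})"
      using gens_finite arcs.finite_thin_separating by (intro finite_UN_I) auto
    ultimately show ?thesis by (rule finite_subset)
  qed
  ultimately obtain W where WM: "W \<in> M" and max: "\<And>E. E \<in> M \<Longrightarrow> \<not> W \<subset> E"
    using finite_has_maximal[of M] by blast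
  then obtain s0 where W: "optimal_cut W" "\<one> \<in> W" and s0: "s0 \<in> S" "s0 \<notin> W" "W \<inter> (s0 <# W) = {}"
    by (auto simp: M_def)
  have WG: "W \<subseteq> carrier G" using W(1) by (rule optimal_subset)
  have Wne: "W \<noteq> {}" "infinite W" using W(1) by (auto simp: optimal_def thin_def cut_def)
  have fin: "finite (stabilizer W)" using W(1) by (simp add: finite_stabilizer optimal_def)
  \<comment> \<open>\<open>W\<close> was obtained from \<open>s0\<close> alone. If \<open>W\<close>
    and \<open>t <# W\<close> covered everything for another \<open>t\<close>, then
    \<open>t <# W\<close> would contain \<open>s0 <# W\<close>; by \<open>nh2\<close> the two
    coincide and are the complement of \<open>W\<close>.\<close>
  have tW: "t <# W = W \<or> W \<inter> (t <# W) = {}" if t: "t \<in> S" for t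
  proof -
    have tG: "t <# W \<subseteq> carrier G" "s0 <# W \<subseteq> carrier G" using t s0 WG by (auto simp: l_coset_subset_G)
    have "nested (carrier G) W (t <# W)" using arcs.optimal_nested optimal_l_coset W t by simp
    then consider "t <# W = W" | "W \<inter> (t <# W) = {}" | "carrier G \<subseteq> W \<union> (t <# W)"
      using nh1[OF t W(1)] by (auto simp: nested_def)
    then show ?thesis
    proof cases
      case 3
      then have "s0 <# W \<subseteq> carrier G - W" "carrier G - W \<subseteq> t <# W" using s0(3) tG by auto
      then have "t <# W = carrier G - W" using nh2[OF s0(1) t W(1)] by blast
      then show ?thesis by blast
    qed auto
  qed
  \<comment> \<open>If some generator exchanges \<open>W\<close> with its complement, the group
    permutes these two sets. Otherwise maximality of \<open>W\<close> makes every
    \<open>t <# W\<close> equal to \<open>W\<close> or a sibling of it, and transitivity extends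
    this to all elements: the vertex where \<open>W\<close> starts is fixed.\<close>
  have all: "x <# W = W \<or> W \<inter> (x <# W) = {}" if x: "x \<in> carrier G" for x
  proof (cases "\<exists>t\<in>S. t <# W = carrier G - W")
    case True
    then obtain t where t: "t \<in> S" "t <# W = carrier G - W" by blast
    have gens: "t' <# W = W \<or> t' <# W = carrier G - W" if t': "t' \<in> S" for t'
    proof -
      have "t' <# W \<subseteq> carrier G" using t' WG by (auto simp: l_coset_subset_G)
      then show ?thesis using tW[OF t'] nh2[OF t' t(1) W(1)] t(2) by blast
    qed
    have "x <# W = W \<or> x <# W = carrier G - W" using x
    proof (induction x rule: generate_induct_left)
      case one
      then show ?case using lcos_mult_one[OF WG] by simp
    next
      case (mult s x)
      then have "(s \<otimes> x) <# W = s <# W \<or> (s \<otimes> x) <# W = carrier G - (s <# W)"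
        using WG lcos_m_assoc[of W s x] by (auto simp: l_coset_Compl)
      then show ?case using gens[OF mult(1)] WG by (auto simp: double_diff)
    qed
    then show ?thesis by blast
  next
    case False
    have sib: "t <# W = W \<or> siblings W (t <# W)" if t: "t \<in> S" for t
    proof (cases "t <# W = W")
      case ne: False
      have tG: "t <# W \<subseteq> carrier G" "optimal_cut (t <# W)"
        using t WG W by (auto simp: l_coset_subset_G optimal_l_coset)
      have disj: "W \<inter> (t <# W) = {}" using tW[OF t] ne by blast
      have "t <# W \<noteq> carrier G - W" using False t by blast
      then have "W \<subset> carrier G - (t <# W)" using disj tG WG by blast
      moreover have "\<not> (optimal_cut E \<and> W \<subset> E \<and> E \<subset> carrier G - (t <# W))" for E
      proof
        assume E: "optimal_cut E \<and> W \<subset> E \<and> E \<subset> carrier G - (t <# W)"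
        have "t \<in> t <# W" using W t WG mult_mem_l_coset_iff[of t W \<one>] by simp
        then have Et: "\<one> \<in> E" "t \<notin> E" using E W by auto
        have EG: "E \<subseteq> carrier G" using E by (simp add: optimal_subset)
        consider "E \<inter> (t <# E) = {}" | "carrier G \<subseteq> E \<union> (t <# E)"
          using dich[of E t] E Et t by blast
        then show False
        proof cases
          case 1
          then have "E \<in> M" using E Et t by (auto simp: M_def)
          then show False using max E by blast
        next
          case 2
          let ?E = "inv t <# (carrier G - E)"
          have "?E \<in> M" using flip[of E t] 2 E Et t by blast
          moreover have "W \<subset> ?E"
          proof -
            have "t <# W \<subset> carrier G - E" using E tG by blast
            then have "inv t <# (t <# W) \<subset> ?E"
              using l_coset_psubset_iff[of "inv t" "t <# W" "carrier G - E"] t tG by simp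
            then show ?thesis using l_coset_inv_cancel(2)[of t W] t WG by simp
          qed
          ultimately show False using max by blast
        qed
      qed
      ultimately show ?thesis by (auto simp: siblings_def)
    qed auto
    have "x <# W = W \<or> siblings W (x <# W)" using x
    proof (induction x rule: generate_induct_left)
      case one
      then show ?case using lcos_mult_one[OF WG] by simp
    next
      case (mult s x)
      have e: "(s \<otimes> x) <# W = s <# (x <# W)" using mult WG by (simp add: lcos_m_assoc)
      have o: "optimal_cut (s <# W)" "optimal_cut (s <# (x <# W))" using mult W by (auto simp: optimal_l_coset)
      have "s <# (x <# W) = s <# W \<or> siblings (s <# W) (s <# (x <# W))"
        using mult(3) siblings_l_coset[of s W "x <# W"] mult(1,2) WG by (auto simp: l_coset_subset_G)
      then show ?case
        using sib[OF mult(1)] siblings_trans[OF W(1) o] unfolding e by (metis )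
    qed
    then show ?thesis by (auto simp: siblings_def)
  qed
  \<comment> \<open>As \<one> is in \<open>W\<close>, every \<open>x\<close> in \<open>W\<close>
    also lies in \<open>x <# W\<close>. So these two sets meet and are equal, which would embed the
    infinite \<open>W\<close> into a finite stabilizer.\<close>
  have "W \<subseteq> stabilizer W"
  proof
    fix x assume x: "x \<in> W"
    then have xG: "x \<in> carrier G" using WG by blast
    have "x \<in> x <# W" using mult_mem_l_coset_iff[of x W \<one>] xG WG W by simp
    then show "x \<in> stabilizer W" using all[OF xG] x xG by (auto simp: stabilizer_def)
  qed
  then show False using fin Wne(2) finite_subset by blast
qed

end

section \<open>Ends and axes\<close>

context cayley_group
begin

section \<open>Translates of a cut that shrink towards an end\<close>

definition hyperbolic :: "'a \<Rightarrow> 'a set \<Rightarrow> bool" where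
  "hyperbolic g E \<longleftrightarrow> g \<in> carrier G \<and> thin_cut E \<and> g <# E \<subset> E"

lemma hyperbolicD:
  assumes "hyperbolic g E"
  shows "g \<in> carrier G" "E \<subseteq> carrier G" "thin_cut E" "g <# E \<subset> E"
  using assms by (auto simp: hyperbolic_def arcs.thin_subset)

lemma hyperbolic_inv:
  assumes "hyperbolic g E"
  shows "hyperbolic (inv g) (carrier G - E)"
proof -
  note h = hyperbolicD[OF assms]
  have "E \<subset> inv g <# E"
    using inv_l_coset_psubset_iff[of "inv g" E E] h by simp
  moreover have "inv g <# E \<subseteq> carrier G" using h by (simp add: l_coset_subset_G)
  ultimately have "carrier G - (inv g <# E) \<subset> carrier G - E" using h(2) by blast
  then have "inv g <# (carrier G - E) \<subset> carrier G - E" using h by (simp add: l_coset_Compl)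
  then show ?thesis using h by (simp add: hyperbolic_def arcs.thin_Compl)
qed

lemma pow_l_coset_Suc:
  assumes "hyperbolic g E"
  shows "(g [^] Suc m) <# E \<subset> (g [^] m) <# E"
proof -
  note h = hyperbolicD[OF assms]
  have "(g [^] Suc m) <# E = (g [^] m) <# (g <# E)" using h by (simp add: lcos_m_assoc)
  then show ?thesis using h l_coset_psubset_iff[of "g [^] m" "g <# E" E] by (simp add: l_coset_subset_G)
qed

lemma pow_l_coset_antimono:
  assumes "hyperbolic g E" "m \<le> k"
  shows "(g [^] (k::nat)) <# E \<subseteq> (g [^] (m::nat)) <# E"
  using lift_Suc_antimono_le[of "\<lambda>m::nat. (g [^] m) <# E",
      OF psubset_imp_subset[OF pow_l_coset_Suc[OF assms(1)]] assms(2)] .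

text \<open>The translates strictly decrease, so they are infinitely many thin cuts, all omitting a
  fixed point outside \<open>E\<close>. If all contained \<open>x\<close>, infinitely many thin cuts
  would separate two given vertices.\<close>

lemma hyperbolic_escape:
  assumes hyp: "hyperbolic g E" and x: "x \<in> carrier G"
  shows "\<exists>m::nat. x \<notin> (g [^] m) <# E"
proof (rule ccontr)
  assume "\<not> ?thesis"
  then have xin: "x \<in> (g [^] m) <# E" for m :: nat by blast
  note h = hyperbolicD[OF hyp]
  have "E \<noteq> carrier G" using h(3) by (auto simp: thin_def cut_def)
  then obtain y where y: "y \<in> carrier G" "y \<notin> E" using h(2) by blast
  have ynot: "y \<notin> (g [^] m) <# E" for m :: nat
    using pow_l_coset_antimono[OF hyp, of 0 m] y h(2) by (auto simp: lcos_mult_one)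
  have "(g [^] k) <# E \<subset> (g [^] m) <# E" if "m < k" for m k :: nat
    using pow_l_coset_antimono[OF hyp, of "Suc m" k] pow_l_coset_Suc[OF hyp, of m] that by simp
  then have "inj (\<lambda>m::nat. (g [^] m) <# E)"
    by (intro linorder_injI) (metis psubsetE)
  then have "infinite (range (\<lambda>m::nat. (g [^] m) <# E))" using range_inj_infinite by blast
  moreover have "range (\<lambda>m::nat. (g [^] m) <# E) \<subseteq> {W. thin_cut W \<and> x \<in> W \<and> y \<notin> W}"
    using xin ynot thin_l_coset h by auto
  ultimately show False using arcs.finite_thin_separating[OF x y(1)] finite_subset by blast
qed

lemma hyperbolic_escape_finite:
  assumes hyp: "hyperbolic g E" and "finite P" "P \<subseteq> carrier G"
  shows "\<exists>m::nat. P \<inter> ((g [^] m) <# E) = {}"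
  using assms(2,3)
proof (induction rule: finite_induct)
  case (insert x P)
  then obtain m where m: "P \<inter> ((g [^] (m::nat)) <# E) = {}" by blast
  obtain k where k: "x \<notin> (g [^] (k::nat)) <# E" using hyperbolic_escape[OF hyp] insert by blast
  have "insert x P \<inter> ((g [^] max m k) <# E) = {}"
    using m k pow_l_coset_antimono[OF hyp, of m "max m k"] pow_l_coset_antimono[OF hyp, of k "max m k"]
    by auto
  then show ?case by blast
qed auto

definition tame :: "'a set \<Rightarrow> bool" where
  "tame A \<longleftrightarrow> A \<subseteq> carrier G \<and> finite (bd A)"

lemma tame_Compl: "tame A \<Longrightarrow> tame (carrier G - A)"
  by (auto simp: tame_def arcs.boundary_Compl)

lemma tame_l_coset: "x \<in> carrier G \<Longrightarrow> tame A \<Longrightarrow> tame (x <# A)"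
  by (simp add: tame_def card_boundary_l_coset l_coset_subset_G)

lemma thin_tame: "thin_cut A \<Longrightarrow> tame A"
  by (simp add: tame_def arcs.thin_subset arcs.thin_finite_boundary)

text \<open>Once the translate avoids the finitely many starting points of boundary arcs of
  \<open>A\<close>, no arc inside it leaves \<open>A\<close>; being connected, it lies on one
  side.\<close>

lemma hyperbolic_decides:
  assumes hyp: "hyperbolic g E" and A: "tame A"
  shows "\<exists>m::nat. (g [^] m) <# E \<subseteq> A \<or> ((g [^] m) <# E) \<inter> A = {}"
proof -
  note h = hyperbolicD[OF hyp]
  have "finite (fst ` bd A)" "fst ` bd A \<subseteq> carrier G"
    using A by (auto simp: tame_def boundary_def)
  then obtain m where m: "fst ` bd A \<inter> ((g [^] (m::nat)) <# E) = {}"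
    using hyperbolic_escape_finite[OF hyp] by blast
  let ?W = "(g [^] m) <# E"
  have con: "connected_in arcs ?W" using h by (simp add: arcs.thin_connected thin_l_coset)
  have "\<not> (\<exists>x y. x \<in> ?W \<inter> A \<and> y \<in> ?W - A)"
  proof
    assume "\<exists>x y. x \<in> ?W \<inter> A \<and> y \<in> ?W - A"
    then obtain x y where "x \<in> ?W \<inter> A" "y \<in> ?W - A" by blast
    from connected_in_crosses[OF con this]
    obtain p q where pq: "p \<in> ?W" "(p, q) \<in> bd A" by blast
    then have "p \<in> fst ` bd A" using image_eqI[of p fst "(p, q)" "bd A"] by simp
    then show False using m pq(1) by blast
  qed
  then show ?thesis by blast
qed

text \<open>Ends are modelled as ultrafilters on the Boolean algebra of sets with finite boundary.\<close>

definition is_end :: "'a set set \<Rightarrow> bool" where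
  "is_end \<Omega> \<longleftrightarrow> (\<forall>A\<in>\<Omega>. tame A) \<and> (\<forall>A. tame A \<longrightarrow> (A \<in> \<Omega> \<longleftrightarrow> carrier G - A \<notin> \<Omega>))
     \<and> (\<forall>A\<in>\<Omega>. \<forall>B. tame B \<and> A \<subseteq> B \<longrightarrow> B \<in> \<Omega>)"

lemma is_endD:
  assumes "is_end \<Omega>"
  shows "A \<in> \<Omega> \<Longrightarrow> tame A" "tame A \<Longrightarrow> A \<in> \<Omega> \<longleftrightarrow> carrier G - A \<notin> \<Omega>"
    "A \<in> \<Omega> \<Longrightarrow> tame B \<Longrightarrow> A \<subseteq> B \<Longrightarrow> B \<in> \<Omega>"
  using assms unfolding is_end_def by blast+

text \<open>As for ultrafilters: a set in the larger family but not in the smaller would have its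
  complement in both.\<close>

lemma is_end_eqI:
  assumes "is_end \<Omega>" "is_end \<Omega>'" "\<Omega> \<subseteq> \<Omega>'"
  shows "\<Omega> = \<Omega>'"
proof -
  have "A \<in> \<Omega>" if "A \<in> \<Omega>'" for A
    using that assms is_endD(1,2)[OF assms(2), of A] is_endD(2)[OF assms(1), of A] by blast
  then show ?thesis using assms(3) by blast
qed

text \<open>The end towards which \<open>g\<close> translates, with the sets
  \<open>(g [^] m) <# E\<close> as a neighbourhood base. By \<open>hyperbolic_decides\<close> this
  base decides every set of finite boundary.\<close>

definition attractor :: "'a \<Rightarrow> 'a set \<Rightarrow> 'a set set" where
  "attractor g E = {A. tame A \<and> (\<exists>m::nat. (g [^] m) <# E \<subseteq> A)}"

lemma is_end_attractor:
  assumes hyp: "hyperbolic g E"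
  shows "is_end (attractor g E)"
proof -
  note h = hyperbolicD[OF hyp]
  have ne: "(g [^] m) <# E \<noteq> {}" for m :: nat
    using h by (auto simp: thin_def cut_def l_coset_def)
  have "carrier G - A \<notin> attractor g E" if A: "A \<in> attractor g E" for A
  proof
    assume "carrier G - A \<in> attractor g E"
    then obtain k m where km: "(g [^] (k::nat)) <# E \<subseteq> A" "(g [^] (m::nat)) <# E \<subseteq> carrier G - A"
      using A unfolding attractor_def by blast
    moreover have "(g [^] max k m) <# E \<subseteq> (g [^] k) <# E" "(g [^] max k m) <# E \<subseteq> (g [^] m) <# E"
      by (simp_all add: pow_l_coset_antimono[OF hyp])
    ultimately show False using ne[of "max k m"] by blast
  qed
  moreover have "A \<in> attractor g E" if A: "tame A" "carrier G - A \<notin> attractor g E" for A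
  proof -
    obtain m where m: "(g [^] (m::nat)) <# E \<subseteq> A \<or> ((g [^] m) <# E) \<inter> A = {}"
      using hyperbolic_decides[OF hyp A(1)] by blast
    have "(g [^] m) <# E \<subseteq> carrier G" using h by (simp add: l_coset_subset_G)
    then have "(g [^] m) <# E \<subseteq> A \<or> (g [^] m) <# E \<subseteq> carrier G - A" using m by blast
    then show ?thesis using A tame_Compl[OF A(1)] unfolding attractor_def by blast
  qed
  moreover have "A \<in> attractor g E \<Longrightarrow> tame A" for A by (simp add: attractor_def)
  moreover have "B \<in> attractor g E" if "A \<in> attractor g E" "tame B" "A \<subseteq> B" for A B
    using that unfolding attractor_def by blast
  ultimately show ?thesis unfolding is_end_def by metis
qed

section \<open>The action of the group on ends\<close>

definition translate_end :: "'a \<Rightarrow> 'a set set \<Rightarrow> 'a set set" where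
  "translate_end x \<Omega> = (\<lambda>A. x <# A) ` \<Omega>"

lemma translate_end_mult:
  assumes "x \<in> carrier G" "y \<in> carrier G" "is_end \<Omega>"
  shows "translate_end (x \<otimes> y) \<Omega> = translate_end x (translate_end y \<Omega>)"
proof -
  have "(x \<otimes> y) <# A = x <# (y <# A)" if "A \<in> \<Omega>" for A
    using that assms is_endD(1)[OF assms(3)] by (simp add: tame_def lcos_m_assoc)
  then show ?thesis by (auto simp: translate_end_def)
qed

lemma translate_end_one: "is_end \<Omega> \<Longrightarrow> translate_end \<one> \<Omega> = \<Omega>"
  using is_endD(1)[of \<Omega>] lcos_mult_one by (simp add: translate_end_def tame_def)

lemma mem_translate_end:
  assumes "x \<in> carrier G" "is_end \<Omega>" "A \<subseteq> carrier G"
  shows "A \<in> translate_end x \<Omega> \<longleftrightarrow> inv x <# A \<in> \<Omega>"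
proof
  assume "A \<in> translate_end x \<Omega>"
  then obtain B where B: "B \<in> \<Omega>" "A = x <# B" by (auto simp: translate_end_def)
  then have "B \<subseteq> carrier G" using is_endD(1)[OF assms(2)] by (simp add: tame_def)
  then show "inv x <# A \<in> \<Omega>" using l_coset_inv_cancel(2)[OF assms(1)] B by simp
next
  assume "inv x <# A \<in> \<Omega>"
  then have "x <# (inv x <# A) \<in> translate_end x \<Omega>" by (auto simp: translate_end_def)
  then show "A \<in> translate_end x \<Omega>" using assms l_coset_inv_cancel by simp
qed

lemma l_coset_mem_translate_end:
  assumes "x \<in> carrier G" "is_end \<Omega>" "A \<subseteq> carrier G"
  shows "x <# A \<in> translate_end x \<Omega> \<longleftrightarrow> A \<in> \<Omega>"
  using mem_translate_end[OF assms(1,2), of "x <# A"] assms l_coset_inv_cancel(2)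
  by (simp add: l_coset_subset_G)

lemma is_end_translate_end:
  assumes x: "x \<in> carrier G" and \<Omega>: "is_end \<Omega>"
  shows "is_end (translate_end x \<Omega>)"
  unfolding is_end_def
proof (intro conjI ballI allI impI)
  fix A assume "A \<in> translate_end x \<Omega>"
  then show tA: "tame A" using tame_l_coset[OF x] is_endD(1)[OF \<Omega>] by (auto simp: translate_end_def)
  fix B assume "tame B \<and> A \<subseteq> B"
  then have B: "tame B" "A \<subseteq> B" "A \<subseteq> carrier G" "B \<subseteq> carrier G" using tA by (auto simp: tame_def)
  have "inv x <# A \<in> \<Omega>" using \<open>A \<in> translate_end x \<Omega>\<close> B mem_translate_end x \<Omega> by blast
  moreover have "inv x <# A \<subseteq> inv x <# B" using B x by (simp add: l_coset_mono_iff)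
  ultimately have "inv x <# B \<in> \<Omega>" using is_endD(3)[OF \<Omega>] tame_l_coset B x by blast
  then show "B \<in> translate_end x \<Omega>" using mem_translate_end x \<Omega> B by blast
next
  fix A assume A: "tame A"
  then have AG: "A \<subseteq> carrier G" "carrier G - A \<subseteq> carrier G" by (auto simp: tame_def)
  show "A \<in> translate_end x \<Omega> \<longleftrightarrow> carrier G - A \<notin> translate_end x \<Omega>"
    using AG x A is_endD(2)[OF \<Omega>, of "inv x <# A"] tame_l_coset[of "inv x" A]
    by (simp add: mem_translate_end[OF x \<Omega>] l_coset_Compl)
qed

lemma translate_end_inv_eq:
  assumes "x \<in> carrier G" "is_end \<Omega>" "is_end \<Omega>'"
  shows "translate_end x \<Omega> = \<Omega>' \<longleftrightarrow> translate_end (inv x) \<Omega>' = \<Omega>"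
proof
  assume "translate_end x \<Omega> = \<Omega>'"
  then show "translate_end (inv x) \<Omega>' = \<Omega>"
    using translate_end_mult[of "inv x" x \<Omega>] translate_end_one[OF assms(2)] assms(1,2) by simp
next
  assume "translate_end (inv x) \<Omega>' = \<Omega>"
  then show "translate_end x \<Omega> = \<Omega>'"
    using translate_end_mult[of x "inv x" \<Omega>'] translate_end_one[OF assms(3)] assms(1,3) by simp
qed

lemma translate_end_pow:
  assumes "x \<in> carrier G" "is_end \<Omega>" "translate_end x \<Omega> = \<Omega>"
  shows "translate_end (x [^] (m::nat)) \<Omega> = \<Omega>"
  by (induction m) (use assms in \<open>auto simp: translate_end_one translate_end_mult\<close>)

lemma translate_attractor:
  assumes hyp: "hyperbolic g E"
  shows "translate_end g (attractor g E) = attractor g E"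
proof (rule is_end_eqI)
  note h = hyperbolicD[OF hyp]
  show ends: "is_end (translate_end g (attractor g E))" "is_end (attractor g E)"
    using is_end_attractor[OF hyp] is_end_translate_end h by auto
  show "translate_end g (attractor g E) \<subseteq> attractor g E"
  proof
    fix A assume A: "A \<in> translate_end g (attractor g E)"
    then obtain B m where B: "A = g <# B" "tame B" "(g [^] (m::nat)) <# E \<subseteq> B"
      by (auto simp: translate_end_def attractor_def)
    have "g <# ((g [^] m) <# E) \<subseteq> A"
      using B h by (auto simp: l_coset_def)
    moreover have "g <# ((g [^] m) <# E) = (g [^] Suc m) <# E"
      using h by (simp add: lcos_m_assoc nat_pow_Suc2[symmetric])
    ultimately have "(g [^] Suc m) <# E \<subseteq> A" by simp
    then show "A \<in> attractor g E" using is_endD(1)[OF ends(1) A] unfolding attractor_def by blast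
  qed
qed

abbreviation repeller :: "'a \<Rightarrow> 'a set \<Rightarrow> 'a set set" where
  "repeller g E \<equiv> attractor (inv g) (carrier G - E)"

lemma is_end_repeller: "hyperbolic g E \<Longrightarrow> is_end (repeller g E)"
  by (simp add: hyperbolic_inv is_end_attractor)

lemma translate_repeller:
  assumes "hyperbolic g E"
  shows "translate_end g (repeller g E) = repeller g E"
  using translate_attractor[OF hyperbolic_inv[OF assms]]
    translate_end_inv_eq[OF hyperbolicD(1)[OF assms] is_end_repeller[OF assms] is_end_repeller[OF assms]]
  by simp

lemma mem_attractor:
  assumes "hyperbolic g E"
  shows "E \<in> attractor g E"
  using hyperbolicD[OF assms] thin_tame
  by (auto simp: attractor_def lcos_mult_one intro!: exI[of _ "0::nat"])

lemma not_mem_repeller: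
  assumes "hyperbolic g E"
  shows "E \<notin> repeller g E"
  using mem_attractor[OF hyperbolic_inv[OF assms]]
    is_endD(2)[OF is_end_repeller[OF assms] thin_tame[OF hyperbolicD(3)[OF assms]]] by simp

text \<open>Only the square of \<open>g\<close> is assumed to fix the end, because elements of
  \<open>axis_group\<close> may swap two ends and only their squares are known to fix both. Its
  powers carry \<open>E\<close> to arbitrarily small translates, which therefore all belong to
  \<open>\<Omega>\<close>.\<close>

lemma attractor_subset_fixed:
  assumes hyp: "hyperbolic g E" and \<Omega>: "is_end \<Omega>" "translate_end (g \<otimes> g) \<Omega> = \<Omega>" and E: "E \<in> \<Omega>"
  shows "\<Omega> = attractor g E"
proof -
  note h = hyperbolicD[OF hyp]
  have "attractor g E \<subseteq> \<Omega>"
  proof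
    fix A assume "A \<in> attractor g E"
    then obtain m where A: "tame A" "(g [^] (m::nat)) <# E \<subseteq> A" by (auto simp: attractor_def)
    have "((g \<otimes> g) [^] m) <# E \<in> \<Omega>"
      using translate_end_pow[of "g \<otimes> g" \<Omega> m] \<Omega> E h l_coset_mem_translate_end[of "(g \<otimes> g) [^] m" \<Omega> E]
      by simp
    moreover have "(g \<otimes> g) [^] m = g [^] (m + m)"
      using h by (simp add: pow_mult_distrib nat_pow_mult)
    moreover have "(g [^] (m + m)) <# E \<subseteq> (g [^] m) <# E"
      using pow_l_coset_antimono[OF hyp] by simp
    ultimately show "A \<in> \<Omega>" using A is_endD(3)[OF \<Omega>(1), of "(g [^] (m + m)) <# E" A] by simp
  qed
  then show ?thesis using is_end_eqI[OF is_end_attractor[OF hyp] \<Omega>(1)] by simp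
qed

lemma fixed_end_cases:
  assumes hyp: "hyperbolic g E" and \<Omega>: "is_end \<Omega>" "translate_end (g \<otimes> g) \<Omega> = \<Omega>"
  shows "\<Omega> = attractor g E \<or> \<Omega> = repeller g E"
proof (cases "E \<in> \<Omega>")
  case True
  then show ?thesis using attractor_subset_fixed[OF assms] by blast
next
  case False
  note h = hyperbolicD[OF hyp]
  have "carrier G - E \<in> \<Omega>" using False is_endD(2)[OF \<Omega>(1), of E] thin_tame h by blast
  moreover have "translate_end (inv g \<otimes> inv g) \<Omega> = \<Omega>"
    using translate_end_inv_eq[of "g \<otimes> g" \<Omega> \<Omega>] \<Omega> h by (simp add: inv_mult_group)
  ultimately show ?thesis using attractor_subset_fixed[OF hyperbolic_inv[OF hyp] \<Omega>(1)] by blast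
qed

section \<open>The stabiliser of the two ends of an axis\<close>

definition axis_ends :: "'a \<Rightarrow> 'a set \<Rightarrow> 'a set set set" where
  "axis_ends g E = {attractor g E, repeller g E}"

definition axis_group :: "'a \<Rightarrow> 'a set \<Rightarrow> 'a set" where
  "axis_group g E = {x \<in> carrier G. translate_end x ` axis_ends g E = axis_ends g E}"

lemma axis_ends_is_end: "hyperbolic g E \<Longrightarrow> \<Omega> \<in> axis_ends g E \<Longrightarrow> is_end \<Omega>"
  unfolding axis_ends_def using is_end_attractor[of g E] is_end_repeller[of g E] by blast

lemma translate_axis_ends_mult:
  assumes "hyperbolic g E" "x \<in> carrier G" "y \<in> carrier G"
  shows "translate_end (x \<otimes> y) ` axis_ends g E = translate_end x ` translate_end y ` axis_ends g E"
  unfolding image_image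
  by (intro image_cong refl translate_end_mult[OF assms(2,3)] axis_ends_is_end[OF assms(1)])

lemma subgroup_axis_group:
  assumes hyp: "hyperbolic g E"
  shows "subgroup (axis_group g E) G"
proof (rule subgroupI)
  have one: "translate_end \<one> ` axis_ends g E = axis_ends g E"
  proof -
    have "translate_end \<one> ` axis_ends g E = (\<lambda>\<Omega>. \<Omega>) ` axis_ends g E"
      by (intro image_cong refl translate_end_one axis_ends_is_end[OF hyp])
    then show ?thesis by simp
  qed
  then show "axis_group g E \<noteq> {}" by (auto simp: axis_group_def)
  show "inv x \<in> axis_group g E" if "x \<in> axis_group g E" for x
    using that translate_axis_ends_mult[OF hyp, of "inv x" x] one by (auto simp: axis_group_def)
  show "x \<otimes> y \<in> axis_group g E" if "x \<in> axis_group g E" "y \<in> axis_group g E" for x y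
    using that translate_axis_ends_mult[OF hyp, of x y] by (auto simp: axis_group_def)
qed (auto simp: axis_group_def)

lemma mem_axis_group_self: "hyperbolic g E \<Longrightarrow> g \<in> axis_group g E"
  using translate_attractor translate_repeller hyperbolicD(1)
  by (auto simp: axis_group_def axis_ends_def)

lemma axis_group_square:
  assumes hyp: "hyperbolic g E" and x: "x \<in> axis_group g E" and \<Omega>: "\<Omega> \<in> axis_ends g E"
  shows "translate_end (x \<otimes> x) \<Omega> = \<Omega>"
proof -
  have xG: "x \<in> carrier G" and eq: "translate_end x ` axis_ends g E = axis_ends g E"
    using x by (auto simp: axis_group_def)
  have "translate_end (x \<otimes> x) \<Omega> = translate_end x (translate_end x \<Omega>)"
    using translate_end_mult xG axis_ends_is_end[OF hyp \<Omega>] by blast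
  then show ?thesis using eq \<Omega> unfolding axis_ends_def by (auto simp: doubleton_eq_iff)
qed

text \<open>The square of the conjugate fixes each end of the pair, so the square of
  \<open>g\<close> fixes the images of these ends under \<open>w\<close>. By
  \<open>fixed_end_cases\<close> the images are again ends of the axis of \<open>g\<close>.\<close>

lemma axis_group_conj:
  assumes hyp: "hyperbolic g E" and w: "w \<in> carrier G" and c: "inv w \<otimes> g \<otimes> w \<in> axis_group g E"
  shows "w \<in> axis_group g E"
proof -
  note h = hyperbolicD[OF hyp]
  have sub: "translate_end w \<Omega> \<in> axis_ends g E" if \<Omega>: "\<Omega> \<in> axis_ends g E" for \<Omega>
  proof -
    have e: "is_end \<Omega>" using axis_ends_is_end[OF hyp \<Omega>] .
    have "w \<otimes> ((inv w \<otimes> g \<otimes> w) \<otimes> (inv w \<otimes> g \<otimes> w)) = (g \<otimes> g) \<otimes> w"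
      using w h(1) by (simp add: m_assoc[symmetric]) (simp add: m_assoc)
    then have "translate_end ((g \<otimes> g) \<otimes> w) \<Omega>
        = translate_end w (translate_end ((inv w \<otimes> g \<otimes> w) \<otimes> (inv w \<otimes> g \<otimes> w)) \<Omega>)"
      using translate_end_mult[of w "(inv w \<otimes> g \<otimes> w) \<otimes> (inv w \<otimes> g \<otimes> w)" \<Omega>] e w h(1) by simp
    also have "\<dots> = translate_end w \<Omega>" using axis_group_square[OF hyp c \<Omega>] by simp
    finally have "translate_end (g \<otimes> g) (translate_end w \<Omega>) = translate_end w \<Omega>"
      using translate_end_mult[of "g \<otimes> g" w \<Omega>] e w h(1) by simp
    then show ?thesis
      using fixed_end_cases[OF hyp is_end_translate_end[OF w e]] by (auto simp: axis_ends_def)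
  qed
  have "inj_on (translate_end w) (axis_ends g E)"
  proof (rule inj_onI)
    fix \<Omega> \<Omega>' assume "\<Omega> \<in> axis_ends g E" "\<Omega>' \<in> axis_ends g E" "translate_end w \<Omega> = translate_end w \<Omega>'"
    then show "\<Omega> = \<Omega>'"
      using axis_ends_is_end[OF hyp] translate_end_inv_eq[OF w] is_end_translate_end[OF w] by metis
  qed
  moreover have "finite (axis_ends g E)" by (simp add: axis_ends_def)
  ultimately have "translate_end w ` axis_ends g E = axis_ends g E"
    using sub by (intro endo_inj_surj) auto
  then show ?thesis using w by (simp add: axis_group_def)
qed

lemma iter_comm_closed:
  assumes "x \<in> carrier G" "y \<in> carrier G"
  shows "iter_comm G k x y \<in> carrier G"
proof (induction k)
  case (Suc k)
  then show ?case using assms by (cases k) simp_all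
qed simp

text \<open>Each commutator is \<open>g \<otimes> inv w \<otimes> inv g \<otimes> w\<close>, where
  \<open>w\<close> is the preceding one, or \<open>x\<close> at the bottom. Since \<open>g\<close>
  is in the subgroup, so is the conjugate of \<open>g\<close> by \<open>w\<close>, and
  \<open>axis_group_conj\<close> gives \<open>w\<close> itself; repeating this descends to
  \<open>x\<close>.\<close>

lemma iter_comm_axis_group:
  assumes hyp: "hyperbolic g E" and x: "x \<in> carrier G"
    and mem: "iter_comm G (Suc k) g x \<in> axis_group g E"
  shows "x \<in> axis_group g E"
proof -
  interpret A: subgroup "axis_group g E" G using subgroup_axis_group[OF hyp] .
  note h = hyperbolicD[OF hyp]
  have g: "g \<in> axis_group g E" "inv g \<in> axis_group g E" using mem_axis_group_self[OF hyp] by auto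
  have cancel: "inv g \<otimes> (g \<otimes> z) = z" if "z \<in> carrier G" for z
    using that h(1) by (simp add: m_assoc[symmetric])
  have key: "w \<in> axis_group g E"
    if w: "w \<in> carrier G" "g \<otimes> inv w \<otimes> inv g \<otimes> w \<in> axis_group g E" for w
  proof -
    have "inv g \<otimes> (g \<otimes> inv w \<otimes> inv g \<otimes> w) \<in> axis_group g E" using g w by blast
    then have "inv (inv w \<otimes> inv g \<otimes> w) \<in> axis_group g E"
      using w h(1) cancel[of "inv w \<otimes> (inv g \<otimes> w)"] by (simp add: m_assoc)
    then have "inv w \<otimes> g \<otimes> w \<in> axis_group g E"
      using w h(1) by (simp add: inv_mult_group m_assoc)
    then show ?thesis using axis_group_conj[OF hyp w(1)] by blast
  qed
  show ?thesis using mem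
  proof (induction k)
    case 0
    then show ?case using key[OF x] by simp
  next
    case (Suc k)
    then show ?case using key[OF iter_comm_closed[OF h(1) x, of "Suc k"]] by simp
  qed
qed

lemma axis_group_eq_carrier:
  assumes hyp: "hyperbolic g E" and engel: "\<And>s. s \<in> S \<Longrightarrow> iter_comm G (Suc k) g s = \<one>"
  shows "axis_group g E = carrier G"
proof -
  interpret A: subgroup "axis_group g E" G using subgroup_axis_group[OF hyp] .
  have "S \<subseteq> axis_group g E"
    using iter_comm_axis_group[OF hyp gens_closed, where k = k] engel A.one_closed by auto
  then have "generate G S \<subseteq> axis_group g E"
    using generate_subgroup_incl[OF _ subgroup_axis_group[OF hyp]] by blast
  then show ?thesis using gens_generate A.subset by auto
qed

text \<open>These elements are closed under products and exclude \<one>, as \<open>E\<close> has to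
  shrink strictly. A commutator shown to lie in this set is therefore nontrivial.\<close>

definition forward :: "'a \<Rightarrow> 'a set \<Rightarrow> 'a set" where
  "forward g E = {x \<in> carrier G. translate_end x (attractor g E) = attractor g E
     \<and> translate_end x (repeller g E) = repeller g E \<and> x <# E \<subset> E}"

lemma forward_hyperbolic: "hyperbolic g E \<Longrightarrow> x \<in> forward g E \<Longrightarrow> hyperbolic x E"
  by (simp add: forward_def hyperbolic_def)

lemma end_not_disjoint:
  assumes "is_end \<Omega>" "A \<in> \<Omega>" "B \<in> \<Omega>"
  shows "A \<inter> B \<noteq> {}"
proof
  assume "A \<inter> B = {}"
  moreover have t: "tame A" "tame B" using assms is_endD(1) by auto
  ultimately have "B \<subseteq> carrier G - A" by (auto simp: tame_def)
  then have "carrier G - A \<in> \<Omega>" using is_endD(3)[OF assms(1,3) tame_Compl[OF t(1)]] by blast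
  then show False using is_endD(2)[OF assms(1) t(1)] assms(2) by blast
qed

text \<open>The sets share the first end and their complements share the second, so the corners
  \<open>A \<inter> B\<close> and outside \<open>A \<union> B\<close> are nonempty; nestedness
  leaves only inclusion.\<close>

lemma separating_cuts_comparable:
  assumes A: "optimal_cut A" "A \<in> \<Omega>" "A \<notin> \<Omega>'" and B: "optimal_cut B" "B \<in> \<Omega>" "B \<notin> \<Omega>'"
    and ends: "is_end \<Omega>" "is_end \<Omega>'"
  shows "A \<subseteq> B \<or> B \<subseteq> A"
proof -
  have tame: "tame A" "tame B" using A B is_endD(1)[OF ends(1)] by auto
  have "A \<inter> B \<noteq> {}" using end_not_disjoint ends A B by blast
  moreover have "\<not> carrier G \<subseteq> A \<union> B"
  proof
    assume "carrier G \<subseteq> A \<union> B"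
    then have "carrier G - A \<subseteq> B" by blast
    moreover have "carrier G - A \<in> \<Omega>'" using is_endD(2)[OF ends(2) tame(1)] A(3) by blast
    ultimately show False using is_endD(3)[OF ends(2) _ tame(2)] B(3) by blast
  qed
  ultimately show ?thesis using arcs.optimal_nested[OF A(1) B(1)] by (auto simp: nested_def)
qed

text \<open>\<open>C\<close> and \<open>x <# C\<close> separate the same ends, so they are
  comparable. If \<open>C\<close> did not shrink, it would lie in all \<open>(x [^] m) <# C\<close>.
  Some such translate is inside \<open>E\<close>, so \<open>C\<close> would lie in every
  \<open>(x [^] k) <# E\<close>, against \<open>hyperbolic_escape\<close>.\<close>

lemma forward_psubset:
  assumes hyp: "hyperbolic g E" and x: "x \<in> forward g E"
    and C: "optimal_cut C" "C \<in> attractor g E" "C \<notin> repeller g E"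
  shows "x <# C \<subset> C"
proof (rule ccontr)
  assume n: "\<not> x <# C \<subset> C"
  note h = hyperbolicD[OF hyp]
  have hx: "hyperbolic x E" and hx': "hyperbolic (inv x) (carrier G - E)"
    using forward_hyperbolic[OF hyp x] hyperbolic_inv by auto
  have xG: "x \<in> carrier G" and fx: "translate_end x (attractor g E) = attractor g E"
      "translate_end x (repeller g E) = repeller g E"
    using x by (auto simp: forward_def)
  have ends: "is_end (attractor g E)" "is_end (repeller g E)"
    using is_end_attractor is_end_repeller hyp by auto
  have CG: "C \<subseteq> carrier G" using C optimal_subset by blast
  have "x <# C \<in> attractor g E" "x <# C \<notin> repeller g E"
    using l_coset_mem_translate_end[OF xG ends(1) CG] l_coset_mem_translate_end[OF xG ends(2) CG]
      fx C by auto
  then have sub: "C \<subseteq> x <# C"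
    using separating_cuts_comparable[OF C optimal_l_coset[OF xG C(1)] _ _ ends] n by blast
  have subm: "C \<subseteq> (x [^] m) <# C" for m :: nat
  proof (induction m)
    case 0
    then show ?case using CG by (simp add: lcos_mult_one)
  next
    case (Suc m)
    have "(x [^] m) <# C \<subseteq> (x [^] m) <# (x <# C)" using sub xG CG by (simp add: l_coset_mono_iff l_coset_subset_G)
    also have "\<dots> = (x [^] Suc m) <# C" using xG CG by (simp add: lcos_m_assoc)
    finally show ?case using Suc by blast
  qed
  obtain m where m: "(inv x [^] (m::nat)) <# (carrier G - E) \<subseteq> C \<or> ((inv x [^] m) <# (carrier G - E)) \<inter> C = {}"
    using hyperbolic_decides[OF hx', of C] is_endD(1)[OF ends(1) C(2)] by blast
  have ix: "inv x [^] m = inv (x [^] m)" using xG by (simp add: nat_pow_inv)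
  have "(inv x [^] m) <# (carrier G - E) \<in> repeller g E"
  proof -
    have "translate_end (inv x) (repeller g E) = repeller g E"
      using translate_end_inv_eq[OF xG ends(2,2)] fx by simp
    then have "translate_end (inv x [^] m) (repeller g E) = repeller g E"
      using translate_end_pow ends xG by simp
    moreover have "carrier G - E \<in> repeller g E" using mem_attractor[OF hyperbolic_inv[OF hyp]] .
    ultimately show ?thesis
      using l_coset_mem_translate_end[of "inv x [^] m" "repeller g E" "carrier G - E"] ends xG by simp
  qed
  then have "\<not> (inv x [^] m) <# (carrier G - E) \<subseteq> C"
    using C(3) is_endD(3)[OF ends(2)] is_endD(1)[OF ends(1) C(2)] by blast
  then have "C \<subseteq> inv (x [^] m) <# E"
    using m h xG CG by (auto simp: ix l_coset_Compl)
  then have Cm: "(x [^] m) <# C \<subseteq> E"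
    using inv_l_coset_subset_iff[of "inv (x [^] m)" C E] xG CG h by simp
  have "C \<noteq> {}" using C by (auto simp: optimal_def thin_def cut_def)
  then obtain c where c: "c \<in> C" by blast
  then obtain k where k: "c \<notin> (x [^] (k::nat)) <# E" using hyperbolic_escape[OF hx] CG by blast
  have "C \<subseteq> (x [^] (k + m)) <# C" by (rule subm)
  also have "\<dots> = (x [^] k) <# ((x [^] m) <# C)" using xG CG by (simp add: lcos_m_assoc nat_pow_mult)
  also have "\<dots> \<subseteq> (x [^] k) <# E" using Cm xG CG h by (simp add: l_coset_mono_iff l_coset_subset_G)
  finally show False using c k by blast
qed

lemma forward_mult:
  assumes hyp: "hyperbolic g E" and "x \<in> forward g E" "y \<in> forward g E"
  shows "x \<otimes> y \<in> forward g E"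
proof -
  note h = hyperbolicD[OF hyp]
  have xy: "x \<in> carrier G" "y \<in> carrier G" "x <# E \<subset> E" "y <# E \<subset> E"
    using assms by (auto simp: forward_def)
  have "(x \<otimes> y) <# E = x <# (y <# E)" using xy h by (simp add: lcos_m_assoc)
  moreover have "x <# (y <# E) \<subset> x <# E" using xy h by (simp add: l_coset_psubset_iff l_coset_subset_G)
  ultimately have "(x \<otimes> y) <# E \<subset> E" using xy(3) by blast
  then show ?thesis
    using assms is_end_attractor[OF hyp] is_end_repeller[OF hyp] by (simp add: forward_def translate_end_mult)
qed

text \<open>Since \<open>t\<close> swaps the ends, the complement of \<open>inv t <# E\<close> again
  contains the attracting end and omits the repelling one, so \<open>x\<close> shrinks it. Carried
  over by \<open>t\<close>, this says that the conjugate of \<open>inv x\<close> by \<open>t\<close>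
  shrinks \<open>E\<close>: inverting and swapping reverse the direction twice.\<close>

lemma forward_conj:
  assumes hyp: "hyperbolic g E" "optimal_cut E" and t: "t \<in> carrier G"
    and swap: "translate_end t (attractor g E) = repeller g E" "translate_end t (repeller g E) = attractor g E"
    and x: "x \<in> forward g E"
  shows "t \<otimes> inv x \<otimes> inv t \<in> forward g E"
proof -
  note h = hyperbolicD[OF hyp(1)]
  let ?p = "attractor g E" and ?q = "repeller g E"
  have ends: "is_end ?p" "is_end ?q" using is_end_attractor is_end_repeller hyp by auto
  have xG: "x \<in> carrier G" "translate_end x ?p = ?p" "translate_end x ?q = ?q"
    using x by (auto simp: forward_def)
  have swap': "translate_end (inv t) ?p = ?q" "translate_end (inv t) ?q = ?p"
    using swap translate_end_inv_eq[OF t] ends by blast+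
  have fix': "translate_end (inv x) ?p = ?p" "translate_end (inv x) ?q = ?q"
    using xG translate_end_inv_eq[OF xG(1)] ends by blast+
  have fx: "translate_end (t \<otimes> inv x \<otimes> inv t) ?p = ?p" "translate_end (t \<otimes> inv x \<otimes> inv t) ?q = ?q"
    using t xG(1) ends by (simp_all add: translate_end_mult swap swap' fix' m_assoc)
  let ?B = "inv t <# E"
  have BG: "?B \<subseteq> carrier G" using t h by (simp add: l_coset_subset_G)
  have B: "?B \<in> ?q" "?B \<notin> ?p"
    using l_coset_mem_translate_end[of "inv t" ?p E] l_coset_mem_translate_end[of "inv t" ?q E]
      swap' t h ends mem_attractor[OF hyp(1)] not_mem_repeller[OF hyp(1)] by simp_all
  have tB: "tame ?B" using B is_endD(1)[OF ends(2)] by blast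
  have C: "carrier G - ?B \<in> ?p" "carrier G - ?B \<notin> ?q" "optimal_cut (carrier G - ?B)"
    using B is_endD(2)[OF ends(1) tB] is_endD(2)[OF ends(2) tB] t hyp(2)
    by (auto simp: arcs.optimal_Compl optimal_l_coset)
  have "x <# (carrier G - ?B) \<subset> carrier G - ?B" using forward_psubset[OF hyp(1) x C(3,1,2)] .
  then have "?B \<subset> x <# ?B"
    using xG(1) BG l_coset_subset_G[OF BG xG(1)] by (auto simp: l_coset_Compl)
  then have "inv x <# ?B \<subset> ?B" using inv_l_coset_psubset_iff[OF xG(1) BG BG] by simp
  then have "t <# (inv x <# ?B) \<subset> t <# ?B"
    using t xG(1) BG by (simp add: l_coset_psubset_iff l_coset_subset_G)
  then have "(t \<otimes> inv x \<otimes> inv t) <# E \<subset> E"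
    using t xG(1) h by (simp add: lcos_m_assoc m_assoc lcos_mult_one l_coset_subset_G)
  then show ?thesis using fx t xG(1) by (simp add: forward_def)
qed

text \<open>The commutator is a product of \<open>t \<otimes> inv w \<otimes> inv t\<close> and
  \<open>w\<close>, where \<open>w\<close> is the preceding commutator, or \<open>g\<close> at the
  start. Both factors move forward.\<close>

lemma iter_comm_forward:
  assumes hyp: "hyperbolic g E" "optimal_cut E" and t: "t \<in> carrier G"
    and swap: "translate_end t (attractor g E) = repeller g E" "translate_end t (repeller g E) = attractor g E"
  shows "iter_comm G (Suc k) t g \<in> forward g E"
proof (induction k)
  case 0
  have "g \<in> forward g E"
    using hyp translate_attractor translate_repeller hyperbolicD by (auto simp: forward_def)
  then show ?case using forward_mult[OF hyp(1) forward_conj[OF hyp t swap]] by simp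
next
  case (Suc k)
  then show ?case using forward_mult[OF hyp(1) forward_conj[OF hyp t swap Suc] Suc] by simp
qed

lemma gens_fix_axis_ends:
  assumes hyp: "hyperbolic g E" "optimal_cut E"
    and engel: "\<And>s. s \<in> S \<Longrightarrow> iter_comm G (Suc k) g s = \<one>" "\<And>s. s \<in> S \<Longrightarrow> iter_comm G (Suc k) s g = \<one>"
    and x: "x \<in> carrier G"
  shows "translate_end x (attractor g E) = attractor g E \<and> translate_end x (repeller g E) = repeller g E"
  using x
proof (induction x rule: generate_induct_left)
  case one
  then show ?case using translate_end_one is_end_attractor is_end_repeller hyp by blast
next
  case (mult s x)
  have s: "s \<in> carrier G" using mult by simp
  have img: "translate_end s ` axis_ends g E = axis_ends g E"
    using axis_group_eq_carrier[OF hyp(1) engel(1)] s by (auto simp: axis_group_def)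
  have ends: "is_end (attractor g E)" "is_end (repeller g E)" using is_end_attractor is_end_repeller hyp by auto
  have "\<not> (translate_end s (attractor g E) = repeller g E \<and> translate_end s (repeller g E) = attractor g E)"
  proof
    assume "translate_end s (attractor g E) = repeller g E \<and> translate_end s (repeller g E) = attractor g E"
    then have "\<one> \<in> forward g E" using iter_comm_forward[OF hyp s, of k] engel(2)[OF mult(1)] by simp
    then show False using hyperbolicD[OF hyp(1)] by (simp add: forward_def lcos_mult_one)
  qed
  then have "translate_end s (attractor g E) = attractor g E \<and> translate_end s (repeller g E) = repeller g E"
    using img unfolding axis_ends_def by (auto simp: doubleton_eq_iff)
  then show ?case using mult s ends by (simp add: translate_end_mult)
qed

end

section \<open>Cayley graphs with a two-ended structure\<close>

context cayley_group
begin

text \<open>Two such elements differ by an element of the finite stabilizer of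
  \<open>E\<close>.\<close>

lemma finite_translates_eq:
  assumes "thin_cut E"
  shows "finite {x \<in> carrier G. x <# E = W}"
proof (cases "\<exists>y\<in>carrier G. y <# E = W")
  case True
  then obtain y where y: "y \<in> carrier G" "y <# E = W" by blast
  have E: "E \<subseteq> carrier G" using assms by (rule arcs.thin_subset)
  have "(\<lambda>x. inv y \<otimes> x) ` {x \<in> carrier G. x <# E = W} \<subseteq> stabilizer E"
  proof
    fix z assume "z \<in> (\<lambda>x. inv y \<otimes> x) ` {x \<in> carrier G. x <# E = W}"
    then obtain x where x: "x \<in> carrier G" "x <# E = W" "z = inv y \<otimes> x" by blast
    have "z <# E = inv y <# (x <# E)" using lcos_m_assoc[OF E, of "inv y" x] x(1,3) y(1) by simp
    also have "\<dots> = E" using x y E l_coset_inv_cancel(2)[of y E] by simp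
    finally show "z \<in> stabilizer E" using x y by (simp add: stabilizer_def)
  qed
  moreover have "inj_on (\<lambda>x. inv y \<otimes> x) {x \<in> carrier G. x <# E = W}"
    using y by (auto simp: inj_on_def)
  ultimately show ?thesis using finite_stabilizer[OF assms] by (meson finite_imageD finite_subset)
next
  case False
  then have "{x \<in> carrier G. x <# E = W} = {}" by blast
  then show ?thesis by (simp only: finite.emptyI)
qed

definition fixes_axis :: "'a \<Rightarrow> 'a set \<Rightarrow> bool" where
  "fixes_axis s E \<longleftrightarrow> (\<forall>x\<in>carrier G. translate_end x (attractor s E) = attractor s E
     \<and> translate_end x (repeller s E) = repeller s E)"

text \<open>The group fixes both ends, so all translates of \<open>E\<close> separate the same two
  ends in the same direction and form a chain.\<close>

lemma translates_comparable:
  assumes hyp: "hyperbolic s E" "optimal_cut E" "fixes_axis s E"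
    and x: "x \<in> carrier G" and y: "y \<in> carrier G"
  shows "x <# E \<subseteq> y <# E \<or> y <# E \<subseteq> x <# E"
proof -
  have ends: "is_end (attractor s E)" "is_end (repeller s E)"
    using is_end_attractor is_end_repeller hyp by auto
  have "z <# E \<in> attractor s E \<and> z <# E \<notin> repeller s E" if z: "z \<in> carrier G" for z
    using l_coset_mem_translate_end[OF z ends(1)] l_coset_mem_translate_end[OF z ends(2)]
      hyperbolicD(2)[OF hyp(1)] mem_attractor[OF hyp(1)] not_mem_repeller[OF hyp(1)] hyp(3) z
    by (simp add: fixes_axis_def)
  then show ?thesis
    using separating_cuts_comparable[OF optimal_l_coset[OF x hyp(2)] _ _ optimal_l_coset[OF y hyp(2)] _ _ ends]
      x y by simp
qed

text \<open>Every vertex \<open>x\<close> lies on the boundary of a translate of \<open>E\<close>, and the translates between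
  \<open>E\<close> and \<open>s\<^sup>k E\<close> are finitely many.\<close>

lemma finite_slab:
  assumes hyp: "hyperbolic s E" "optimal_cut E" "fixes_axis s E"
  shows "finite (E - ((s [^] (k::nat)) <# E))"
proof -
  note h = hyperbolicD[OF hyp(1)]
  have ne: "E \<noteq> {}" "E \<noteq> carrier G" "finite (bd E)"
    using h by (auto simp: thin_def cut_def)
  then obtain a b where ab: "(a, b) \<in> bd E" using arcs.boundary_nonempty[OF h(2)] by fast
  then have ab': "a \<in> E" "b \<notin> E" "a \<in> carrier G" "b \<in> carrier G" "(a, b) \<in> arcs"
    by (auto simp: boundary_def arcs_mem)
  obtain y where y: "y \<in> carrier G" "y \<notin> E" using ne h by blast
  obtain e where e: "e \<in> (s [^] k) <# E" using ne(1) by (auto simp: l_coset_def)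
  have eG: "e \<in> carrier G" using e h l_coset_subset_G[of E "s [^] k"] by auto
  define T where "T = {W. thin_cut W \<and> e \<in> W \<and> y \<notin> W}"
  have T: "finite T" using arcs.finite_thin_separating[OF eG y(1)] by (simp add: T_def)
  have "E - ((s [^] k) <# E) \<subseteq> fst ` bd E \<union> (\<Union>W\<in>T. (\<lambda>h. h \<otimes> a) ` {h \<in> carrier G. h <# E = W})"
  proof
    fix x assume x: "x \<in> E - ((s [^] k) <# E)"
    then have xG: "x \<in> carrier G" using h by blast
    \<comment> \<open>\<open>z\<close> moves the boundary arc \<open>(a, b)\<close> so that it
      starts at \<open>x\<close>. If \<open>z <# E\<close> is inside \<open>E\<close>, it is one of
      the finitely many cuts in \<open>T\<close>; otherwise \<open>E\<close> is inside it, and the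
      moved arc also leaves \<open>E\<close>.\<close>
    define z where "z = x \<otimes> inv a"
    have z: "z \<in> carrier G" "z \<otimes> a = x" using xG ab' by (auto simp: z_def m_assoc)
    have xz: "x \<in> z <# E" using mult_mem_l_coset_iff[of z E a] z ab' h by simp
    have zb: "z \<otimes> b \<notin> z <# E" using mult_mem_l_coset_iff[of z E b] z ab' h by simp
    have 1: "(s [^] k) <# E \<subseteq> z <# E"
      using translates_comparable[OF hyp, of "s [^] k" z] h z x xz by auto
    have 2: "E \<subseteq> z <# E \<or> z <# E \<subseteq> E"
      using translates_comparable[OF hyp, of \<one> z] h z by (auto simp: lcos_mult_one)
    show "x \<in> fst ` bd E \<union> (\<Union>W\<in>T. (\<lambda>h. h \<otimes> a) ` {h \<in> carrier G. h <# E = W})"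
    proof (cases "z <# E \<subseteq> E")
      case True
      then have "z <# E \<in> T" using 1 e y thin_l_coset[OF z(1) h(3)] by (auto simp: T_def)
      moreover have "x \<in> (\<lambda>h. h \<otimes> a) ` {h \<in> carrier G. h <# E = z <# E}"
        using z by (intro image_eqI[of _ _ z]) auto
      ultimately show ?thesis by blast
    next
      case False
      then have "z \<otimes> b \<notin> E" using 2 zb by blast
      moreover have "(x, z \<otimes> b) \<in> arcs" using arcs_translate[of z a b] z ab' by simp
      ultimately have "(x, z \<otimes> b) \<in> bd E" using x by (simp add: boundary_def)
      then have "x \<in> fst ` bd E" by (intro image_eqI[of _ _ "(x, z \<otimes> b)"]) simp_all
      then show ?thesis by blast
    qed
  qed
  moreover have "finite (fst ` bd E \<union> (\<Union>W\<in>T. (\<lambda>h. h \<otimes> a) ` {h \<in> carrier G. h <# E = W}))"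
    using T ne(3) finite_translates_eq[OF h(3)] by blast
  ultimately show ?thesis by (rule finite_subset)
qed

text \<open>\<open>A\<close> contains a forward translate of \<open>E\<close> and a backward
  translate of its complement; what remains lies in a translate of a finite slab.\<close>

lemma both_ends_imp_cofinite:
  assumes hyp: "hyperbolic s E" "optimal_cut E" "fixes_axis s E"
    and A: "A \<in> attractor s E" "A \<in> repeller s E"
  shows "finite (carrier G - A)"
proof -
  note h = hyperbolicD[OF hyp(1)]
  obtain m k where mk: "(s [^] (m::nat)) <# E \<subseteq> A" "(inv s [^] (k::nat)) <# (carrier G - E) \<subseteq> A"
    using A by (auto simp: attractor_def)
  let ?x = "inv s [^] k"
  have x: "?x \<in> carrier G" "?x = inv (s [^] k)" using h by (auto simp: nat_pow_inv)
  have "carrier G - A \<subseteq> ?x <# (E - ((s [^] (k + m)) <# E))"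
  proof
    fix z assume z: "z \<in> carrier G - A"
    then have "z \<notin> ?x <# (carrier G - E)" "z \<notin> (s [^] m) <# E" using mk by auto
    then have 1: "inv ?x \<otimes> z \<in> E" "inv (s [^] m) \<otimes> z \<notin> E"
      using z h x by (auto simp: mem_l_coset_iff)
    have "inv (s [^] (k + m)) \<otimes> (inv ?x \<otimes> z) = inv (s [^] m) \<otimes> z"
      using z h x(2) by (simp add: nat_pow_mult[symmetric] inv_mult_group m_assoc)
        (simp add: m_assoc[symmetric])
    then have "inv ?x \<otimes> z \<notin> (s [^] (k + m)) <# E"
      using 1 h z by (simp add: mem_l_coset_iff)
    then show "z \<in> ?x <# (E - ((s [^] (k + m)) <# E))"
      using 1 z x h mem_l_coset_iff[of ?x "E - ((s [^] (k + m)) <# E)" z] by auto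
  qed
  moreover have "finite (?x <# (E - ((s [^] (k + m)) <# E)))"
    using finite_slab[OF hyp] by (simp add: l_coset_image)
  ultimately show ?thesis by (rule finite_subset)
qed

lemma cut_separates_axis_ends:
  assumes hyp: "hyperbolic s E" "optimal_cut E" "fixes_axis s E" and A: "cut arcs (carrier G) A"
  shows "A \<in> attractor s E \<longleftrightarrow> carrier G - A \<in> repeller s E"
proof -
  have tame: "tame A" "infinite A" "infinite (carrier G - A)" "A \<subseteq> carrier G"
    using A by (auto simp: tame_def cut_def)
  have ends: "is_end (attractor s E)" "is_end (repeller s E)"
    using is_end_attractor is_end_repeller hyp by auto
  have "\<not> (A \<in> attractor s E \<and> A \<in> repeller s E)"
    using both_ends_imp_cofinite[OF hyp, of A] tame by blast
  moreover have "\<not> (carrier G - A \<in> attractor s E \<and> carrier G - A \<in> repeller s E)"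
    using both_ends_imp_cofinite[OF hyp, of "carrier G - A"] tame by (auto simp: double_diff)
  ultimately show ?thesis using is_endD(2)[OF ends(1) tame(1)] is_endD(2)[OF ends(2) tame(1)] by blast
qed

lemma power_enters:
  assumes hyp: "hyperbolic s E" and fx: "translate_end x (attractor s E) = attractor s E"
    and x: "x \<in> carrier G" and A: "A \<in> attractor s E"
  shows "\<exists>m::nat. x \<otimes> s [^] m \<in> A"
proof -
  note h = hyperbolicD[OF hyp]
  have end_p: "is_end (attractor s E)" using is_end_attractor hyp by auto
  have AG: "A \<subseteq> carrier G" using is_endD(1)[OF end_p A] by (simp add: tame_def)
  have "inv x <# A \<in> attractor s E"
    using mem_translate_end[OF x end_p AG] fx A by simp
  then obtain m where m: "(s [^] (m::nat)) <# E \<subseteq> inv x <# A" by (auto simp: attractor_def)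
  \<comment> \<open>\<one> need not lie in \<open>E\<close>, but some power of \<open>s\<close>
    does: \<one> escapes from the backward translates of the complement of \<open>E\<close>.\<close>
  obtain i where i: "\<one> \<notin> (inv s [^] (i::nat)) <# (carrier G - E)"
    using hyperbolic_escape[OF hyperbolic_inv[OF hyp], of \<one>] by auto
  then have "s [^] i \<in> E" using h by (simp add: mem_l_coset_iff nat_pow_inv)
  then have "s [^] m \<otimes> s [^] i \<in> (s [^] m) <# E" by (auto simp: l_coset_def)
  then have "s [^] (m + i) \<in> inv x <# A" using m h by (auto simp: nat_pow_mult)
  then have "x \<otimes> s [^] (m + i) \<in> A" using x AG h by (simp add: mem_l_coset_iff)
  then show ?thesis by blast
qed

text \<open>\<open>Y\<close> separates \<open>A\<close> from the rest, and every coset of \<open>\<langle>s\<rangle>\<close> is a path between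
  the two ends.\<close>

lemma coset_meets_separator:
  assumes hyp: "hyperbolic s E" "optimal_cut E" "fixes_axis s E" and s: "s \<in> S"
    and A: "cut arcs (carrier G) A"
    and Y: "\<And>x t. x \<in> A \<Longrightarrow> t \<in> S \<Longrightarrow> x \<otimes> t \<in> A \<union> Y"
    and AY: "A \<inter> Y = {}"
    and x: "x \<in> carrier G"
  shows "\<exists>j::int. x \<otimes> s [^] j \<in> Y"
proof -
  note h = hyperbolicD[OF hyp(1)]
  have AG: "A \<subseteq> carrier G" using A by (simp add: cut_def)
  have fx: "translate_end x (attractor s E) = attractor s E" "translate_end x (repeller s E) = repeller s E"
    using hyp(3) x by (auto simp: fixes_axis_def)
  have ends: "is_end (attractor s E)" "is_end (repeller s E)"
    using is_end_attractor is_end_repeller hyp by auto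
  have tA: "tame A" using A by (simp add: tame_def cut_def)
  have sep: "A \<in> attractor s E \<longleftrightarrow> carrier G - A \<in> repeller s E"
    using cut_separates_axis_ends[OF hyp A] .
  \<comment> \<open>The side of the separation that contains the attracting end.\<close>
  define B where "B = (if A \<in> attractor s E then A else carrier G - A)"
  have B: "B \<in> attractor s E" "carrier G - B \<in> repeller s E"
    using sep is_endD(2)[OF ends(1) tA] is_endD(2)[OF ends(2) tA] AG
    by (auto simp: B_def double_diff)
  obtain m where m: "x \<otimes> s [^] (m::nat) \<in> B" using power_enters[OF hyp(1) fx(1) x B(1)] by blast
  obtain k where k: "x \<otimes> inv s [^] (k::nat) \<in> carrier G - B"
    using power_enters[OF hyperbolic_inv[OF hyp(1)] fx(2) x B(2)] by blast
  \<comment> \<open>The coset as a path indexed by naturals, beginning at exponent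
    \<open>- k\<close>, outside \<open>B\<close>. The step that first enters \<open>B\<close>
    crosses the boundary of \<open>A\<close>, so one of its endpoints is in
    \<open>Y\<close>.\<close>
  define f where "f l = x \<otimes> s [^] (int l - int k)" for l :: nat
  have "f 0 = x \<otimes> inv s [^] k" using h(1) by (simp add: f_def int_pow_neg int_pow_int nat_pow_inv)
  then have f0: "f 0 \<notin> B" using k by simp
  have "f (k + m) \<in> B" using m by (simp add: f_def int_pow_int)
  from ex_least_nat_less[of "\<lambda>l. f l \<in> B", OF this f0]
  obtain l where l: "f l \<notin> B" "f (Suc l) \<in> B" by auto
  have fG: "f j \<in> carrier G" for j using x h by (simp add: f_def)
  have step: "f (Suc l) = f l \<otimes> s"
  proof -
    have "s [^] (int (Suc l) - int k) = s [^] ((int l - int k) + 1)" by (simp add: algebra_simps)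
    also have "\<dots> = s [^] (int l - int k) \<otimes> s" using h(1) by (simp only: int_pow_mult) simp
    finally show ?thesis using x h(1) by (simp add: f_def m_assoc)
  qed
  then have step': "f l = f (Suc l) \<otimes> inv s" using fG h(1) by (simp add: m_assoc)
  have "f l \<in> Y \<or> f (Suc l) \<in> Y"
  proof (cases "A \<in> attractor s E")
    case True
    then have "f (Suc l) \<in> A" "f l \<notin> A" using l by (auto simp: B_def)
    then show ?thesis using Y[of "f (Suc l)" "inv s"] step' gens_inv[OF s] by auto
  next
    case False
    then have "f l \<in> A" "f (Suc l) \<notin> A" using l fG by (auto simp: B_def)
    then show ?thesis using Y[of "f l" s] step s by auto
  qed
  then show ?thesis unfolding f_def by blast
qed

lemma hyperbolic_infinite_order:
  assumes hyp: "hyperbolic s E" and m: "m > 0"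
  shows "s [^] (m::nat) \<noteq> \<one>"
proof
  note h = hyperbolicD[OF hyp]
  assume eq: "s [^] m = \<one>"
  obtain k where k: "m = Suc k" using m gr0_implies_Suc by blast
  have "(s [^] Suc k) <# E \<subseteq> (s [^] (1::nat)) <# E" using pow_l_coset_antimono[OF hyp, of 1 "Suc k"] by simp
  then have "E \<subseteq> s <# E" using eq k h by (simp add: lcos_mult_one)
  then show False using h by blast
qed

text \<open>The hyperbolic \<open>g\<close> may be a product of two generators. The whole group
  fixes its axis ends, so the translates of \<open>E\<close> form a chain. The stabilizer of
  \<open>E\<close> is finite, hence some generator moves \<open>E\<close>, and it or its inverse
  shrinks \<open>E\<close>.\<close>

lemma exists_hyperbolic_gen:
  assumes cut: "cut arcs (carrier G) A"
    and engel: "\<And>g s. g \<in> short_elts \<Longrightarrow> s \<in> S \<Longrightarrow> iter_comm G (Suc k) g s = \<one>"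
      "\<And>g s. g \<in> short_elts \<Longrightarrow> s \<in> S \<Longrightarrow> iter_comm G (Suc k) s g = \<one>"
  shows "\<exists>s\<in>S. \<exists>E. hyperbolic s E \<and> optimal_cut E \<and> fixes_axis s E"
proof -
  have inf: "infinite (carrier G)" using cut finite_subset by (auto simp: cut_def)
  obtain E0 where "optimal_cut E0" using arcs.exists_optimal[OF cut] by blast
  from exists_short_hyperbolic[OF this] obtain g E where
    g: "g \<in> short_elts" "optimal_cut E" "g <# E \<subset> E" by blast
  have hyp: "hyperbolic g E" using g short_elts_closed by (auto simp: hyperbolic_def optimal_def)
  have fix_all: "fixes_axis g' E" if "hyperbolic g' E" "g' \<in> short_elts" for g'
    unfolding fixes_axis_def
    using gens_fix_axis_ends[OF that(1) g(2) engel[OF that(2)]] by blast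
  have EG: "E \<subseteq> carrier G" and thinE: "thin_cut E" using g(2) by (auto simp: optimal_def arcs.thin_subset)
  have "\<exists>s\<in>S. s <# E \<noteq> E"
  proof (rule ccontr)
    assume "\<not> ?thesis"
    then have *: "s <# E = E" if "s \<in> S" for s using that by blast
    have "x \<in> stabilizer E" if "x \<in> carrier G" for x
      using that
    proof (induction x rule: generate_induct_left)
      case one
      then show ?case using lcos_mult_one[OF EG] by (simp add: stabilizer_def)
    next
      case (mult s x)
      then show ?case using lcos_m_assoc[OF EG, of s x] * by (simp add: stabilizer_def)
    qed
    then have "carrier G \<subseteq> stabilizer E" by (rule subsetI)
    then show False using finite_stabilizer[OF thinE] inf finite_subset by metis
  qed
  then obtain s where s: "s \<in> S" "s <# E \<noteq> E" by blast
  have "s <# E \<subseteq> E \<or> E \<subseteq> s <# E"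
    using translates_comparable[OF hyp g(2) fix_all[OF hyp g(1)], of s \<one>] s EG by (auto simp: lcos_mult_one)
  then have "s <# E \<subset> E \<or> inv s <# E \<subset> E"
    using s inv_l_coset_psubset_iff[of s E E] EG by auto
  then obtain s' where "s' \<in> S" "hyperbolic s' E"
    using s gens_inv thinE by (auto simp: hyperbolic_def)
  then show ?thesis using g(2) fix_all gens_short by blast
qed

lemma int_pow_inj:
  assumes "s \<in> carrier G" "\<And>m::nat. m > 0 \<Longrightarrow> s [^] m \<noteq> \<one>" "s [^] (i::int) = s [^] (j::int)"
  shows "i = j"
proof (rule ccontr)
  assume ne: "i \<noteq> j"
  have *: False if "a < b" "s [^] a = s [^] b" for a b :: int
  proof -
    have "s [^] (b - a) = \<one>" using that assms(1) by (simp add: int_pow_diff)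
    then have "s [^] nat (b - a) = \<one>" using that(1) int_pow_int[of G s "nat (b - a)"] by simp
    then show False using assms(2)[of "nat (b - a)"] that(1) by simp
  qed
  from ne consider "i < j" | "j < i" by linarith
  then show False using *[of i j] *[of j i] assms(3) by cases simp_all
qed

text \<open>Here \<open>t\<close> may itself be a power of \<open>s\<close>. Whether the group is
  cyclic is sorted out by \<open>std_form_exists\<close>, after projection to the finite
  group.\<close>

theorem two_ended_structure:
  assumes A: "cut arcs (carrier G) A"
    and Y: "\<And>x t. x \<in> A \<Longrightarrow> t \<in> S \<Longrightarrow> x \<otimes> t \<in> A \<union> Y"
    and AY: "A \<inter> Y = {}" and cY: "finite Y" "card Y \<le> 2"
    and engel: "\<And>g s. g \<in> short_elts \<Longrightarrow> s \<in> S \<Longrightarrow> iter_comm G (Suc k) g s = \<one>"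
      "\<And>g s. g \<in> short_elts \<Longrightarrow> s \<in> S \<Longrightarrow> iter_comm G (Suc k) s g = \<one>"
  shows "\<exists>s\<in>S. (\<forall>m>0. s [^] (m::nat) \<noteq> \<one>) \<and> (\<exists>t\<in>carrier G. s \<otimes> t = t \<otimes> s
           \<and> (\<forall>x\<in>carrier G. \<exists>j::int. x = s [^] j \<or> x = t \<otimes> s [^] j))"
proof -
  obtain s E where s: "s \<in> S" and hyp: "hyperbolic s E" "optimal_cut E" "fixes_axis s E"
    using exists_hyperbolic_gen[OF A engel] by blast
  have sG [simp]: "s \<in> carrier G" using s by simp
  have ord: "s [^] m \<noteq> \<one>" if "m > 0" for m :: nat using hyperbolic_infinite_order[OF hyp(1) that] .
  have meets: "\<exists>j::int. x \<otimes> s [^] j \<in> Y" if "x \<in> carrier G" for x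
    using coset_meets_separator[OF hyp s A Y AY that] by blast
  let ?Z = "range (\<lambda>j::int. s [^] j)"
  have ZG: "?Z \<subseteq> carrier G" by auto
  have Zmult: "x \<otimes> y \<in> ?Z" if "x \<in> ?Z" "y \<in> ?Z" for x y
    using that by (auto simp: int_pow_mult[symmetric])
  have Zinv: "inv x \<in> ?Z" if "x \<in> ?Z" for x
    using that by (auto simp: int_pow_neg[symmetric])
  have sZ: "s \<in> ?Z" using rangeI[of "\<lambda>j::int. s [^] j" 1] by simp
  have split: "x \<in> ?Z" if "x \<otimes> s [^] (i::int) = s [^] (j::int)" "x \<in> carrier G" for x i j
  proof -
    have "x = s [^] j \<otimes> inv (s [^] i)" using that inv_solve_right[of x "s [^] j" "s [^] i"] by simp
    then show ?thesis using Zmult[OF rangeI Zinv[OF rangeI]] by simp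
  qed
  have split': "\<exists>l. x = t \<otimes> s [^] (l::int)"
    if "x \<otimes> s [^] (i::int) = t \<otimes> s [^] (j::int)" "x \<in> carrier G" "t \<in> carrier G" for x t i j
  proof -
    have "x = t \<otimes> s [^] j \<otimes> inv (s [^] i)" using that inv_solve_right[of x "t \<otimes> s [^] j" "s [^] i"] by simp
    then have "x = t \<otimes> s [^] (j - i)" using that by (simp add: m_assoc int_pow_diff)
    then show ?thesis by (rule exI)
  qed
  show ?thesis
  proof (cases "S \<subseteq> ?Z")
    case True
    have "x \<in> ?Z" if "x \<in> carrier G" for x
      using that
    proof (induction x rule: generate_induct_left)
      case one
      then show ?case using rangeI[of "\<lambda>j::int. s [^] j" 0] by simp
    next
      case (mult t x)
      then show ?case using Zmult True by blast
    qed
    then have "\<exists>t\<in>carrier G. s \<otimes> t = t \<otimes> s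
           \<and> (\<forall>x\<in>carrier G. \<exists>j::int. x = s [^] j \<or> x = t \<otimes> s [^] j)"
      by (intro bexI[of _ \<one>]) auto
    then show ?thesis using s ord by blast
  next
    case False
    then obtain t where t: "t \<in> S" "t \<notin> ?Z" by blast
    have tG [simp]: "t \<in> carrier G" using t by simp
    have all: "\<exists>j::int. x = s [^] j \<or> x = t \<otimes> s [^] j" if x: "x \<in> carrier G" for x
    proof -
      \<comment> \<open>The cosets of \<one>, \<open>t\<close> and \<open>x\<close> each supply a
        point of \<open>Y\<close>. As \<open>Y\<close> has at most two points and the first two
        cosets are disjoint, the third coincides with one of them.\<close>
      obtain i1 i2 i3 where i: "\<one> \<otimes> s [^] (i1::int) \<in> Y" "t \<otimes> s [^] (i2::int) \<in> Y" "x \<otimes> s [^] (i3::int) \<in> Y"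
        using meets[of \<one>] meets[of t] meets[OF x] by auto
      let ?a = "s [^] i1" and ?b = "t \<otimes> s [^] i2" and ?c = "x \<otimes> s [^] i3"
      have "{?a, ?b, ?c} \<subseteq> Y" using i by simp
      then have "card {?a, ?b, ?c} \<le> 2" using cY card_mono by (meson order_trans)
      moreover have "?b \<noteq> ?a" using split[of t i2 i1] t by auto
      ultimately have "?c = ?a \<or> ?c = ?b" by (auto simp: card_insert_if split: if_splits)
      then show ?thesis using split[of x i3 i1] split'[of x i3 t i2] x by auto
    qed
    have notZ: "s \<otimes> t \<notin> ?Z"
    proof
      assume "s \<otimes> t \<in> ?Z"
      then have "inv s \<otimes> (s \<otimes> t) \<in> ?Z" by (rule Zmult[OF Zinv[OF sZ]])
      then show False using t(2) by (simp add: m_assoc[symmetric])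
    qed
    have notZ': "inv t \<notin> ?Z"
    proof
      assume "inv t \<in> ?Z"
      then have "inv (inv t) \<in> ?Z" by (rule Zinv)
      then show False using t(2) by simp
    qed
    have notZ'': "s \<otimes> inv t \<notin> ?Z"
    proof
      assume "s \<otimes> inv t \<in> ?Z"
      then have "inv s \<otimes> (s \<otimes> inv t) \<in> ?Z" by (rule Zmult[OF Zinv[OF sZ]])
      then show False using notZ' by (simp add: m_assoc[symmetric])
    qed
    \<comment> \<open>Conjugation by \<open>t\<close> and by its inverse send \<open>s\<close> to
      the powers with exponents \<open>j\<close> and \<open>i - l\<close>, in one order or the
      other. Composing them gives \<open>j * (i - l) = 1\<close>, as \<open>s\<close> has infinite
      order, so \<open>j\<close> is 1 or -1.\<close>
    obtain j where j: "s \<otimes> t = t \<otimes> s [^] (j::int)" using all[of "s \<otimes> t"] notZ by auto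
    obtain l where l: "inv t = t \<otimes> s [^] (l::int)" using all[of "inv t"] notZ' by auto
    obtain i where i: "s \<otimes> inv t = t \<otimes> s [^] (i::int)" using all[of "s \<otimes> inv t"] notZ'' by auto
    have "inv t \<otimes> s [^] (i - l) = t \<otimes> (s [^] l \<otimes> s [^] (i - l))" by (simp add: l m_assoc)
    also have "\<dots> = s \<otimes> inv t" by (simp add: i int_pow_mult[symmetric])
    finally have e: "s \<otimes> inv t = inv t \<otimes> s [^] (i - l)" by simp
    have conj_pow: "s [^] a \<otimes> t = t \<otimes> s [^] (j * a)" for a :: int
    proof -
      have st: "inv t \<otimes> s \<otimes> t = s [^] j"
      proof -
        have "inv t \<otimes> s \<otimes> t = inv t \<otimes> (t \<otimes> s [^] j)" using j by (simp add: m_assoc)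
        then show ?thesis by (simp add: m_assoc[symmetric])
      qed
      have "(inv t \<otimes> s \<otimes> t) [^] a = inv t \<otimes> s [^] a \<otimes> t"
      proof -
        have n: "(inv t \<otimes> s \<otimes> t) [^] (n::nat) = inv t \<otimes> s [^] n \<otimes> t" for n
        proof (induction n)
          case (Suc n)
          have "t \<otimes> (inv t \<otimes> (s \<otimes> t)) = s \<otimes> t" by (simp add: m_assoc[symmetric])
          then show ?case using Suc by (simp add: m_assoc)
        qed simp
        show ?thesis
        proof (cases a)
          case (nonneg n)
          then show ?thesis using n by (simp add: int_pow_int)
        next
          case (neg n)
          have "(inv t \<otimes> s \<otimes> t) [^] a = inv (inv t \<otimes> s [^] (Suc n) \<otimes> t)"
            using neg n[of "Suc n"] by (simp add: int_pow_neg int_pow_int del: nat_pow_Suc of_nat_Suc)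
          also have "\<dots> = inv t \<otimes> s [^] a \<otimes> t"
            using neg by (simp add: inv_mult_group int_pow_neg int_pow_int m_assoc del: nat_pow_Suc of_nat_Suc)
          finally show ?thesis .
        qed
      qed
      then have "inv t \<otimes> s [^] a \<otimes> t = s [^] (j * a)" using st by (simp add: int_pow_pow)
      then have "t \<otimes> (inv t \<otimes> s [^] a \<otimes> t) = t \<otimes> s [^] (j * a)" by simp
      then show ?thesis by (simp add: m_assoc[symmetric])
    qed
    have "s [^] (1::int) = s [^] (j * (i - l))"
    proof -
      have "t \<otimes> s [^] (j * (i - l)) = s [^] (i - l) \<otimes> t" using conj_pow by simp
      also have "\<dots> = t \<otimes> (inv t \<otimes> s [^] (i - l)) \<otimes> t" by (simp add: m_assoc[symmetric])
      also have "\<dots> = t \<otimes> s" by (simp add: e[symmetric] m_assoc)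
      finally show ?thesis by simp
    qed
    then have "j * (i - l) = 1" using int_pow_inj[OF sG ord] by metis
    then have "j = 1 \<or> j = -1" using zmult_eq_1_iff by auto
    \<comment> \<open>If \<open>t\<close> inverted \<open>s\<close>, each commutation with
      \<open>t\<close> would double the exponent of \<open>s\<close>. The iterated commutator would
      be a power of \<open>s\<close> with a positive exponent, which is nontrivial.\<close>
    moreover have "j \<noteq> -1"
    proof
      assume "j = -1"
      then have flip: "t \<otimes> inv (s [^] (m::nat)) \<otimes> inv t = s [^] m" for m
      proof -
        have "s [^] m \<otimes> t = t \<otimes> inv (s [^] m)"
          using conj_pow[of "int m"] \<open>j = -1\<close> by (simp add: int_pow_neg int_pow_int)
        then have "t \<otimes> inv (s [^] m) \<otimes> inv t = s [^] m \<otimes> t \<otimes> inv t" by simp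
        then show ?thesis by (simp add: m_assoc)
      qed
      have "iter_comm G (Suc n) t s = s [^] ((2::nat) ^ Suc n)" for n
      proof (induction n)
        case 0
        then show ?case using flip[of 1] by (simp add: numeral_2_eq_2)
      next
        case (Suc n)
        have "iter_comm G (Suc (Suc n)) t s = s [^] ((2::nat) ^ Suc n) \<otimes> s [^] ((2::nat) ^ Suc n)"
          using Suc flip[of "2 ^ Suc n"] by (simp del: power_Suc)
        then show ?case by (simp add: nat_pow_mult mult_2)
      qed
      then have "s [^] ((2::nat) ^ Suc k) = \<one>" using engel(1)[OF gens_short[OF t(1)] s] by simp
      then show False using ord[of "2 ^ Suc k"] by simp
    qed
    ultimately have "s \<otimes> t = t \<otimes> s" using j by simp
    then show ?thesis using all s ord tG by blast
  qed
qed

end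

section \<open>The group of the local covering\<close>

lemma adj_sym: "adj K x y \<Longrightarrow> adj K y x"
  by (auto simp: adj_def insert_commute)

lemma walk_single [simp]: "walk K [x] \<longleftrightarrow> x \<in> verts K"
  by (simp add: walk_def)

lemma walk_Cons [simp]: "walk K (x # y # l) \<longleftrightarrow> adj K x y \<and> walk K (y # l)"
proof
  assume w: "walk K (x # y # l)"
  have "adj K ((x # y # l) ! 0) ((x # y # l) ! Suc 0)" using w unfolding walk_def by auto
  moreover have "adj K ((y # l) ! i) ((y # l) ! Suc i)" if "Suc i < length (y # l)" for i
  proof -
    have "Suc (Suc i) < length (x # y # l)" using that by simp
    then have "adj K ((x # y # l) ! Suc i) ((x # y # l) ! Suc (Suc i))" using w unfolding walk_def by blast
    then show ?thesis by simp
  qed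
  ultimately show "adj K x y \<and> walk K (y # l)" using w by (auto simp: walk_def)
next
  assume w: "adj K x y \<and> walk K (y # l)"
  have "adj K ((x # y # l) ! i) ((x # y # l) ! Suc i)" if "Suc i < length (x # y # l)" for i
    using w that by (cases i) (auto simp: walk_def)
  then show "walk K (x # y # l)" using w by (auto simp: walk_def adj_def)
qed

lemma walk_not_Nil [simp]: "\<not> walk K []"
  by (simp add: walk_def)

lemma walk_append:
  assumes "p \<noteq> []" "q \<noteq> []"
  shows "walk K (p @ q) \<longleftrightarrow> walk K p \<and> walk K q \<and> adj K (last p) (hd q)"
  using assms
proof (induction p)
  case (Cons x p)
  then show ?case
  proof (cases p)
    case Nil
    then show ?thesis using Cons.prems by (cases q) (auto simp: adj_def)
  qed auto
qed simp

lemma reachable_refl: "x \<in> verts K \<Longrightarrow> reachable K x x"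
  unfolding reachable_def by (rule exI[of _ "[x]"]) simp

lemma reachable_step:
  assumes "reachable K x y" "adj K y z"
  shows "reachable K x z"
proof -
  obtain w where w: "walk K w" "hd w = x" "last w = y" using assms by (auto simp: reachable_def)
  then have "w \<noteq> []" by auto
  then have "walk K (w @ [z])" using w assms(2) walk_append[of w "[z]" K] by (auto simp: adj_def)
  then show ?thesis unfolding reachable_def using w \<open>w \<noteq> []\<close> by (intro exI[of _ "w @ [z]"]) simp
qed

lemma reachable_induct [consumes 1, case_names refl step]:
  assumes "reachable K x y" "x \<in> verts K \<Longrightarrow> P x"
    and "\<And>y z. reachable K x y \<Longrightarrow> P y \<Longrightarrow> adj K y z \<Longrightarrow> P z"
  shows "P y"
proof -
  obtain w where w: "walk K w" "hd w = x" "last w = y" using assms by (auto simp: reachable_def)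
  have "w \<noteq> []" using w by auto
  then have "reachable K (hd w) (last w) \<and> P (last w)" using w(1,2)
  proof (induction w rule: rev_induct)
    case (snoc z w)
    show ?case
    proof (cases "w = []")
      case True
      then show ?thesis using snoc.prems assms(2) reachable_refl[of x K] by simp
    next
      case False
      then have "walk K w" "adj K (last w) z" using snoc.prems walk_append[of w "[z]"] by auto
      then show ?thesis using snoc False assms(3)[of "last w" z] reachable_step[of K x "last w" z] by auto
    qed
  qed simp
  then show ?thesis using w by simp
qed

lemma reachable_trans:
  assumes "reachable K x y" "reachable K y z"
  shows "reachable K x z"
  using assms(2,1)
proof (induction rule: reachable_induct)
  case (step y z)
  then show ?case using reachable_step by metis
qed

lemma reachable_verts: "reachable K x y \<Longrightarrow> x \<in> verts K \<and> y \<in> verts K"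
  unfolding reachable_def walk_def by (metis hd_in_set last_in_set subsetD)

lemma reachable_sym:
  assumes "reachable K x y"
  shows "reachable K y x"
  using assms
proof (induction rule: reachable_induct)
  case (step y z)
  have zy: "adj K z y" using \<open>adj K y z\<close> by (rule adj_sym)
  have "z \<in> verts K" using zy by (simp add: adj_def)
  then have "reachable K z y" using reachable_step[OF reachable_refl zy] by simp
  then show ?case using \<open>reachable K y x\<close> by (rule reachable_trans)
qed (rule reachable_refl)

locale short_relators = group G for G (structure) +
  fixes S :: "'a set" and r :: nat
  assumes gens: "cayley_gen_set G S" and gens_fin: "finite S" and r2: "r \<ge> 2"
begin

lemma S_sub: "S \<subseteq> carrier G" and one_notin_S: "\<one> \<notin> S" and S_inv: "s \<in> S \<Longrightarrow> inv s \<in> S"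
  and S_generate: "generate G S = carrier G"
  using gens by (auto simp: cayley_gen_set_def)

lemma S_closed [simp]: "s \<in> S \<Longrightarrow> s \<in> carrier G"
  using S_sub by blast

sublocale base: cayley_group G S
  using S_sub S_inv S_generate gens_fin by unfold_locales auto

section \<open>Words modulo short relators\<close>

definition word_val :: "'a list \<Rightarrow> 'a" where "word_val w = foldr (\<otimes>) w \<one>"

lemma word_val_Nil [simp]: "word_val [] = \<one>" and word_val_Cons [simp]: "word_val (s # w) = s \<otimes> word_val w"
  by (simp_all add: word_val_def)

lemma word_val_closed [simp]: "set w \<subseteq> S \<Longrightarrow> word_val w \<in> carrier G"
  by (induction w) auto

lemma word_val_append [simp]:
  "set u \<subseteq> S \<Longrightarrow> set v \<subseteq> S \<Longrightarrow> word_val (u @ v) = word_val u \<otimes> word_val v"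
  by (induction u) (auto simp: m_assoc)

text \<open>Insertion of short relators is the only rewriting rule. It includes free cancellation,
  because a letter followed by its inverse is a relator of length two and
  \<open>r \<ge> 2\<close>.\<close>

inductive word_eq :: "'a list \<Rightarrow> 'a list \<Rightarrow> bool" where
  word_eq_refl: "set w \<subseteq> S \<Longrightarrow> word_eq w w"
| word_eq_insert: "set (p @ u @ q) \<subseteq> S \<Longrightarrow> length u \<le> r \<Longrightarrow> word_val u = \<one> \<Longrightarrow> word_eq (p @ q) (p @ u @ q)"
| word_eq_sym: "word_eq u v \<Longrightarrow> word_eq v u"
| word_eq_trans: "word_eq u v \<Longrightarrow> word_eq v w \<Longrightarrow> word_eq u w"

lemma word_eq_words: "word_eq u v \<Longrightarrow> set u \<subseteq> S \<and> set v \<subseteq> S"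
  by (induction rule: word_eq.induct) auto

lemma word_eq_val: "word_eq u v \<Longrightarrow> word_val u = word_val v"
proof (induction rule: word_eq.induct)
  case (word_eq_insert p u q)
  then show ?case by simp
qed auto

lemma word_eq_context:
  assumes "word_eq u v" "set p \<subseteq> S" "set q \<subseteq> S"
  shows "word_eq (p @ u @ q) (p @ v @ q)"
  using assms
proof (induction rule: word_eq.induct)
  case (word_eq_refl w)
  then show ?case by (intro word_eq.word_eq_refl) auto
next
  case (word_eq_insert p' u q')
  then show ?case using word_eq.word_eq_insert[of "p @ p'" u "q' @ q"] by simp
next
  case (word_eq_sym u v)
  then show ?case using word_eq.word_eq_sym by blast
next
  case (word_eq_trans u v w)
  then show ?case using word_eq.word_eq_trans by blast
qed

lemma word_eq_append:
  assumes "word_eq u u'" "word_eq v v'"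
  shows "word_eq (u @ v) (u' @ v')"
  using word_eq_context[OF assms(1), of "[]" v] word_eq_context[OF assms(2), of u' "[]"]
    word_eq_words[OF assms(1)] word_eq_words[OF assms(2)] word_eq_trans by auto

definition inv_word :: "'a list \<Rightarrow> 'a list" where "inv_word w = rev (map (\<lambda>x. inv x) w)"

lemma inv_word_set [simp]: "set w \<subseteq> S \<Longrightarrow> set (inv_word w) \<subseteq> S"
  using S_inv by (auto simp: inv_word_def)

lemma length_inv_word [simp]: "length (inv_word w) = length w"
  by (simp add: inv_word_def)

lemma inv_word_inv_word: "set w \<subseteq> S \<Longrightarrow> inv_word (inv_word w) = w"
  by (induction w) (auto simp: inv_word_def)

lemma word_val_inv_word [simp]: "set w \<subseteq> S \<Longrightarrow> word_val (inv_word w) = inv (word_val w)"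
proof (induction w)
  case (Cons s w)
  have "inv_word (s # w) = inv_word w @ [inv s]" by (simp add: inv_word_def)
  then show ?case using Cons S_inv by (simp add: inv_mult_group)
qed (simp add: inv_word_def)

lemma word_eq_relator: "set u \<subseteq> S \<Longrightarrow> length u \<le> r \<Longrightarrow> word_val u = \<one> \<Longrightarrow> word_eq u []"
  using word_eq_insert[of "[]" u "[]"] word_eq_sym by simp

lemma word_eq_inv_right: "set w \<subseteq> S \<Longrightarrow> word_eq (w @ inv_word w) []"
proof (induction w)
  case Nil
  then show ?case by (simp add: inv_word_def word_eq_refl)
next
  case (Cons s w)
  have "word_eq ([s] @ (w @ inv_word w) @ [inv s]) ([s] @ [] @ [inv s])"
    using Cons S_inv by (intro word_eq_context) auto
  moreover have "word_eq ([s] @ [] @ [inv s]) []"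
    using Cons S_inv r2 by (intro word_eq_relator) auto
  moreover have "s # w @ inv_word (s # w) = [s] @ (w @ inv_word w) @ [inv s]"
    by (simp add: inv_word_def)
  ultimately show ?case using word_eq_trans by auto
qed

lemma word_eq_inv_left: "set w \<subseteq> S \<Longrightarrow> word_eq (inv_word w @ w) []"
  using word_eq_inv_right[of "inv_word w"] by (simp add: inv_word_inv_word)

definition cls :: "'a list \<Rightarrow> 'a list set" where "cls w = {v. word_eq w v}"

lemma cls_eq_iff: "set u \<subseteq> S \<Longrightarrow> cls u = cls v \<longleftrightarrow> word_eq u v"
  unfolding cls_def using word_eq_refl word_eq_sym word_eq_trans by blast

definition rep :: "'a list set \<Rightarrow> 'a list" where "rep A = (SOME w. w \<in> A)"

lemma rep_cls: "set w \<subseteq> S \<Longrightarrow> word_eq w (rep (cls w))"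
  unfolding rep_def cls_def using word_eq_refl someI_ex[of "\<lambda>v. word_eq w v"] by auto

text \<open>The group presented by the generators \<open>S\<close> and all relators of length at most \<open>r\<close>
  that hold in \<open>G\<close>.  Its Cayley graph is the \<open>r\<close>-local covering.\<close>

definition H :: "'a list set monoid" where
  "H = \<lparr>carrier = cls ` {w. set w \<subseteq> S}, monoid.mult = (\<lambda>A B. cls (rep A @ rep B)), one = cls []\<rparr>"

lemma carrier_H: "carrier H = cls ` {w. set w \<subseteq> S}" and one_H: "\<one>\<^bsub>H\<^esub> = cls []"
  by (simp_all add: H_def)

lemma cls_in_H [simp]: "set w \<subseteq> S \<Longrightarrow> cls w \<in> carrier H"
  by (auto simp: carrier_H)

lemma H_cases:
  assumes "x \<in> carrier H"
  obtains w where "set w \<subseteq> S" "x = cls w"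
  using assms by (auto simp: carrier_H)

lemma mult_H [simp]:
  assumes "set u \<subseteq> S" "set v \<subseteq> S"
  shows "cls u \<otimes>\<^bsub>H\<^esub> cls v = cls (u @ v)"
proof -
  have "word_eq (u @ v) (rep (cls u) @ rep (cls v))" using word_eq_append rep_cls assms by blast
  then have "cls (u @ v) = cls (rep (cls u) @ rep (cls v))" using assms by (simp add: cls_eq_iff)
  then show ?thesis by (simp add: H_def)
qed

lemma group_H: "group H"
proof (rule groupI)
  show "x \<otimes>\<^bsub>H\<^esub> y \<in> carrier H" if "x \<in> carrier H" "y \<in> carrier H" for x y
    using that by (elim H_cases) auto
  show "\<one>\<^bsub>H\<^esub> \<in> carrier H" by (simp add: one_H)
  show "x \<otimes>\<^bsub>H\<^esub> y \<otimes>\<^bsub>H\<^esub> z = x \<otimes>\<^bsub>H\<^esub> (y \<otimes>\<^bsub>H\<^esub> z)"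
    if "x \<in> carrier H" "y \<in> carrier H" "z \<in> carrier H" for x y z
    using that by (elim H_cases) auto
  show "\<one>\<^bsub>H\<^esub> \<otimes>\<^bsub>H\<^esub> x = x" if "x \<in> carrier H" for x
    using that by (elim H_cases) (auto simp: one_H)
  show "\<exists>y\<in>carrier H. y \<otimes>\<^bsub>H\<^esub> x = \<one>\<^bsub>H\<^esub>" if "x \<in> carrier H" for x
  proof -
    obtain w where w: "set w \<subseteq> S" "x = cls w" using \<open>x \<in> carrier H\<close> by (rule H_cases)
    then have "cls (inv_word w) \<otimes>\<^bsub>H\<^esub> x = \<one>\<^bsub>H\<^esub>"
      using word_eq_inv_left[OF w(1)] by (simp add: one_H cls_eq_iff)
    then show ?thesis using w by (intro bexI[of _ "cls (inv_word w)"]) auto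
  qed
qed

sublocale H: group H by (rule group_H)

lemma inv_cls [simp]: "set w \<subseteq> S \<Longrightarrow> inv\<^bsub>H\<^esub> (cls w) = cls (inv_word w)"
  using word_eq_inv_left[of w] by (intro H.inv_equality) (auto simp: one_H cls_eq_iff)

text \<open>\<open>u\<close> followed by the formal inverse of \<open>v\<close> is a relator of
  length at most \<open>r\<close>. Most equations in \<open>H\<close> are obtained in this
  way.\<close>

lemma short_eq:
  assumes "set u \<subseteq> S" "set v \<subseteq> S" "length u + length v \<le> r" "word_val u = word_val v"
  shows "cls u = cls v"
proof -
  have "word_val (u @ inv_word v) = \<one>" using assms by simp
  then have "word_eq (u @ inv_word v) []" using assms by (intro word_eq_relator) auto
  then have "cls (u @ inv_word v) = \<one>\<^bsub>H\<^esub>" using assms by (simp add: one_H cls_eq_iff)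
  then have "cls u \<otimes>\<^bsub>H\<^esub> inv\<^bsub>H\<^esub> cls v = \<one>\<^bsub>H\<^esub>" using assms by simp
  then have "inv\<^bsub>H\<^esub> (inv\<^bsub>H\<^esub> cls v) = cls u"
    by (rule H.inv_equality) (use assms in simp_all)
  then show ?thesis using H.inv_inv[of "cls v"] assms(2) by simp
qed

definition T :: "'a list set set" where "T = (\<lambda>s. cls [s]) ` S"

lemma inv_word_single [simp]: "inv_word [s] = [inv s]"
  by (simp add: inv_word_def)

lemma generate_T: "set w \<subseteq> S \<Longrightarrow> cls w \<in> generate H T"
proof (induction w)
  case Nil
  then show ?case using generate.one[of H T] by (simp add: one_H)
next
  case (Cons s w)
  then have "cls [s] \<in> generate H T" by (intro generate.incl) (auto simp: T_def)
  then have "cls [s] \<otimes>\<^bsub>H\<^esub> cls w \<in> generate H T" using Cons by (intro generate.eng) auto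
  then show ?case using Cons by simp
qed

lemma T_sub: "T \<subseteq> carrier H"
  by (auto simp: T_def)

sublocale cover: cayley_group H T
proof
  show "finite T" using gens_fin by (simp add: T_def)
  show "T \<subseteq> carrier H" by (rule T_sub)
  show "inv\<^bsub>H\<^esub> x \<in> T" if "x \<in> T" for x
    using that S_inv by (auto simp: T_def)
  show "generate H T = carrier H"
    using H.generate_incl[OF T_sub] generate_T by (auto elim!: H_cases)
qed

definition proj :: "'a list set \<Rightarrow> 'a" where "proj A = word_val (rep A)"

lemma proj_cls [simp]: "set w \<subseteq> S \<Longrightarrow> proj (cls w) = word_val w"
  using rep_cls[of w] word_eq_val by (auto simp: proj_def)

lemma proj_hom: "proj \<in> hom H G"
  by (rule homI) (auto elim!: H_cases)

lemma proj_surj: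
  assumes "x \<in> carrier G"
  shows "\<exists>w. set w \<subseteq> S \<and> word_val w = x"
  using assms
proof (induction x rule: base.generate_induct_left)
  case one
  then show ?case by (intro exI[of _ "[]"]) simp
next
  case (mult s x)
  then obtain w where "set w \<subseteq> S" "word_val w = x" by blast
  then show ?case using mult by (intro exI[of _ "s # w"]) simp
qed

text \<open>The words are left unreduced, so that their length obeys an exact recursion; reduction
  would not change their values.\<close>

fun comm_word :: "nat \<Rightarrow> 'a list \<Rightarrow> 'a list \<Rightarrow> 'a list" where
  "comm_word 0 u v = []"
| "comm_word (Suc 0) u v = u @ inv_word v @ inv_word u @ v"
| "comm_word (Suc (Suc k)) u v = u @ inv_word (comm_word (Suc k) u v) @ inv_word u @ comm_word (Suc k) u v"

lemma comm_word:
  assumes "set u \<subseteq> S" "set v \<subseteq> S"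
  shows "set (comm_word k u v) \<subseteq> S \<and> word_val (comm_word k u v) = iter_comm G k (word_val u) (word_val v)
    \<and> cls (comm_word k u v) = iter_comm H k (cls u) (cls v)"
proof (induction k)
  case 0
  then show ?case by (simp add: one_H)
next
  case (Suc k)
  show ?case
  proof (cases k)
    case 0
    then show ?thesis using assms by (simp add: m_assoc)
  next
    case (Suc j)
    note IH = Suc.IH[unfolded Suc]
    have e: "iter_comm H (Suc j) (cls u) (cls v) = cls (comm_word (Suc j) u v)"
      "iter_comm G (Suc j) (word_val u) (word_val v) = word_val (comm_word (Suc j) u v)"
      "set (comm_word (Suc j) u v) \<subseteq> S" using IH by auto
    show ?thesis unfolding Suc using assms e by (simp add: m_assoc)
  qed
qed

text \<open>Passing to the next commutator doubles the length and adds \<open>2 * length u\<close>.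
  Hence the length plus \<open>2 * length u\<close> doubles.\<close>

lemma length_comm_word: "length (comm_word (Suc k) u v) + 2 * length u = 2 ^ k * (4 * length u + 2 * length v)"
  by (induction k) (auto simp: algebra_simps)

text \<open>The definition of nilpotency leaves out the pairs \<open>x = y\<close> and
  \<open>x = inv y\<close>; these commute, so their first commutator is already trivial and all
  later ones follow.\<close>

lemma iter_comm_trivial:
  assumes "nilpotent_class_le G (Suc k)" "x \<in> carrier G" "y \<in> carrier G"
  shows "iter_comm G (Suc k) x y = \<one>"
proof (cases "x = y \<or> x = inv y")
  case False
  then show ?thesis using assms by (auto simp: nilpotent_class_le_def)
next
  case True
  then have "iter_comm G (Suc 0) x y = \<one>" using assms by (auto simp: m_assoc) (simp add: m_assoc[symmetric])
  then show ?thesis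
  proof (induction k)
    case (Suc k)
    then show ?case using assms by simp
  qed
qed

text \<open>The number 10 is \<open>4 * 2 + 2 * 1\<close>, for entries of lengths 2 and 1; the
  opposite order gives 8. The commutator word has length at most
  \<open>10 * 2 ^ k \<le> 16 * 4 ^ k\<close>, so it is a short relator.\<close>

lemma iter_comm_H:
  assumes nil: "nilpotent_class_le G (Suc k)" and r: "r \<ge> 4 ^ (k + 2)"
    and uv: "set u \<subseteq> S" "set v \<subseteq> S" "4 * length u + 2 * length v \<le> 10"
  shows "iter_comm H (Suc k) (cls u) (cls v) = \<one>\<^bsub>H\<^esub>"
proof -
  let ?w = "comm_word (Suc k) u v"
  have w: "set ?w \<subseteq> S" "word_val ?w = \<one>" "cls ?w = iter_comm H (Suc k) (cls u) (cls v)"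
    using comm_word[OF uv(1,2), of "Suc k"] iter_comm_trivial[OF nil] uv by auto
  have "length ?w \<le> 2 ^ k * (4 * length u + 2 * length v)"
    using length_comm_word[of k u v] by simp
  also have "\<dots> \<le> 2 ^ k * 10" using uv(3) by (intro mult_left_mono) auto
  also have "\<dots> \<le> 4 ^ k * 16" by (intro mult_mono power_mono) auto
  also have "\<dots> = 4 ^ (k + 2)" by (simp add: power_add)
  finally have "length ?w \<le> r" using r by simp
  then have "cls ?w = cls []" using w(1,2) by (simp add: cls_eq_iff word_eq_relator del: comm_word.simps)
  then show ?thesis using w by (simp add: one_H)
qed

lemma engel_H:
  assumes nil: "nilpotent_class_le G (Suc k)" and r: "r \<ge> 4 ^ (k + 2)"
    and g: "g \<in> cover.short_elts" and s: "s \<in> T"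
  shows "iter_comm H (Suc k) g s = \<one>\<^bsub>H\<^esub>" "iter_comm H (Suc k) s g = \<one>\<^bsub>H\<^esub>"
proof -
  have "\<exists>u. g = cls u \<and> set u \<subseteq> S \<and> length u \<le> 2"
    using g unfolding cover.short_elts_def
  proof (elim UnE CollectE exE conjE)
    assume "g \<in> T"
    then obtain a where "a \<in> S" "g = cls [a]" by (auto simp: T_def)
    then show ?thesis by (intro exI[of _ "[a]"]) auto
  next
    fix x y assume "g = x \<otimes>\<^bsub>H\<^esub> y" "x \<in> T" "y \<in> T"
    then obtain a b where "a \<in> S" "b \<in> S" "g = cls [a, b]" by (auto simp: T_def)
    then show ?thesis by (intro exI[of _ "[a, b]"]) auto
  qed
  then obtain u where u: "g = cls u" "set u \<subseteq> S" "length u \<le> 2" by blast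
  obtain a where a: "a \<in> S" "s = cls [a]" using s by (auto simp: T_def)
  show "iter_comm H (Suc k) g s = \<one>\<^bsub>H\<^esub>" "iter_comm H (Suc k) s g = \<one>\<^bsub>H\<^esub>"
    unfolding u(1) a(2) using u a by (intro iter_comm_H nil r; simp)+
qed

section \<open>Translation between walks in the Cayley graph and words\<close>

abbreviation "Cay \<equiv> cayley_graph G S"

lemma verts_Cay: "verts Cay = carrier G"
  by (simp add: cayley_graph_def verts_def)

lemma adj_Cay: "adj Cay x y \<longleftrightarrow> x \<in> carrier G \<and> y \<in> carrier G \<and> inv x \<otimes> y \<in> S"
proof
  assume a: "adj Cay x y"
  then have xy: "x \<in> carrier G" "y \<in> carrier G" by (auto simp: adj_def verts_Cay)
  obtain g s where gs: "{x, y} = {g, g \<otimes> s}" "g \<in> carrier G" "s \<in> S"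
    using a by (auto simp: adj_def cayley_graph_def edges_def)
  then consider "x = g" "y = g \<otimes> s" | "y = g" "x = g \<otimes> s" by (auto simp: doubleton_eq_iff)
  then have "inv x \<otimes> y \<in> S"
  proof cases
    case 1
    then show ?thesis using gs by (simp add: m_assoc[symmetric])
  next
    case 2
    then have "inv x \<otimes> y = inv s" using gs by (simp add: inv_mult_group m_assoc)
    then show ?thesis using S_inv gs by simp
  qed
  then show "x \<in> carrier G \<and> y \<in> carrier G \<and> inv x \<otimes> y \<in> S" using xy by simp
next
  assume xy: "x \<in> carrier G \<and> y \<in> carrier G \<and> inv x \<otimes> y \<in> S"
  then have "y = x \<otimes> (inv x \<otimes> y)" by (simp add: m_assoc[symmetric])
  then have "{x, y} = {x, x \<otimes> (inv x \<otimes> y)}" by simp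
  then have "{x, y} \<in> edges Cay" using xy unfolding cayley_graph_def edges_def snd_conv by blast
  moreover have "x \<noteq> y" using xy one_notin_S by auto
  ultimately show "adj Cay x y" using xy by (simp add: adj_def verts_Cay)
qed

lemma adj_Cay_mult [simp]: "x \<in> carrier G \<Longrightarrow> s \<in> S \<Longrightarrow> adj Cay x (x \<otimes> s)"
  by (simp add: adj_Cay m_assoc[symmetric])

fun path :: "'a \<Rightarrow> 'a list \<Rightarrow> 'a list" where
  "path x [] = [x]"
| "path x (s # w) = x # path (x \<otimes> s) w"

fun word_of :: "'a list \<Rightarrow> 'a list" where
  "word_of (x # y # l) = (inv x \<otimes> y) # word_of (y # l)"
| "word_of _ = []"

lemma path_nonempty [simp]: "path x w \<noteq> []"
  by (cases w) auto

lemma hd_path [simp]: "hd (path x w) = x"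
  by (cases w) auto

lemma last_path [simp]: "x \<in> carrier G \<Longrightarrow> set w \<subseteq> S \<Longrightarrow> last (path x w) = x \<otimes> word_val w"
  by (induction w arbitrary: x) (auto simp: m_assoc)

lemma length_path [simp]: "length (path x w) = Suc (length w)"
  by (induction w arbitrary: x) auto

lemma nth_path:
  "x \<in> carrier G \<Longrightarrow> set w \<subseteq> S \<Longrightarrow> q \<le> length w \<Longrightarrow> path x w ! q = x \<otimes> word_val (take q w)"
proof (induction w arbitrary: x q)
  case (Cons y w)
  have "set (take n w) \<subseteq> S" for n using Cons.prems(2) set_take_subset[of n w] by auto
  then show ?case using Cons by (cases q) (auto simp: m_assoc)
qed simp

lemma walk_path [simp]: "x \<in> carrier G \<Longrightarrow> set w \<subseteq> S \<Longrightarrow> walk Cay (path x w)"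
proof (induction w arbitrary: x)
  case (Cons s w)
  then have "walk Cay (path (x \<otimes> s) w)" by simp
  then show ?case using Cons.prems by (cases w) auto
qed (simp add: verts_Cay)

lemma word_of_path [simp]: "x \<in> carrier G \<Longrightarrow> set w \<subseteq> S \<Longrightarrow> word_of (path x w) = w"
proof (induction w arbitrary: x)
  case (Cons s w)
  then have "word_of (path (x \<otimes> s) w) = w" by simp
  moreover have "inv x \<otimes> (x \<otimes> s) = s" using Cons.prems by (simp add: m_assoc[symmetric])
  ultimately show ?case using Cons.prems by (cases w) auto
qed simp

lemma word_of_set: "walk Cay l \<Longrightarrow> set (word_of l) \<subseteq> S"
  by (induction l rule: word_of.induct) (auto simp: adj_Cay)

lemma path_word_of: "walk Cay l \<Longrightarrow> path (hd l) (word_of l) = l"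
proof (induction l rule: word_of.induct)
  case (1 x y l)
  then have "x \<otimes> (inv x \<otimes> y) = y" by (auto simp: adj_Cay m_assoc[symmetric])
  then show ?case using 1 by simp
qed auto

lemma walk_hd_closed: "walk Cay l \<Longrightarrow> hd l \<in> carrier G"
  by (auto simp: walk_def verts_Cay)

lemma length_word_of: "length (word_of l) = length l - 1"
  by (induction l rule: word_of.induct) auto

lemma last_eq_word_of: "walk Cay l \<Longrightarrow> last l = hd l \<otimes> word_val (word_of l)"
  using last_path[of "hd l" "word_of l"] by (simp add: path_word_of walk_hd_closed word_of_set)

lemma word_of_append: "word_of (p @ [u] @ q) = word_of (p @ [u]) @ word_of ([u] @ q)"
proof (induction p rule: word_of.induct)
  case ("2_2" v)
  then show ?case by (cases q) auto
qed auto

lemma path_append: "path x (u @ v) = butlast (path x u) @ path (last (path x u)) v"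
  by (induction u arbitrary: x) auto

lemma closed_walk_word:
  assumes "closed_walk Cay w" "walk_len w \<le> r"
  shows "set (word_of w) \<subseteq> S" "length (word_of w) \<le> r" "word_val (word_of w) = \<one>"
proof -
  have w: "walk Cay w" "hd w = last w" using assms by (auto simp: closed_walk_def)
  show s: "set (word_of w) \<subseteq> S" using word_of_set w by blast
  show "length (word_of w) \<le> r" using assms by (simp add: length_word_of walk_len_def)
  have "hd w = hd w \<otimes> word_val (word_of w)" using last_eq_word_of w by metis
  then show "word_val (word_of w) = \<one>" using walk_hd_closed[OF w(1)] s by (metis l_cancel_one' word_val_closed)
qed

text \<open>Read as words, a spliced closed walk is an inserted relator. A backtrack is a closed
  walk of length two, so both kinds of moves are covered by one case.\<close>

lemma walk_move_word_eq:
  assumes W: "walk_from Cay \<one> W" "walk_from Cay \<one> W'" and m: "walk_move Cay r W W'"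
  shows "word_eq (word_of W) (word_of W')"
proof -
  have "\<exists>Pa u Pb Cw. W = Pa @ [u] @ Pb \<and> W' = Pa @ Cw @ Pb \<and> closed_walk Cay Cw \<and> hd Cw = u \<and> walk_len Cw \<le> r"
    using m unfolding walk_move_def
  proof (elim disjE exE conjE)
    fix Pa u Pb w assume "W = Pa @ [u] @ Pb" "W' = Pa @ [u, w, u] @ Pb" and a: "adj Cay u w"
    moreover have "closed_walk Cay [u, w, u]" using a adj_sym[OF a] by (auto simp: closed_walk_def adj_def)
    ultimately show ?thesis using r2 by (intro exI[of _ Pa] exI[of _ u] exI[of _ Pb] exI[of _ "[u, w, u]"])
        (auto simp: walk_len_def)
  qed blast
  then obtain Pa u Pb Cw where c: "W = Pa @ [u] @ Pb" "W' = Pa @ Cw @ Pb" "closed_walk Cay Cw"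
    "hd Cw = u" "walk_len Cw \<le> r" by blast
  note cw = closed_walk_word[OF c(3,5)]
  have "Cw \<noteq> []" "last Cw = u" using c(3,4) by (auto simp: closed_walk_def)
  then obtain C1 C2 where C: "Cw = C1 @ [u]" "Cw = [u] @ C2" using c(4)
    by (metis append_butlast_last_id append_Cons append_Nil list.collapse)
  have "word_of W' = word_of (Pa @ C1 @ [u]) @ word_of ([u] @ Pb)"
    using word_of_append[of "Pa @ C1" u Pb] C(1) c(2) by simp
  also have "Pa @ C1 @ [u] = Pa @ [u] @ C2" using C by simp
  also have "word_of (Pa @ [u] @ C2) = word_of (Pa @ [u]) @ word_of Cw"
    using word_of_append[of Pa u C2] C(2) by simp
  finally have W': "word_of W' = word_of (Pa @ [u]) @ word_of Cw @ word_of ([u] @ Pb)" by simp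
  moreover have "word_of W = word_of (Pa @ [u]) @ word_of ([u] @ Pb)"
    using word_of_append[of Pa u Pb] c(1) by simp
  moreover have "set (word_of W') \<subseteq> S" using W(2) word_of_set by (auto simp: walk_from_def)
  ultimately show ?thesis using word_eq_insert[of "word_of (Pa @ [u])" "word_of Cw" "word_of ([u] @ Pb)"] cw by simp
qed

lemma homotopy_word_eq:
  assumes "(W, W') \<in> homotopy_rel Cay r \<one>" "walk_from Cay \<one> W"
  shows "word_eq (word_of W) (word_of W') \<and> walk_from Cay \<one> W'"
  using assms unfolding homotopy_rel_def
proof (induction rule: rtrancl_induct)
  case base
  then show ?case using word_eq_refl word_of_set by (auto simp: walk_from_def)
next
  case (step y z)
  then show ?case using walk_move_word_eq[of y z] walk_move_word_eq[of z y] word_eq_sym word_eq_trans by blast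
qed

lemma walk_from_path [simp]: "set w \<subseteq> S \<Longrightarrow> walk_from Cay \<one> (path \<one> w)"
  by (simp add: walk_from_def)

lemma homotopy_sym: "(W, W') \<in> homotopy_rel Cay r \<one> \<Longrightarrow> (W', W) \<in> homotopy_rel Cay r \<one>"
  unfolding homotopy_rel_def by (rule symD[OF sym_rtrancl]) (auto simp: sym_def)

text \<open>Inserting \<open>u\<close> after \<open>p\<close> splices a closed walk into the path at
  the endpoint of \<open>p\<close>. Consecutive pieces share a vertex, which \<open>butlast\<close>
  and \<open>tl\<close> keep from being listed twice.\<close>

lemma word_eq_homotopy:
  "word_eq u v \<Longrightarrow> (path \<one> u, path \<one> v) \<in> homotopy_rel Cay r \<one>"
proof (induction rule: word_eq.induct)
  case (word_eq_refl w)
  then show ?case by (simp add: homotopy_rel_def)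
next
  case (word_eq_insert p u q)
  let ?x = "word_val p"
  have p: "set p \<subseteq> S" "set u \<subseteq> S" "set q \<subseteq> S" using word_eq_insert by auto
  have x: "?x \<in> carrier G" "last (path \<one> p) = ?x" "last (path ?x u) = ?x" using p word_eq_insert(3) by auto
  have 1: "path \<one> (p @ q) = butlast (path \<one> p) @ [?x] @ tl (path ?x q)"
    using path_append[of \<one> p q] x by (cases q) auto
  have 2: "path \<one> (p @ u @ q) = butlast (path \<one> p) @ butlast (path ?x u) @ path ?x q"
    using path_append[of \<one> p "u @ q"] path_append[of ?x u q] x by simp
  have "butlast (path ?x u) @ [?x] = path ?x u"
    using append_butlast_last_id[of "path ?x u"] x by simp
  then have 3: "path \<one> (p @ u @ q) = butlast (path \<one> p) @ path ?x u @ tl (path ?x q)"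
    unfolding 2 by (cases q) auto
  have "closed_walk Cay (path ?x u)" "hd (path ?x u) = ?x" "walk_len (path ?x u) \<le> r"
    using x p word_eq_insert by (auto simp: closed_walk_def walk_len_def)
  then have "walk_move Cay r (path \<one> (p @ q)) (path \<one> (p @ u @ q))"
    unfolding walk_move_def using 1 3 by blast
  moreover have "walk_from Cay \<one> (path \<one> (p @ q))" "walk_from Cay \<one> (path \<one> (p @ u @ q))"
    using p by (intro walk_from_path; simp)+
  ultimately show ?case unfolding homotopy_rel_def by (intro r_into_rtrancl) auto
next
  case (word_eq_sym u v)
  then show ?case using homotopy_sym by blast
next
  case (word_eq_trans u v w)
  then show ?case unfolding homotopy_rel_def by (meson rtrancl_trans)
qed

section \<open>The local covering as a Cayley graph\<close>

definition lift :: "'a list set \<Rightarrow> 'a list set" where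
  "lift A = walk_class Cay r \<one> (path \<one> (rep A))"

lemma walk_class_eq_iff:
  assumes "walk_from Cay \<one> W" "walk_from Cay \<one> W'"
  shows "walk_class Cay r \<one> W = walk_class Cay r \<one> W' \<longleftrightarrow> word_eq (word_of W) (word_of W')"
proof
  have refl: "(W', W') \<in> homotopy_rel Cay r \<one>" by (simp add: homotopy_rel_def)
  assume "walk_class Cay r \<one> W = walk_class Cay r \<one> W'"
  then have "(W, W') \<in> homotopy_rel Cay r \<one>" using refl by (auto simp: walk_class_def)
  then show "word_eq (word_of W) (word_of W')" using homotopy_word_eq assms by blast
next
  assume e: "word_eq (word_of W) (word_of W')"
  have "path \<one> (word_of W) = W" "path \<one> (word_of W') = W'"
    using assms path_word_of[of W] path_word_of[of W'] by (simp_all add: walk_from_def)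
  then have h: "(W, W') \<in> homotopy_rel Cay r \<one>" using word_eq_homotopy[OF e] by simp
  then show "walk_class Cay r \<one> W = walk_class Cay r \<one> W'"
    using homotopy_sym[OF h] unfolding walk_class_def homotopy_rel_def
    by (auto intro: rtrancl_trans)
qed

lemma lift_cls: "set w \<subseteq> S \<Longrightarrow> lift (cls w) = walk_class Cay r \<one> (path \<one> w)"
proof -
  assume w: "set w \<subseteq> S"
  then have e: "word_eq w (rep (cls w))" by (rule rep_cls)
  then have "set (rep (cls w)) \<subseteq> S" using word_eq_words by blast
  then show ?thesis using e w word_eq_sym by (simp add: lift_def walk_class_eq_iff)
qed

lemma lift_inj: "inj_on lift (carrier H)"
proof (rule inj_onI)
  fix a b assume ab: "a \<in> carrier H" "b \<in> carrier H" "lift a = lift b"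
  obtain u v where "set u \<subseteq> S" "a = cls u" "set v \<subseteq> S" "b = cls v"
    using ab(1,2) by (auto elim!: H_cases)
  then show "a = b" using ab(3) by (simp add: lift_cls walk_class_eq_iff cls_eq_iff)
qed

abbreviation "Cov \<equiv> local_covering Cay r \<one>"

lemma walk_from_cases:
  assumes "walk_from Cay \<one> W"
  obtains w where "set w \<subseteq> S" "W = path \<one> w"
  using assms path_word_of word_of_set that unfolding walk_from_def by metis

lemma verts_Cov: "verts Cov = lift ` carrier H"
proof (intro equalityI subsetI)
  fix x assume "x \<in> verts Cov"
  then obtain W where W: "x = walk_class Cay r \<one> W" "walk_from Cay \<one> W"
    by (auto simp: local_covering_def verts_def)
  then show "x \<in> lift ` carrier H" by (auto elim!: walk_from_cases simp: lift_cls[symmetric])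
next
  fix x assume "x \<in> lift ` carrier H"
  then show "x \<in> verts Cov" by (auto elim!: H_cases simp: lift_cls local_covering_def verts_def)
qed

text \<open>With \<open>lift_inj\<close> and \<open>verts_Cov\<close> this identifies the local
  covering with the Cayley graph of \<open>H\<close> for \<open>T\<close>: a walk extended by a
  vertex is a word extended by a letter.\<close>

lemma adj_Cov:
  assumes "a \<in> carrier H" "b \<in> carrier H"
  shows "adj Cov (lift a) (lift b) \<longleftrightarrow> (\<exists>t\<in>T. b = a \<otimes>\<^bsub>H\<^esub> t)"
proof
  assume "adj Cov (lift a) (lift b)"
  then have "{lift a, lift b} \<in> edges Cov" by (simp add: adj_def)
  then obtain W y where W: "{lift a, lift b} = {walk_class Cay r \<one> W, walk_class Cay r \<one> (W @ [y])}"
    "walk_from Cay \<one> W" "adj Cay (last W) y"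
    by (auto simp: local_covering_def edges_def)
  obtain w where w: "set w \<subseteq> S" "W = path \<one> w" using W(2) by (rule walk_from_cases)
  define s where "s = inv (word_val w) \<otimes> y"
  have s: "s \<in> S" "y = word_val w \<otimes> s"
    using W(3) w by (auto simp: s_def adj_Cay m_assoc[symmetric])
  have "W @ [y] = path \<one> (w @ [s])"
    using path_append[of \<one> w "[s]"] w s append_butlast_last_id[of "path \<one> w"] by simp
  then have "{lift a, lift b} = {lift (cls w), lift (cls (w @ [s]))}"
    using W(1) w s by (simp add: lift_cls)
  then have "{a, b} = {cls w, cls (w @ [s])}"
    using assms lift_inj w s inj_on_image_eq_iff[OF lift_inj, of "{a, b}" "{cls w, cls (w @ [s])}"] by simp
  then consider "a = cls w" "b = cls (w @ [s])" | "b = cls w" "a = cls (w @ [s])"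
    by (auto simp: doubleton_eq_iff)
  then show "\<exists>t\<in>T. b = a \<otimes>\<^bsub>H\<^esub> t"
  proof cases
    case 1
    then have "b = a \<otimes>\<^bsub>H\<^esub> cls [s]" using w s by simp
    then show ?thesis using s by (auto simp: T_def)
  next
    case 2
    then have "a = b \<otimes>\<^bsub>H\<^esub> cls [s]" using w s by simp
    then have "b = a \<otimes>\<^bsub>H\<^esub> cls [inv s]"
      using assms s S_inv H.inv_solve_right'[of b a "cls [s]"] H.inv_solve_right[of b a "cls [s]"] by simp
    then show ?thesis using s S_inv by (auto simp: T_def)
  qed
next
  assume "\<exists>t\<in>T. b = a \<otimes>\<^bsub>H\<^esub> t"
  then obtain s where s: "s \<in> S" "b = a \<otimes>\<^bsub>H\<^esub> cls [s]" by (auto simp: T_def)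
  obtain w where w: "set w \<subseteq> S" "a = cls w" using assms(1) by (rule H_cases)
  have b: "b = cls (w @ [s])" using s w by simp
  \<comment> \<open>Adjacency requires distinct vertices; the two classes differ because they
    project to different elements of \<open>G\<close>.\<close>
  have "word_val w \<noteq> word_val w \<otimes> s" using w s one_notin_S r_cancel_one'[of "word_val w" s] by auto
  then have "a \<noteq> b" using w s b word_eq_val[of w "w @ [s]"] by (auto simp: cls_eq_iff)
  then have ne: "lift a \<noteq> lift b" using assms lift_inj by (auto dest: inj_onD)
  have "path \<one> (w @ [s]) = path \<one> w @ [word_val w \<otimes> s]"
    using path_append[of \<one> w "[s]"] w s append_butlast_last_id[of "path \<one> w"] by simp
  then have "{lift a, lift b} = {walk_class Cay r \<one> (path \<one> w), walk_class Cay r \<one> (path \<one> w @ [word_val w \<otimes> s])}"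
    using w s b by (simp add: lift_cls)
  moreover have "walk_from Cay \<one> (path \<one> w)" "adj Cay (last (path \<one> w)) (word_val w \<otimes> s)" using w s by auto
  ultimately have "{lift a, lift b} \<in> edges Cov" unfolding local_covering_def edges_def by fastforce
  then show "adj Cov (lift a) (lift b)" using ne assms verts_Cov by (simp add: adj_def)
qed

end

section \<open>From two ends to the group structure\<close>

text \<open>Every arc leaving \<open>A\<close> ends in \<open>Y\<close>, and since \<open>S\<close>
  is finite only finitely many arcs end there. This turns vertex separators into cuts.\<close>

lemma (in cayley_group) cutI:
  assumes "A \<subseteq> carrier G" "infinite A" "infinite (carrier G - A)" "finite Y"
    and step: "\<And>x t. x \<in> A \<Longrightarrow> t \<in> S \<Longrightarrow> x \<otimes> t \<in> A \<union> Y"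
  shows "cut arcs (carrier G) A"
proof -
  have "bd A \<subseteq> (\<lambda>(y, t). (y \<otimes> inv t, y)) ` (Y \<times> S)"
  proof
    fix p assume "p \<in> bd A"
    then obtain x y where p: "p = (x, y)" "(x, y) \<in> arcs" "x \<in> A" "y \<notin> A" by (auto simp: boundary_def)
    then obtain t where t: "t \<in> S" "y = x \<otimes> t" "x \<in> carrier G" by (auto simp: arcs_def)
    then have "y \<in> Y" using step p by blast
    moreover have "x = y \<otimes> inv t" using t by (simp add: m_assoc)
    then have "p = (\<lambda>(y, t). (y \<otimes> inv t, y)) (y, t)" using p(1) by simp
    ultimately show "p \<in> (\<lambda>(y, t). (y \<otimes> inv t, y)) ` (Y \<times> S)"
      using t(1) by (intro image_eqI[of _ _ "(y, t)"]) simp_all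
  qed
  then have "finite (bd A)" using assms(4) gens_finite by (meson finite_SigmaI finite_imageI finite_subset)
  then show ?thesis using assms by (simp add: cut_def)
qed

text \<open>Internal form of (iii): \<open>t\<close> generates a factor of order one or two that
  meets the powers of \<open>s\<close> trivially. That \<open>s\<close> has order above
  \<open>r\<close> is expressed by its first \<open>r\<close> powers being nontrivial.\<close>

definition std_form :: "('a, 'b) monoid_scheme \<Rightarrow> 'a \<Rightarrow> 'a \<Rightarrow> nat \<Rightarrow> bool" where
  "std_form G s t r \<longleftrightarrow> s \<in> carrier G \<and> t \<in> carrier G \<and> s \<otimes>\<^bsub>G\<^esub> t = t \<otimes>\<^bsub>G\<^esub> s \<and> t \<otimes>\<^bsub>G\<^esub> t = \<one>\<^bsub>G\<^esub>
     \<and> (t = \<one>\<^bsub>G\<^esub> \<or> (\<forall>j::int. t \<noteq> s [^]\<^bsub>G\<^esub> j))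
     \<and> (\<forall>m::nat. 0 < m \<and> m \<le> r \<longrightarrow> s [^]\<^bsub>G\<^esub> m \<noteq> \<one>\<^bsub>G\<^esub>)
     \<and> (\<forall>x\<in>carrier G. \<exists>j::int. x = s [^]\<^bsub>G\<^esub> j \<or> x = t \<otimes>\<^bsub>G\<^esub> s [^]\<^bsub>G\<^esub> j)"

lemma (in group) std_form_of_involution:
  assumes "s \<in> carrier G" "t \<in> carrier G" "s \<otimes> t = t \<otimes> s" "t \<otimes> t = \<one>"
    "\<And>m::nat. 0 < m \<Longrightarrow> m \<le> r \<Longrightarrow> s [^] m \<noteq> \<one>"
    and all: "\<And>x. x \<in> carrier G \<Longrightarrow> \<exists>j::int. x = s [^] j \<or> x = t \<otimes> s [^] j"
  shows "\<exists>t. std_form G s t r"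
proof (cases "\<exists>j::int. t = s [^] j")
  case True
  then obtain i where i: "t = s [^] (i::int)" by blast
  have "\<exists>j::int. x = s [^] j \<or> x = \<one> \<otimes> s [^] j" if "x \<in> carrier G" for x
    using all[OF that] assms(1) i by (metis int_pow_mult)
  then have "std_form G s \<one> r" using assms by (simp add: std_form_def)
  then show ?thesis by blast
next
  case False
  then have "std_form G s t r" using assms by (simp add: std_form_def)
  then show ?thesis by blast
qed

lemma (in group) commute_int_pow:
  assumes "s \<in> carrier G" "t \<in> carrier G" "s \<otimes> t = t \<otimes> s"
  shows "s [^] (j::int) \<otimes> t = t \<otimes> s [^] j"
proof -
  have n: "s [^] (n::nat) \<otimes> t = t \<otimes> s [^] n" for n
  proof (induction n)
    case (Suc n)
    have "s [^] Suc n \<otimes> t = s [^] n \<otimes> t \<otimes> s" using assms by (simp add: m_assoc)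
    then show ?case using Suc assms by (simp add: m_assoc)
  qed (use assms in simp)
  show ?thesis
  proof (cases j)
    case (nonneg n)
    then show ?thesis using n by (simp add: int_pow_int)
  next
    case (neg n)
    obtain p where p: "p \<in> carrier G" "s [^] j = inv p" "p \<otimes> t = t \<otimes> p"
      using neg n[of "Suc n"] assms by (metis int_pow_neg_int nat_pow_closed)
    have "inv p \<otimes> t = inv p \<otimes> (t \<otimes> p) \<otimes> inv p" using p assms by (simp add: m_assoc)
    also have "\<dots> = inv p \<otimes> (p \<otimes> t) \<otimes> inv p" by (simp only: p(3))
    also have "\<dots> = t \<otimes> inv p" using p(1) assms(2) by (simp add: m_assoc[symmetric])
    finally show ?thesis using p by simp
  qed
qed

text \<open>Either \<open>t\<close> can be modified by a power of \<open>s\<close> to an involution, or \<open>s\<close> has a square root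
  that generates everything.\<close>

lemma (in group) std_form_exists:
  assumes s: "s \<in> carrier G" and t: "t \<in> carrier G" and comm: "s \<otimes> t = t \<otimes> s"
    and ord: "\<And>m::nat. 0 < m \<Longrightarrow> m \<le> r \<Longrightarrow> s [^] m \<noteq> \<one>"
    and all: "\<And>x. x \<in> carrier G \<Longrightarrow> \<exists>j::int. x = s [^] j \<or> x = t \<otimes> s [^] j"
  shows "\<exists>s t. std_form G s t r"
proof (cases "\<exists>k::int. t = s [^] k")
  case True
  then obtain i where i: "t = s [^] (i::int)" by blast
  have "\<exists>j::int. x = s [^] j \<or> x = \<one> \<otimes> s [^] j" if "x \<in> carrier G" for x
    using all[OF that] s i by (metis int_pow_mult)
  then show ?thesis using std_form_of_involution[of s \<one> r] s ord by auto
next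
  case False
  obtain k where k: "t \<otimes> t = s [^] (k::int) \<or> t \<otimes> t = t \<otimes> s [^] k" using all[of "t \<otimes> t"] t by auto
  have "t \<otimes> t \<noteq> t \<otimes> s [^] k" using False s t by simp
  then have tt: "t \<otimes> t = s [^] k" using k by simp
  have c: "s [^] (j::int) \<otimes> t = t \<otimes> s [^] j" for j using commute_int_pow s t comm .
  \<comment> \<open>Since \<open>t \<otimes> t = s [^] k\<close>, dividing \<open>t\<close> by half
    the exponent leaves a square of \<open>s [^] (k mod 2)\<close>, that is, \<one> or
    \<open>s\<close>.\<close>
  define u where "u = t \<otimes> s [^] (- (k div 2))"
  have u: "u \<in> carrier G" using s t by (simp add: u_def)
  have uu: "u \<otimes> u = s [^] (k mod 2)"
  proof -
    have "u \<otimes> u = t \<otimes> (s [^] (- (k div 2)) \<otimes> t) \<otimes> s [^] (- (k div 2))"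
      using s t by (simp add: u_def m_assoc)
    also have "\<dots> = t \<otimes> (t \<otimes> s [^] (- (k div 2))) \<otimes> s [^] (- (k div 2))" by (simp only: c)
    also have "\<dots> = (t \<otimes> t) \<otimes> (s [^] (- (k div 2)) \<otimes> s [^] (- (k div 2)))"
      using s t by (simp add: m_assoc)
    also have "\<dots> = s [^] (k + (- (k div 2) + - (k div 2)))" using s by (simp only: tt int_pow_mult)
    also have "k + (- (k div 2) + - (k div 2)) = k mod 2" by (simp add: minus_mult_div_eq_mod [symmetric])
    finally show ?thesis .
  qed
  have tu: "t = u \<otimes> s [^] (k div 2)" using s t by (simp add: u_def m_assoc int_pow_mult[symmetric])
  have cu: "s \<otimes> u = u \<otimes> s"
  proof -
    have "s \<otimes> u = t \<otimes> (s [^] (1::int) \<otimes> s [^] (- (k div 2)))"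
      using s t comm by (simp add: u_def m_assoc[symmetric])
    also have "\<dots> = t \<otimes> (s [^] (- (k div 2)) \<otimes> s [^] (1::int))"
      using s by (simp only: int_pow_mult[symmetric] add.commute)
    finally show ?thesis using s t by (simp add: u_def m_assoc)
  qed
  have all': "\<exists>j::int. x = s [^] j \<or> x = u \<otimes> s [^] j" if xG: "x \<in> carrier G" for x
  proof -
    obtain j where "x = s [^] (j::int) \<or> x = t \<otimes> s [^] j" using all[OF xG] by (elim exE)
    moreover have "t \<otimes> s [^] j = u \<otimes> s [^] (k div 2 + j)"
      using tu s u by (simp add: m_assoc int_pow_mult)
    ultimately show ?thesis by metis
  qed
  show ?thesis
  proof (cases "even k")
    case True
    then have "u \<otimes> u = \<one>" using uu by (simp add: even_iff_mod_2_eq_zero)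
    then show ?thesis using std_form_of_involution[OF s u cu _ ord all'] by blast
  next
    case odd: False
    \<comment> \<open>Now all elements are powers of \<open>u\<close>. Squaring
      \<open>u [^] m = \<one>\<close> would give \<open>s [^] m = \<one>\<close>, so the bound on
      the order passes from \<open>s\<close> to \<open>u\<close>.\<close>
    then have us: "u \<otimes> u = s" using uu s by (simp add: odd_iff_mod_2_eq_one)
    have sj: "s [^] (j::int) = u [^] (2 * j)" for j
    proof -
      have "s = u [^] (2::int)" using us u int_pow_mult[of u 1 1] by simp
      then show ?thesis using u by (simp add: int_pow_pow)
    qed
    have "\<exists>j::int. x = u [^] j \<or> x = \<one> \<otimes> u [^] j" if x: "x \<in> carrier G" for x
    proof -
      obtain j where "x = s [^] (j::int) \<or> x = u \<otimes> s [^] j" using all'[OF x] by (elim exE)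
      moreover have "u \<otimes> s [^] j = u [^] (1 + 2 * j)" using u sj int_pow_mult[of u 1 "2 * j"] by simp
      ultimately show ?thesis using sj by metis
    qed
    moreover have "u [^] m \<noteq> \<one>" if m: "0 < m" "m \<le> r" for m :: nat
    proof
      assume "u [^] m = \<one>"
      then have "u [^] m \<otimes> u [^] m = \<one>" by simp
      moreover have "s [^] m = u [^] m \<otimes> u [^] m"
        using us u pow_mult_distrib[of u u m] by simp
      ultimately show False using ord m by simp
    qed
    ultimately show ?thesis using std_form_of_involution[of u \<one> r] u by auto
  qed
qed

context short_relators
begin

lemma cut_imp_std_form:
  assumes nil: "nilpotent_class_le G (Suc k)" and r: "r \<ge> 4 ^ (k + 2)"
    and A: "cut cover.arcs (carrier H) A"
    and Y: "\<And>x t. x \<in> A \<Longrightarrow> t \<in> T \<Longrightarrow> x \<otimes>\<^bsub>H\<^esub> t \<in> A \<union> Y" "A \<inter> Y = {}" "finite Y" "card Y \<le> 2"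
  shows "\<exists>s t. std_form G s t r"
proof -
  have "\<exists>s\<in>T. (\<forall>m>0. s [^]\<^bsub>H\<^esub> (m::nat) \<noteq> \<one>\<^bsub>H\<^esub>) \<and> (\<exists>t\<in>carrier H. s \<otimes>\<^bsub>H\<^esub> t = t \<otimes>\<^bsub>H\<^esub> s
      \<and> (\<forall>x\<in>carrier H. \<exists>j::int. x = s [^]\<^bsub>H\<^esub> j \<or> x = t \<otimes>\<^bsub>H\<^esub> s [^]\<^bsub>H\<^esub> j))"
    by (rule cover.two_ended_structure[OF A _ Y(2-4), where k = k]) (use Y(1) engel_H[OF nil r] in simp_all)
  then obtain s' t' where s': "s' \<in> T" and ord: "\<And>m::nat. m > 0 \<Longrightarrow> s' [^]\<^bsub>H\<^esub> m \<noteq> \<one>\<^bsub>H\<^esub>"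
    and t': "t' \<in> carrier H" "s' \<otimes>\<^bsub>H\<^esub> t' = t' \<otimes>\<^bsub>H\<^esub> s'"
    and all: "\<And>x. x \<in> carrier H \<Longrightarrow> \<exists>j::int. x = s' [^]\<^bsub>H\<^esub> j \<or> x = t' \<otimes>\<^bsub>H\<^esub> s' [^]\<^bsub>H\<^esub> j"
    by (elim bexE conjE) simp
  interpret proj: group_hom H G proj
    using proj_hom by unfold_locales
  obtain s where s: "s \<in> S" "s' = cls [s]" using s' by (auto simp: T_def)
  have ps: "proj s' = s" using s by simp
  have s'G: "s' \<in> carrier H" using s by simp
  define t where "t = proj t'"
  have tG: "t \<in> carrier G" using t' by (simp add: t_def)
  have comm: "s \<otimes> t = t \<otimes> s" using arg_cong[OF t'(2), of proj] s'G t'(1) ps by (simp add: t_def)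
  have "s [^] m \<noteq> \<one>" if m: "0 < m" "m \<le> r" for m :: nat
  proof
    assume e: "s [^] m = \<one>"
    have rep: "cls (replicate n s) = s' [^]\<^bsub>H\<^esub> n" "word_val (replicate n s) = s [^] n" "set (replicate n s) \<subseteq> S" for n :: nat
    proof -
      show sub: "set (replicate n s) \<subseteq> S" for n using s by auto
      show "cls (replicate n s) = s' [^]\<^bsub>H\<^esub> n"
      proof (induction n)
        case (Suc n)
        have "cls (replicate (Suc n) s) = cls (replicate n s) \<otimes>\<^bsub>H\<^esub> cls [s]"
          using mult_H[OF sub[of n], of "[s]"] s by (simp add: replicate_append_same)
        then show ?case using Suc s by simp
      qed (simp add: one_H)
      show "word_val (replicate n s) = s [^] n"
      proof (induction n)
        case (Suc n)
        then show ?case using nat_pow_Suc2[of s n] s by simp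
      qed simp
    qed
    have "word_eq (replicate m s) []" using rep[of m] e m by (intro word_eq_relator) auto
    then have "s' [^]\<^bsub>H\<^esub> m = \<one>\<^bsub>H\<^esub>" using rep[of m] by (simp add: one_H cls_eq_iff flip: rep(1))
    then show False using ord m by simp
  qed
  moreover have "\<exists>j::int. x = s [^] j \<or> x = t \<otimes> s [^] j" if x: "x \<in> carrier G" for x
  proof -
    obtain w where w: "set w \<subseteq> S" "word_val w = x" using proj_surj[OF x] by blast
    then obtain j where "cls w = s' [^]\<^bsub>H\<^esub> (j::int) \<or> cls w = t' \<otimes>\<^bsub>H\<^esub> s' [^]\<^bsub>H\<^esub> j"
      using all[of "cls w"] by auto
    then have "proj (cls w) = proj (s' [^]\<^bsub>H\<^esub> j) \<or> proj (cls w) = proj (t' \<otimes>\<^bsub>H\<^esub> s' [^]\<^bsub>H\<^esub> j)"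
      by metis
    then have "x = s [^] j \<or> x = t \<otimes> s [^] j"
      using w s'G t' ps by (simp add: t_def proj.hom_int_pow)
    then show ?thesis by blast
  qed
  ultimately show ?thesis using std_form_exists[OF S_closed[OF s(1)] tG comm, of r] by simp
qed

text \<open>\<open>A\<close> consists of what the tail of the first ray reaches without
  \<open>Ys\<close>, so a step leaving it enters \<open>Ys\<close>. It contains this tail and misses
  the tail of the second ray, whence both sides are infinite.\<close>

lemma two_ends_imp_cut:
  assumes "two_ends_separated_le2 Cov"
  shows "\<exists>A Y. cut cover.arcs (carrier H) A \<and> (\<forall>x\<in>A. \<forall>t\<in>T. x \<otimes>\<^bsub>H\<^esub> t \<in> A \<union> Y) \<and> A \<inter> Y = {}
    \<and> finite Y \<and> card Y \<le> 2"
proof -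
  obtain f g Ys N where fg: "ray Cov f" "ray Cov g" and Ys: "Ys \<subseteq> verts Cov" "finite Ys" "card Ys \<le> 2"
    and N: "\<And>k l. k \<ge> N \<Longrightarrow> l \<ge> N \<Longrightarrow> f k \<notin> Ys \<and> g l \<notin> Ys \<and> \<not> reachable (delete_verts Cov Ys) (f k) (g l)"
    using assms unfolding two_ends_separated_le2_def by blast
  let ?D = "delete_verts Cov Ys"
  have vertsD: "verts ?D = verts Cov - Ys" by (simp add: delete_verts_def verts_def)
  have adjD: "adj ?D x y \<longleftrightarrow> adj Cov x y \<and> x \<notin> Ys \<and> y \<notin> Ys" for x y
    by (auto simp: adj_def delete_verts_def verts_def edges_def)
  have verts: "f k \<in> verts Cov" "g k \<in> verts Cov" for k
    using fg by (auto simp: ray_def adj_def)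
  define A where "A = {x \<in> carrier H. \<exists>k\<ge>N. reachable ?D (f k) (lift x)}"
  define Y where "Y = {x \<in> carrier H. lift x \<in> Ys}"
  have "A \<subseteq> carrier H" by (auto simp: A_def)
  have step: "x \<otimes>\<^bsub>H\<^esub> t \<in> A \<union> Y" if x: "x \<in> A" "t \<in> T" for x t
  proof -
    have xt: "x \<in> carrier H" "x \<otimes>\<^bsub>H\<^esub> t \<in> carrier H" using x by (auto simp: A_def)
    obtain k where k: "k \<ge> N" "reachable ?D (f k) (lift x)" using x by (auto simp: A_def)
    have a: "adj Cov (lift x) (lift (x \<otimes>\<^bsub>H\<^esub> t))" using adj_Cov[OF xt] x by blast
    have "lift x \<notin> Ys" using reachable_verts[OF k(2)] vertsD by blast
    then have "lift (x \<otimes>\<^bsub>H\<^esub> t) \<notin> Ys \<Longrightarrow> reachable ?D (f k) (lift (x \<otimes>\<^bsub>H\<^esub> t))"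
      using reachable_step[OF k(2)] a adjD by blast
    then show ?thesis using k xt by (auto simp: A_def Y_def)
  qed
  have AY: "A \<inter> Y = {}"
    using reachable_verts vertsD by (fastforce simp: A_def Y_def)
  have Yfin: "finite Y" "card Y \<le> 2"
  proof -
    have inj: "inj_on lift Y" using lift_inj by (rule inj_on_subset) (auto simp: Y_def)
    have sub: "lift ` Y \<subseteq> Ys" by (auto simp: Y_def)
    show "finite Y" using inj sub Ys finite_imageD finite_subset by metis
    show "card Y \<le> 2" using card_image[OF inj] card_mono[OF Ys(2) sub] Ys(3) by simp
  qed
  have infinite_tail: "infinite B" if "inj h" "\<And>k. k \<ge> N \<Longrightarrow> h k \<in> lift ` B" for h :: "nat \<Rightarrow> 'a list set" and B
  proof
    assume "finite B"
    moreover have "h ` {N..} \<subseteq> lift ` B" using that(2) by auto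
    ultimately have "finite (h ` {N..})" by (meson finite_imageI finite_subset)
    then have "finite {N..}" using inj_on_subset[OF that(1) subset_UNIV] by (rule finite_imageD)
    then show False using infinite_Ici[of N] by simp
  qed
  have "infinite A"
  proof (rule infinite_tail[of f])
    show "inj f" using fg by (simp add: ray_def)
    fix k assume k: "k \<ge> N"
    then have "f k \<in> verts ?D" using N verts vertsD by blast
    then have "reachable ?D (f k) (f k)" by (rule reachable_refl)
    moreover obtain x where "x \<in> carrier H" "f k = lift x" using verts(1)[of k] verts_Cov by auto
    moreover from this have "x \<in> A"
      using k \<open>reachable ?D (f k) (f k)\<close> unfolding A_def by auto
    ultimately show "f k \<in> lift ` A" by simp
  qed
  moreover have "infinite (carrier H - A)"
  proof (rule infinite_tail[of g])
    show "inj g" using fg by (simp add: ray_def)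
    fix l assume l: "l \<ge> N"
    obtain x where x: "x \<in> carrier H" "g l = lift x" using verts(2)[of l] verts_Cov by auto
    then have "x \<notin> A" using N[OF _ l] unfolding A_def by auto
    then show "g l \<in> lift ` (carrier H - A)" using x by blast
  qed
  ultimately have "cut cover.arcs (carrier H) A"
    using cover.cutI[OF \<open>A \<subseteq> carrier H\<close> _ _ Yfin(1) step] by blast
  then show ?thesis using step AY Yfin by blast
qed

end

lemma (in group) std_form_iso:
  assumes fin: "finite (carrier G)" and sf: "std_form G s t r" and r: "r \<ge> 1"
  shows "\<exists>i j. i > r \<and> j \<in> {1, 2} \<and> G \<cong> DirProd (integer_mod_group i) (integer_mod_group j)"
proof -
  have s: "s \<in> carrier G" and t: "t \<in> carrier G" and comm: "s \<otimes> t = t \<otimes> s" and tt: "t \<otimes> t = \<one>"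
    and tri: "t = \<one> \<or> (\<forall>j::int. t \<noteq> s [^] j)" and ords: "\<And>m::nat. 0 < m \<Longrightarrow> m \<le> r \<Longrightarrow> s [^] m \<noteq> \<one>"
    and all: "\<And>x. x \<in> carrier G \<Longrightarrow> \<exists>j::int. x = s [^] j \<or> x = t \<otimes> s [^] j"
    using sf by (auto simp: std_form_def)
  have c: "s [^] (j::int) \<otimes> t = t \<otimes> s [^] j" for j using commute_int_pow[OF s t comm] .
  define i where "i = ord s"
  define j where "j = (if t = \<one> then 1 else 2 :: nat)"
  have i: "i > 0" "s [^] i = \<one>" using ord_ge_1[OF fin s] pow_ord_eq_1[OF s] by (simp_all add: i_def)
  then have ir: "i > r" using ords[of i] by (meson not_le)
  have seq: "s [^] a = s [^] b \<longleftrightarrow> a mod int i = b mod int i" for a b :: int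
    using int_pow_eq[OF s, of a b] by (simp add: i_def mod_eq_dvd_iff dvd_diff_commute)
  \<comment> \<open>The second coordinate is the exponent of \<open>t\<close>; on the carrier it
    takes at most the values 0 and 1.\<close>
  define h where "h p = (if snd p = 0 then s [^] (fst p) else t \<otimes> s [^] (fst p))" for p :: "int \<times> int"
  let ?D = "DirProd (integer_mod_group i) (integer_mod_group j)"
  have carD: "carrier ?D = {0..<int i} \<times> {0..<int j}"
    using i by (simp add: carrier_integer_mod_group j_def)
  have j01: "b = 0 \<or> (b = 1 \<and> t \<noteq> \<one> \<and> j = 2)" if "b \<in> {0..<int j}" for b
    using that by (auto simp: j_def split: if_splits)
  have mult: "s [^] ((a + b) mod int i) = s [^] a \<otimes> s [^] b" for a b :: int
    using seq[of "(a + b) mod int i" "a + b"] s by (simp add: int_pow_mult)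
  have "h \<in> iso ?D G"
  proof (rule isoI)
    show "h \<in> hom ?D G"
    proof (rule homI)
      fix p assume "p \<in> carrier ?D"
      show "h p \<in> carrier G" using s t by (simp add: h_def)
    next
      fix p q assume pq: "p \<in> carrier ?D" "q \<in> carrier ?D"
      obtain a b a' b' where e: "p = (a, b)" "q = (a', b')" by fastforce
      have b: "b = 0 \<or> (b = 1 \<and> t \<noteq> \<one> \<and> j = 2)" "b' = 0 \<or> (b' = 1 \<and> t \<noteq> \<one> \<and> j = 2)"
        using pq j01 unfolding carD e by auto
      have m: "p \<otimes>\<^bsub>?D\<^esub> q = ((a + a') mod int i, (b + b') mod int j)" using e by simp
      have "t \<otimes> s [^] a \<otimes> (t \<otimes> s [^] a') = s [^] a \<otimes> s [^] a'"
      proof -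
        have "t \<otimes> s [^] a \<otimes> (t \<otimes> s [^] a') = t \<otimes> (s [^] a \<otimes> t) \<otimes> s [^] a'" using s t by (simp add: m_assoc)
        also have "\<dots> = (t \<otimes> t) \<otimes> s [^] a \<otimes> s [^] a'" using s t by (simp only: c) (simp add: m_assoc)
        finally show ?thesis using s tt by simp
      qed
      moreover have "s [^] a \<otimes> (t \<otimes> s [^] a') = t \<otimes> (s [^] a \<otimes> s [^] a')"
        using c[of a] s t by (simp add: m_assoc[symmetric])
      ultimately show "h (p \<otimes>\<^bsub>?D\<^esub> q) = h p \<otimes> h q"
        unfolding m using b s t by (auto simp: h_def e mult m_assoc)
    qed
    show "bij_betw h (carrier ?D) (carrier G)"
    proof (rule bij_betw_imageI)
      show "inj_on h (carrier ?D)"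
      proof (rule inj_onI)
        fix p q assume pq: "p \<in> carrier ?D" "q \<in> carrier ?D" "h p = h q"
        obtain a b a' b' where e: "p = (a, b)" "q = (a', b')" by fastforce
        have b: "b = 0 \<or> (b = 1 \<and> t \<noteq> \<one> \<and> j = 2)" "b' = 0 \<or> (b' = 1 \<and> t \<noteq> \<one> \<and> j = 2)"
          and a: "a mod int i = a" "a' mod int i = a'"
          using pq j01 unfolding carD e by auto
        have no: False if "t \<noteq> \<one>" "t \<otimes> s [^] x = s [^] y" for x y :: int
        proof -
          have "t = s [^] y \<otimes> inv (s [^] x)" using that(2) s t inv_solve_right[of t "s [^] y" "s [^] x"] by simp
          then have "t = s [^] (y - x)" using s by (simp add: int_pow_diff)
          then show False using tri that(1) by blast
        qed
        have "b = b'"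
        proof (rule ccontr)
          assume "b \<noteq> b'"
          then have tn: "t \<noteq> \<one>" and "t \<otimes> s [^] a = s [^] a' \<or> t \<otimes> s [^] a' = s [^] a"
            using b pq(3) unfolding e h_def by auto
          then show False using no[OF tn, of a a'] no[OF tn, of a' a] by (elim disjE)
        qed
        moreover have "s [^] a = s [^] a'" using pq(3) \<open>b = b'\<close> s t unfolding e h_def by (auto split: if_splits)
        then have "a = a'" using seq a by simp
        ultimately show "p = q" using e by simp
      qed
      show "h ` carrier ?D = carrier G"
      proof (intro equalityI subsetI)
        fix x assume "x \<in> carrier G"
        then obtain a where a: "x = s [^] (a::int) \<or> x = t \<otimes> s [^] a" using all by blast
        have am: "s [^] (a mod int i) = s [^] a" using seq by simp
        have rng: "a mod int i \<in> {0..<int i}" using i by simp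
        show "x \<in> h ` carrier ?D"
        proof (cases "x = s [^] a")
          case True
          then have "x = h (a mod int i, 0)" by (simp add: h_def am)
          moreover have "(a mod int i, 0) \<in> carrier ?D" using rng unfolding carD by (simp add: j_def)
          ultimately show ?thesis by (rule image_eqI)
        next
          case False
          then have x: "x = t \<otimes> s [^] a" "t \<noteq> \<one>" using a s by auto
          then have "x = h (a mod int i, 1)" by (simp add: h_def am)
          moreover have "(a mod int i, 1) \<in> carrier ?D" using rng x(2) unfolding carD by (simp add: j_def)
          ultimately show ?thesis by (rule image_eqI)
        qed
      qed (use s t in \<open>auto simp: h_def\<close>)
    qed
  qed
  then have "?D \<cong> G" by (auto simp: is_iso_def)
  moreover have "group ?D" by (simp add: DirProd_group)
  ultimately have "G \<cong> ?D" using group.iso_sym by blast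
  then show ?thesis using ir by (intro exI[of _ i] exI[of _ j]) (auto simp: j_def)
qed

lemma (in group) iso_std_form:
  assumes "G \<cong> DirProd (integer_mod_group i) (integer_mod_group j)" and i: "i > r" "r \<ge> 1" and j: "j \<in> {1, 2}"
  shows "\<exists>s t. std_form G s t r"
proof -
  let ?D = "DirProd (integer_mod_group i) (integer_mod_group j)"
  have gD: "group ?D" by (simp add: DirProd_group)
  have "?D \<cong> G" using iso_sym assms(1) by blast
  then obtain h where h: "h \<in> iso ?D G" by (auto simp: is_iso_def)
  then have hom: "h \<in> hom ?D G" and bij: "bij_betw h (carrier ?D) (carrier G)" by (auto simp: iso_def)
  interpret h: group_hom ?D G h using hom gD group_axioms by (simp add: group_hom_def group_hom_axioms_def)
  have carD: "carrier ?D = {0..<int i} \<times> {0..<int j}"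
    using i j by (auto simp: carrier_integer_mod_group)
  define s where "s = h (1, 0)"
  \<comment> \<open>For \<open>j = 1\<close> the residue \<open>1 mod int j\<close> is 0, so
    \<open>t\<close> becomes trivial as \<open>std_form\<close> wants it.\<close>
  define t where "t = h (0, 1 mod int j)"
  have st: "(1, 0) \<in> carrier ?D" "(0, 1 mod int j) \<in> carrier ?D" using i j unfolding carD by auto
  have s: "s \<in> carrier G" and t: "t \<in> carrier G" using st by (simp_all add: s_def t_def)
  have oneD: "\<one>\<^bsub>?D\<^esub> = (0, 0)" by simp
  have npow: "(1, 0) [^]\<^bsub>?D\<^esub> (m::nat) = (int m mod int i, 0)" for m
    using i by (induction m) (auto simp: mod_simps mod_add_right_eq ac_simps)
  have ipow: "\<exists>m::nat. x [^] (a::int) = x [^] m" if "x \<in> carrier G" "x [^] i = \<one>" for x a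
  proof
    have "x [^] a = x [^] (int i * (a div int i) + a mod int i)" by simp
    also have "\<dots> = x [^] (int i * (a div int i)) \<otimes> x [^] (a mod int i)" using that by (simp only: int_pow_mult)
    also have "x [^] (int i * (a div int i)) = \<one>" using that by (simp add: int_pow_pow[symmetric] int_pow_int)
    finally show "x [^] a = x [^] nat (a mod int i)"
      using that i int_pow_int[of G x "nat (a mod int i)"] by simp
  qed
  have spow: "s [^] (m::nat) = h (int m mod int i, 0)" for m
    using h.hom_nat_pow[OF st(1), of m] npow[of m] by (simp add: s_def)
  have si: "s [^] i = \<one>" using spow[of i] h.hom_one by simp
  have inj: "p = q" if "h p = h q" "p \<in> carrier ?D" "q \<in> carrier ?D" for p q
    using that bij by (auto simp: bij_betw_def dest: inj_onD)
  have car0: "(int m mod int i, 0) \<in> carrier ?D" for m using i j unfolding carD by auto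
  have "s \<otimes> t = t \<otimes> s" using h.hom_mult[OF st] h.hom_mult[OF st(2,1)] by (simp add: s_def t_def)
  moreover have "t \<otimes> t = \<one>" using h.hom_mult[OF st(2,2)] h.hom_one j by (auto simp: t_def)
  moreover have "t = \<one> \<or> (\<forall>a::int. t \<noteq> s [^] a)"
  proof (cases "j = 1")
    case True
    then show ?thesis using h.hom_one by (simp add: t_def)
  next
    case False
    have "t \<noteq> s [^] a" for a :: int
    proof
      assume "t = s [^] a"
      then obtain m where "t = s [^] (m::nat)" using ipow[OF s si] by metis
      then have "(0, 1 mod int j) = (int m mod int i, 0::int)"
        using inj[OF _ st(2) car0, of m] by (simp add: t_def spow)
      then show False using False j by auto
    qed
    then show ?thesis by blast
  qed
  moreover have "s [^] m \<noteq> \<one>" if "0 < m" "m \<le> r" for m :: nat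
  proof
    assume "s [^] m = \<one>"
    then have "(int m mod int i, 0) = (0::int, 0::int)"
      using inj[OF _ car0, of m "(0, 0)"] car0[of 0] h.hom_one by (simp add: spow)
    then show False using that i by simp
  qed
  moreover have "\<exists>a::int. x = s [^] a \<or> x = t \<otimes> s [^] a" if x: "x \<in> carrier G" for x
  proof -
    have "x \<in> h ` carrier ?D" using x bij by (simp add: bij_betw_def)
    then obtain a b where ab: "x = h (a, b)" "a \<in> {0..<int i}" "b \<in> {0..<int j}"
      unfolding carD by auto
    have sa: "s [^] a = h (a, 0)"
      using ab(2) spow[of "nat a"] int_pow_int[of G s "nat a"] by simp
    show ?thesis
    proof (cases "b = 0")
      case True
      then show ?thesis using ab sa by (intro exI[of _ a]) simp
    next
      case False
      then have b: "j = 2" "b = 1" using ab j by auto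
      have "(a, 0) \<in> carrier ?D" using ab j unfolding carD by auto
      then have "t \<otimes> s [^] a = h (a mod int i, 1)"
        using h.hom_mult[OF st(2), of "(a, 0)"] b sa by (simp add: t_def)
      then show ?thesis using ab b by (intro exI[of _ a]) simp
    qed
  qed
  ultimately have "std_form G s t r" using s t by (simp add: std_form_def)
  then show ?thesis by blast
qed

section \<open>Cyclic groups and prisms\<close>

lemma (in group) std_form_gen_set:
  assumes sf: "std_form G s t r" and r: "r \<ge> 1"
  shows "cayley_gen_set G ({s, inv s} \<union> ({t} - {\<one>}))"
proof -
  have s: "s \<in> carrier G" and t: "t \<in> carrier G" and tt: "t \<otimes> t = \<one>"
    and all: "\<And>x. x \<in> carrier G \<Longrightarrow> \<exists>j::int. x = s [^] j \<or> x = t \<otimes> s [^] j"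
    using sf by (auto simp: std_form_def)
  have s1: "s \<noteq> \<one>"
  proof -
    have "s [^] (1::nat) \<noteq> \<one>" using sf r unfolding std_form_def by blast
    then show ?thesis using s by simp
  qed
  let ?S = "{s, inv s} \<union> ({t} - {\<one>})"
  have sub: "?S \<subseteq> carrier G" using s t by auto
  have invt: "inv t = t" using tt t inv_equality by blast
  have gt: "t \<in> generate G ?S"
    by (cases "t = \<one>") (auto intro: generate.one generate.incl)
  have gs: "s [^] (j::int) \<in> generate G ?S" for j
    using generate_is_subgroup[OF sub] subgroup_int_pow_closed generate.incl[of s ?S G] by simp
  have "x \<in> generate G ?S" if "x \<in> carrier G" for x
    using all[OF that] gs gt generate.eng by metis
  then have "generate G ?S = carrier G" using generate_incl[OF sub] by blast
  moreover have "\<one> \<noteq> inv s" using s1 s by (metis inv_inv inv_one)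
  ultimately show ?thesis using sub s t s1 invt unfolding cayley_gen_set_def by auto
qed

text \<open>The Cayley graph is a cycle, or a prism over one if \<open>t\<close> is nontrivial. With
  \<open>r \<ge> 4\<close> the squares of the prism are short relators, so \<open>s\<close> and
  \<open>t\<close> still commute in the cover.\<close>

locale std_presentation = short_relators G S r for G (structure) and S r +
  fixes s t
  assumes sf: "std_form G s t r" and S_eq: "S = {s, inv s} \<union> ({t} - {\<one>})" and r4: "r \<ge> 4"
begin

lemma s_closed [simp]: "s \<in> carrier G" and t_closed [simp]: "t \<in> carrier G"
  and st_comm: "s \<otimes> t = t \<otimes> s" and tt: "t \<otimes> t = \<one>" and s_in: "s \<in> S" "inv s \<in> S"
  and all: "x \<in> carrier G \<Longrightarrow> \<exists>j::int. x = s [^] j \<or> x = t \<otimes> s [^] j"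
  using sf by (auto simp: std_form_def S_eq)

lemma t_in: "t \<noteq> \<one> \<Longrightarrow> t \<in> S"
  by (simp add: S_eq)

lemma S_cases:
  assumes "x \<in> S"
  obtains "x = s" | "x = inv s" | "x = t" "t \<noteq> \<one>"
  using assms by (auto simp: S_eq)

lemma pow_trivial:
  assumes "s [^] (j::int) = \<one>" "\<bar>j\<bar> \<le> int r"
  shows "j = 0"
proof (rule ccontr)
  assume "j \<noteq> 0"
  then have "0 < nat \<bar>j\<bar>" "nat \<bar>j\<bar> \<le> r" using assms(2) by auto
  then have "s [^] nat \<bar>j\<bar> \<noteq> \<one>" using sf unfolding std_form_def by blast
  moreover have "s [^] \<bar>j\<bar> = \<one>" using assms(1) by (cases "j \<ge> 0") (auto simp: int_pow_neg)
  then have "s [^] nat \<bar>j\<bar> = \<one>" using int_pow_int[of G s "nat \<bar>j\<bar>"] by simp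
  ultimately show False by blast
qed

text \<open>Position along the cycle. In a finite group it is determined only modulo the order of
  \<open>s\<close>, hence a relation; \<open>lies_at_unique\<close> makes it single-valued within a
  window of width \<open>r\<close>.\<close>

definition lies_at :: "'a \<Rightarrow> int \<Rightarrow> bool" where
  "lies_at x h \<longleftrightarrow> x = s [^] h \<or> x = t \<otimes> s [^] h"

lemma comm_pow: "s [^] (j::int) \<otimes> t = t \<otimes> s [^] j"
  using commute_int_pow st_comm by simp

lemma lies_at_closed: "lies_at x h \<Longrightarrow> x \<in> carrier G"
  by (auto simp: lies_at_def)

lemma lies_at_mult:
  assumes "lies_at x h" "lies_at y h'"
  shows "lies_at (x \<otimes> y) (h + h')"
proof -
  have 1: "s [^] h \<otimes> s [^] h' = s [^] (h + h')" by (simp add: int_pow_mult)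
  have 2: "s [^] h \<otimes> (t \<otimes> s [^] h') = t \<otimes> s [^] (h + h')"
  proof -
    have "s [^] h \<otimes> (t \<otimes> s [^] h') = (s [^] h \<otimes> t) \<otimes> s [^] h'" by (simp add: m_assoc)
    also have "\<dots> = t \<otimes> (s [^] h \<otimes> s [^] h')" unfolding comm_pow by (simp add: m_assoc)
    finally show ?thesis by (simp only: 1)
  qed
  have 3: "(t \<otimes> s [^] h) \<otimes> s [^] h' = t \<otimes> s [^] (h + h')" by (simp add: m_assoc 1)
  have 4: "(t \<otimes> s [^] h) \<otimes> (t \<otimes> s [^] h') = s [^] (h + h')"
  proof -
    have "(t \<otimes> s [^] h) \<otimes> (t \<otimes> s [^] h') = t \<otimes> (t \<otimes> s [^] (h + h'))" by (simp add: m_assoc 2)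
    then show ?thesis using tt by (simp add: m_assoc[symmetric])
  qed
  show ?thesis using assms 1 2 3 4 unfolding lies_at_def by metis
qed

lemma lies_at_inv:
  assumes "lies_at x h"
  shows "lies_at (inv x) (- h)"
proof -
  have "inv t = t" using tt inv_equality by simp
  then have "inv (t \<otimes> s [^] h) = t \<otimes> s [^] (- h)"
    using comm_pow[of "- h"] by (simp add: inv_mult_group int_pow_neg)
  then show ?thesis using assms by (auto simp: lies_at_def int_pow_neg)
qed

lemma lies_at_zero_iff: "lies_at x 0 \<longleftrightarrow> x \<in> {\<one>, t}"
  by (auto simp: lies_at_def)

text \<open>Dividing \<open>x\<close> by itself puts \<one> at height \<open>h - h'\<close>. So
  \<open>s [^] (h - h')\<close> is trivial, possibly after multiplying by \<open>t\<close>; in that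
  case \<open>t\<close> is a power of \<open>s\<close> and thus \<one>. Then
  \<open>pow_trivial\<close> applies.\<close>

lemma lies_at_unique:
  assumes "lies_at x h" "lies_at x h'" "\<bar>h - h'\<bar> \<le> int r"
  shows "h = h'"
proof -
  have "lies_at (x \<otimes> inv x) (h + - h')" using lies_at_mult lies_at_inv assms by blast
  then have "lies_at \<one> (h - h')" using lies_at_closed[OF assms(1)] by simp
  then consider "s [^] (h - h') = \<one>" | "t \<otimes> s [^] (h - h') = \<one>" unfolding lies_at_def by metis
  then show ?thesis
  proof cases
    case 1
    then show ?thesis using pow_trivial assms(3) by fastforce
  next
    case 2
    then have "t = inv (s [^] (h - h'))" using inv_equality by simp
    then have "t = s [^] (- (h - h'))" by (simp only: int_pow_neg s_closed)
    then have "t = \<one>" using sf unfolding std_form_def by metis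
    then have "s [^] (h - h') = \<one>" using 2 by simp
    then show ?thesis using pow_trivial assms(3) by fastforce
  qed
qed

section \<open>Heights of words and of vertices of the cover\<close>

definition letter_height :: "'a \<Rightarrow> int" where
  "letter_height x = (if x = s then 1 else if x = inv s then -1 else 0)"

definition height :: "'a list \<Rightarrow> int" where
  "height w = sum_list (map letter_height w)"

lemma height_simps [simp]: "height [] = 0" "height (x # w) = letter_height x + height w"
  "height (u @ v) = height u + height v"
  by (simp_all add: height_def)

lemma letter_height_abs: "\<bar>letter_height x\<bar> \<le> 1"
  by (simp add: letter_height_def)

lemma height_abs: "\<bar>height w\<bar> \<le> int (length w)"
proof (induction w)
  case (Cons x w)
  then show ?case using letter_height_abs[of x] by simp
qed simp

lemma lies_at_letter: "x \<in> S \<Longrightarrow> lies_at x (letter_height x)"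
  by (auto simp: S_eq letter_height_def lies_at_def int_pow_neg)

lemma lies_at_height: "set w \<subseteq> S \<Longrightarrow> lies_at (word_val w) (height w)"
  by (induction w) (auto simp: lies_at_zero_iff intro: lies_at_mult lies_at_letter)

text \<open>The height of a relator with at most \<open>r\<close> letters lies in the window where
  \<one> has only the height 0. Hence the height is invariant under \<open>word_eq\<close> and
  becomes a homomorphism from \<open>H\<close> to the integers.\<close>

lemma short_height_zero:
  assumes "set w \<subseteq> S" "length w \<le> r" "word_val w = \<one>"
  shows "height w = 0"
proof -
  have "lies_at \<one> (height w)" using lies_at_height[OF assms(1)] assms(3) by simp
  moreover have "lies_at \<one> 0" by (simp add: lies_at_zero_iff)
  ultimately show ?thesis using lies_at_unique[of \<one> "height w" 0] height_abs[of w] assms(2) by simp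
qed

lemma word_eq_height: "word_eq u v \<Longrightarrow> height u = height v"
proof (induction rule: word_eq.induct)
  case (word_eq_insert p u q)
  then show ?case using short_height_zero[of u] by simp
qed auto

definition cover_height :: "'a list set \<Rightarrow> int" where "cover_height x = height (rep x)"

lemma cover_height_cls [simp]: "set w \<subseteq> S \<Longrightarrow> cover_height (cls w) = height w"
  using word_eq_height[OF rep_cls] by (simp add: cover_height_def)

lemma cover_height_mult:
  "x \<in> carrier H \<Longrightarrow> y \<in> carrier H \<Longrightarrow> cover_height (x \<otimes>\<^bsub>H\<^esub> y) = cover_height x + cover_height y"
  by (auto elim!: H_cases)

lemma letter_height_s [simp]: "letter_height s = 1" "letter_height (inv s) = -1"
proof -
  have "s \<noteq> inv s"
  proof
    assume "s = inv s"
    then have "s [^] (1::int) = s [^] (-1::int)" by (simp add: int_pow_neg)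
    then have "lies_at s 1" "lies_at s (-1)" unfolding lies_at_def by auto
    then show False using lies_at_unique[of s 1 "-1"] r4 by simp
  qed
  then show "letter_height s = 1" "letter_height (inv s) = -1" by (auto simp: letter_height_def)
qed

definition lift_s where "lift_s = cls [s]"
text \<open>The empty word serves for trivial \<open>t\<close>, since \<one> is not a
  letter.\<close>

definition lift_t where "lift_t = cls (if t = \<one> then [] else [t])"

lemma lift_st_closed [simp]: "lift_s \<in> carrier H" "lift_t \<in> carrier H"
  using s_in t_in by (auto simp: lift_s_def lift_t_def)

lemma lift_s_in_T: "lift_s \<in> T" "inv\<^bsub>H\<^esub> lift_s \<in> T"
  using s_in cover.gens_inv[of lift_s] by (auto simp: lift_s_def T_def)

lemma letter_height_t: "t \<noteq> \<one> \<Longrightarrow> letter_height t = 0"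
proof -
  assume t1: "t \<noteq> \<one>"
  then have "t \<noteq> s [^] (1::int)" "t \<noteq> s [^] (-1::int)" using sf unfolding std_form_def by blast+
  then show ?thesis by (simp add: letter_height_def int_pow_neg)
qed

lemma cover_height_lift_st: "cover_height lift_s = 1" "cover_height lift_t = 0"
  using s_in letter_height_t t_in by (auto simp: lift_s_def lift_t_def)

lemma lift_t_trivial: "t = \<one> \<Longrightarrow> lift_t = \<one>\<^bsub>H\<^esub>"
  unfolding lift_t_def one_H by simp

lemma lift_st_comm: "lift_s \<otimes>\<^bsub>H\<^esub> lift_t = lift_t \<otimes>\<^bsub>H\<^esub> lift_s" and lift_t_square: "lift_t \<otimes>\<^bsub>H\<^esub> lift_t = \<one>\<^bsub>H\<^esub>"
proof -
  show "lift_s \<otimes>\<^bsub>H\<^esub> lift_t = lift_t \<otimes>\<^bsub>H\<^esub> lift_s"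
  proof (cases "t = \<one>")
    case False
    then have "cls [s, t] = cls [t, s]" using r4 st_comm s_in t_in by (intro short_eq) auto
    then show ?thesis using False s_in t_in by (simp add: lift_s_def lift_t_def)
  next
    case True
    show ?thesis unfolding lift_t_trivial[OF True] by simp
  qed
  show "lift_t \<otimes>\<^bsub>H\<^esub> lift_t = \<one>\<^bsub>H\<^esub>"
  proof (cases "t = \<one>")
    case False
    then have "cls [t, t] = cls []" using r4 tt t_in by (intro short_eq) auto
    then show ?thesis using False t_in by (simp add: lift_t_def one_H)
  next
    case True
    show ?thesis unfolding lift_t_trivial[OF True] by simp
  qed
qed

lemma cover_elements:
  assumes "x \<in> carrier H"
  shows "\<exists>j::int. x = lift_s [^]\<^bsub>H\<^esub> j \<or> x = lift_t \<otimes>\<^bsub>H\<^esub> lift_s [^]\<^bsub>H\<^esub> j"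
  using assms
proof (induction x rule: cover.generate_induct_left)
  case one
  show ?case by (rule exI[of _ 0]) simp
next
  case (mult y x)
  then obtain j where j: "x = lift_s [^]\<^bsub>H\<^esub> (j::int) \<or> x = lift_t \<otimes>\<^bsub>H\<^esub> lift_s [^]\<^bsub>H\<^esub> j" by (elim exE)
  have "y = lift_s \<or> y = inv\<^bsub>H\<^esub> lift_s \<or> y = lift_t"
  proof -
    obtain x where x: "x \<in> S" "y = cls [x]" using mult(1) by (auto simp: T_def)
    then show ?thesis using s_in by (auto simp: lift_s_def lift_t_def elim: S_cases)
  qed
  then consider i where "y = lift_s [^]\<^bsub>H\<^esub> (i::int)" | "y = lift_t"
  proof (elim disjE)
    assume "y = lift_s"
    then show ?thesis using that(1)[of 1] by simp
  next
    assume "y = inv\<^bsub>H\<^esub> lift_s"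
    then show ?thesis using that(1)[of "-1"] by (simp add: H.int_pow_neg)
  qed (use that in simp)
  then show ?case
  proof cases
    case 1
    have "lift_s [^]\<^bsub>H\<^esub> i \<otimes>\<^bsub>H\<^esub> (lift_t \<otimes>\<^bsub>H\<^esub> lift_s [^]\<^bsub>H\<^esub> j) = lift_t \<otimes>\<^bsub>H\<^esub> lift_s [^]\<^bsub>H\<^esub> (i + j)"
    proof -
      have "lift_s [^]\<^bsub>H\<^esub> i \<otimes>\<^bsub>H\<^esub> (lift_t \<otimes>\<^bsub>H\<^esub> lift_s [^]\<^bsub>H\<^esub> j) = (lift_s [^]\<^bsub>H\<^esub> i \<otimes>\<^bsub>H\<^esub> lift_t) \<otimes>\<^bsub>H\<^esub> lift_s [^]\<^bsub>H\<^esub> j"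
        by (simp add: H.m_assoc)
      then show ?thesis
        unfolding H.commute_int_pow[OF lift_st_closed lift_st_comm] by (simp add: H.m_assoc H.int_pow_mult)
    qed
    moreover have "lift_s [^]\<^bsub>H\<^esub> i \<otimes>\<^bsub>H\<^esub> lift_s [^]\<^bsub>H\<^esub> j = lift_s [^]\<^bsub>H\<^esub> (i + j)" by (simp add: H.int_pow_mult)
    ultimately show ?thesis using j 1 by metis
  next
    case 2
    have "lift_t \<otimes>\<^bsub>H\<^esub> (lift_t \<otimes>\<^bsub>H\<^esub> lift_s [^]\<^bsub>H\<^esub> j) = lift_s [^]\<^bsub>H\<^esub> j" using lift_t_square by (simp add: H.m_assoc[symmetric])
    then show ?thesis using j 2 by metis
  qed
qed

lemma cover_height_one: "cover_height \<one>\<^bsub>H\<^esub> = 0"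
  by (simp add: one_H)

lemma cover_height_pow: "cover_height (lift_s [^]\<^bsub>H\<^esub> (j::int)) = j"
proof -
  have n: "cover_height (lift_s [^]\<^bsub>H\<^esub> (m::nat)) = int m" for m
    by (induction m) (auto simp: cover_height_one cover_height_mult cover_height_lift_st)
  show ?thesis
  proof (cases j)
    case (nonneg m)
    then show ?thesis using n by (simp add: int_pow_int)
  next
    case (neg m)
    have "cover_height (lift_s [^]\<^bsub>H\<^esub> j) + cover_height (lift_s [^]\<^bsub>H\<^esub> (- j)) = 0"
      using cover_height_mult[of "lift_s [^]\<^bsub>H\<^esub> j" "lift_s [^]\<^bsub>H\<^esub> (- j)"] H.int_pow_mult[of lift_s j "- j", symmetric]
      by (simp add: cover_height_one)
    moreover have "cover_height (lift_s [^]\<^bsub>H\<^esub> (- j)) = - j"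
    proof -
      have "- j = int (Suc m)" using neg by simp
      then show ?thesis by (simp only: int_pow_int n)
    qed
    ultimately show ?thesis by simp
  qed
qed

text \<open>Each element is a power of \<open>lift_s\<close>, up to a factor \<open>lift_t\<close>,
  with the exponent as its height. The level 0 is thus a set of at most two vertices, the separator
  used for the two ends.\<close>

lemma cover_height_zero:
  assumes "x \<in> carrier H" "cover_height x = 0"
  shows "x \<in> {\<one>\<^bsub>H\<^esub>, lift_t}"
proof -
  obtain j where j: "x = lift_s [^]\<^bsub>H\<^esub> (j::int) \<or> x = lift_t \<otimes>\<^bsub>H\<^esub> lift_s [^]\<^bsub>H\<^esub> j" using cover_elements[OF assms(1)] by (elim exE)
  then have "cover_height x = j" by (auto simp: cover_height_mult cover_height_lift_st cover_height_pow)
  then show ?thesis using assms(2) j by auto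
qed

lemma T_height: "y \<in> T \<Longrightarrow> \<bar>cover_height y\<bar> \<le> 1"
  using letter_height_abs by (auto simp: T_def)

lemma adj_Cov_height:
  assumes "x \<in> carrier H" "adj Cov (lift x) v"
  shows "\<exists>y\<in>carrier H. v = lift y \<and> \<bar>cover_height y - cover_height x\<bar> \<le> 1"
proof -
  have "v \<in> verts Cov" using assms(2) by (simp add: adj_def)
  then obtain y where y: "y \<in> carrier H" "v = lift y" using verts_Cov by auto
  then obtain z where z: "z \<in> T" "y = x \<otimes>\<^bsub>H\<^esub> z" using adj_Cov[OF assms(1) y(1)] assms(2) by auto
  then have "cover_height y - cover_height x = cover_height z"
    using T_sub assms(1) cover_height_mult[of x z] by auto
  then show ?thesis using T_height[OF z(1)] y by auto
qed

text \<open>An edge changes the height by at most one, so a path from positive to negative heights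
  has to pass level 0. The positive and the negative powers of \<open>lift_s\<close> are the two
  rays.\<close>

theorem two_ends: "two_ends_separated_le2 Cov"
proof -
  define f where "f k = lift (lift_s [^]\<^bsub>H\<^esub> int k)" for k :: nat
  define g where "g k = lift (lift_s [^]\<^bsub>H\<^esub> (- int k))" for k :: nat
  define Ys where "Ys = lift ` {\<one>\<^bsub>H\<^esub>, lift_t}"
  have lift_inj': "x = y" if "lift x = lift y" "x \<in> carrier H" "y \<in> carrier H" for x y
    using lift_inj that by (auto dest: inj_onD)
  have ray_f: "ray Cov f"
    unfolding ray_def
  proof (intro conjI allI injI)
    fix k l assume "f k = f l"
    then have "lift_s [^]\<^bsub>H\<^esub> int k = lift_s [^]\<^bsub>H\<^esub> int l" using lift_inj' by (simp add: f_def)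
    then show "k = l" using cover_height_pow by (metis of_nat_eq_iff)
  next
    fix k
    have "lift_s [^]\<^bsub>H\<^esub> int (Suc k) = lift_s [^]\<^bsub>H\<^esub> int k \<otimes>\<^bsub>H\<^esub> lift_s"
      by (simp only: int_pow_int) simp
    then show "adj Cov (f k) (f (Suc k))" unfolding f_def using lift_s_in_T by (subst adj_Cov) auto
  qed
  have ray_g: "ray Cov g"
    unfolding ray_def
  proof (intro conjI allI injI)
    fix k l assume "g k = g l"
    then have "lift_s [^]\<^bsub>H\<^esub> (- int k) = lift_s [^]\<^bsub>H\<^esub> (- int l)" using lift_inj' by (simp add: g_def)
    then show "k = l" using cover_height_pow by (metis of_nat_eq_iff neg_equal_iff_equal)
  next
    fix k
    have "- int (Suc k) = - int k + - 1" by simp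
    then have "lift_s [^]\<^bsub>H\<^esub> (- int (Suc k)) = lift_s [^]\<^bsub>H\<^esub> (- int k + - 1)" by (simp only:)
    also have "\<dots> = lift_s [^]\<^bsub>H\<^esub> (- int k) \<otimes>\<^bsub>H\<^esub> inv\<^bsub>H\<^esub> lift_s"
      by (simp only: H.int_pow_mult lift_st_closed) (simp add: H.int_pow_neg)
    finally show "adj Cov (g k) (g (Suc k))" unfolding g_def using lift_s_in_T by (subst adj_Cov) auto
  qed
  let ?D = "delete_verts Cov Ys"
  have adjD: "adj ?D x y \<Longrightarrow> adj Cov x y \<and> y \<notin> Ys" for x y
    by (auto simp: adj_def delete_verts_def verts_def edges_def)
  have pos: "\<exists>y\<in>carrier H. v = lift y \<and> cover_height y > 0"
    if "reachable ?D (lift x) v" "x \<in> carrier H" "cover_height x > 0" for x v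
    using that(1)
  proof (induction rule: reachable_induct)
    case refl
    then show ?case using that by blast
  next
    case (step v w)
    then obtain y where y: "y \<in> carrier H" "v = lift y" "cover_height y > 0" by blast
    obtain z where z: "z \<in> carrier H" "w = lift z" "\<bar>cover_height z - cover_height y\<bar> \<le> 1"
      using adj_Cov_height[OF y(1), of w] adjD[OF \<open>adj ?D v w\<close>] y(2) by blast
    have "z \<notin> {\<one>\<^bsub>H\<^esub>, lift_t}" using adjD[OF \<open>adj ?D v w\<close>] z(2) by (auto simp: Ys_def)
    then have "cover_height z \<noteq> 0" using cover_height_zero z(1) by blast
    then show ?case using z y(3) by (intro bexI[of _ z]) auto
  qed
  have notY: "lift x \<notin> Ys" if "x \<in> carrier H" "cover_height x \<noteq> 0" for x
    using that lift_inj'[of x lift_t] lift_inj'[of x "\<one>\<^bsub>H\<^esub>"] cover_height_one cover_height_lift_st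
    by (auto simp: Ys_def)
  have sep: "f k \<notin> Ys \<and> g l \<notin> Ys \<and> \<not> reachable ?D (f k) (g l)" if "k \<ge> 1" "l \<ge> 1" for k l
  proof (intro conjI notI)
    show "f k \<in> Ys \<Longrightarrow> False" unfolding f_def using notY that by (simp add: cover_height_pow)
    show "g l \<in> Ys \<Longrightarrow> False" unfolding g_def using notY that by (simp add: cover_height_pow)
    assume "reachable ?D (f k) (g l)"
    then obtain y where y: "y \<in> carrier H" "g l = lift y" "cover_height y > 0"
      using pos[of "lift_s [^]\<^bsub>H\<^esub> int k" "g l"] \<open>k \<ge> 1\<close> by (auto simp: f_def cover_height_pow)
    then have "y = lift_s [^]\<^bsub>H\<^esub> (- int l)" using lift_inj'[of y "lift_s [^]\<^bsub>H\<^esub> (- int l)"] by (simp add: g_def)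
    then show False using y(3) by (simp add: cover_height_pow)
  qed
  have Ysub: "Ys \<subseteq> verts Cov" by (auto simp: Ys_def verts_Cov)
  have Yfin: "finite Ys" and "card Ys \<le> 2"
    using card_insert_le_m1[of 2 "{lift lift_t}"] by (auto simp: Ys_def card_insert_if)
  moreover have "\<not> same_end Cov f g"
  proof
    assume "same_end Cov f g"
    then obtain N where N: "\<forall>k\<ge>N. \<forall>l\<ge>N. f k \<notin> Ys \<and> g l \<notin> Ys \<and> reachable ?D (f k) (g l)"
      unfolding same_end_def using Yfin by blast
    then have "reachable ?D (f (max N 1)) (g (max N 1))" by simp
    then show False using sep[of "max N 1" "max N 1"] by simp
  qed
  ultimately show ?thesis
    unfolding two_ends_separated_le2_def using ray_f ray_g Ysub sep by blast
qed

section \<open>Heights along short closed walks\<close>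

lemma height_take_diff:
  assumes "p \<le> q"
  shows "\<bar>height (take q w) - height (take p w)\<bar> \<le> int (q - p)"
proof -
  have "take q w = take p w @ take (q - p) (drop p w)"
    using assms take_add[of p "q - p" w] by simp
  then have "height (take q w) - height (take p w) = height (take (q - p) (drop p w))" by simp
  also have "\<bar>\<dots>\<bar> \<le> int (length (take (q - p) (drop p w)))" by (rule height_abs)
  finally show ?thesis by simp
qed

text \<open>Heights are measured from a position where the walk visits \<open>v\<close>. Its total
  height is zero, so of the two arcs between any two positions one has length at most
  \<open>r / 2\<close>, and this bounds the difference in height.\<close>

lemma closed_walk_heights:
  assumes w: "closed_walk Cay w" "walk_len w \<le> r" and v: "v \<in> set w" "v \<in> {\<one>, t}"
  shows "\<exists>d. (\<forall>q\<le>walk_len w. lies_at (w ! q) (d q) \<and> 2 * \<bar>d q\<bar> \<le> int r) \<and>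
    (\<forall>q<walk_len w. \<bar>d (Suc q) - d q\<bar> \<le> 1)"
proof -
  have wk: "walk Cay w" "w \<noteq> []" using w by (auto simp: closed_walk_def)
  let ?u = "word_of w"
  note u = closed_walk_word[OF w]
  have len: "walk_len w = length ?u" "length w = Suc (length ?u)"
    using wk by (auto simp: walk_len_def length_word_of)
  let ?x = "hd w"
  have xG: "?x \<in> carrier G" using walk_hd_closed[OF wk(1)] .
  have nth: "w ! q = ?x \<otimes> word_val (take q ?u)" if "q \<le> walk_len w" for q
    using nth_path[OF xG u(1), of q] that path_word_of[OF wk(1)] len by simp
  obtain p where p: "p \<le> walk_len w" "v = w ! p"
    using v(1) len unfolding in_set_conv_nth by (metis less_Suc_eq_le)
  define d where "d q = height (take q ?u) - height (take p ?u)" for q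
  have setT: "set (take q ?u) \<subseteq> S" for q using u(1) by (meson order_trans set_take_subset)
  have atd: "lies_at (w ! q) (d q)" if q: "q \<le> walk_len w" for q
  proof -
    let ?P = "word_val (take p ?u)" and ?Q = "word_val (take q ?u)"
    have PQ: "?P \<in> carrier G" "?Q \<in> carrier G" using setT by auto
    have "lies_at (inv ?P \<otimes> ?Q) (- height (take p ?u) + height (take q ?u))"
      using lies_at_mult lies_at_inv lies_at_height setT by blast
    then have "lies_at (v \<otimes> (inv ?P \<otimes> ?Q)) (0 + (- height (take p ?u) + height (take q ?u)))"
      using lies_at_mult v(2) lies_at_zero_iff by blast
    moreover have "v \<otimes> (inv ?P \<otimes> ?Q) = w ! q"
    proof -
      have "v \<otimes> (inv ?P \<otimes> ?Q) = ?x \<otimes> (?P \<otimes> (inv ?P \<otimes> ?Q))"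
        using nth[OF p(1)] p(2) xG PQ by (simp add: m_assoc)
      also have "?P \<otimes> (inv ?P \<otimes> ?Q) = ?Q" using PQ by (simp add: m_assoc[symmetric])
      finally show ?thesis using nth[OF q] by simp
    qed
    ultimately show ?thesis by (simp add: d_def)
  qed
  have total: "height (take (walk_len w) ?u) = 0"
    using short_height_zero[OF u] len by simp
  have bound: "2 * \<bar>d q\<bar> \<le> int r" if q: "q \<le> walk_len w" for q
  proof -
    let ?h = "\<lambda>q. height (take q ?u)"
    \<comment> \<open>The difference is at most \<open>j - i\<close> along the walk and at most
      \<open>i + (walk_len w - j)\<close> the other way round; adding both bounds gives the factor
      2.\<close>
    have aux: "2 * \<bar>?h j - ?h i\<bar> \<le> int (walk_len w)" if "i \<le> j" "j \<le> walk_len w" for i j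
    proof -
      have "\<bar>?h j - ?h i\<bar> \<le> int j - int i" "\<bar>?h j\<bar> \<le> int (walk_len w) - int j" "\<bar>?h i\<bar> \<le> int i"
        using height_take_diff[OF that(1), of ?u] height_take_diff[OF that(2), of ?u]
          height_take_diff[of 0 i ?u] total that by simp_all
      moreover have "2 * x \<le> m" if "x \<le> l - k" "y \<le> m - l" "z \<le> k" "x \<le> y + z" for x y z k l m :: int
        using that by linarith
      ultimately show ?thesis using abs_triangle_ineq4[of "?h j" "?h i"] by blast
    qed
    show ?thesis
    proof (cases "p \<le> q")
      case True
      then show ?thesis using aux[of p q] q w(2) by (simp add: d_def)
    next
      case False
      then show ?thesis using aux[of q p] p(1) w(2) by (simp add: d_def abs_minus_commute)
    qed
  qed
  have "\<bar>d (Suc q) - d q\<bar> \<le> 1" for q using height_take_diff[of q "Suc q" ?u] by (simp add: d_def)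
  then show ?thesis using atd bound by blast
qed

text \<open>Bounding heights by \<open>r / 2\<close> keeps any two heights in play within distance
  \<open>r\<close>, so a vertex of positive height cannot also have a negative one.\<close>

definition positive_part :: "'a set" where
  "positive_part = {x. \<exists>h. 1 \<le> h \<and> 2 * h \<le> int r \<and> lies_at x h}"

text \<open>The edge lies on a short closed walk through the centre, along which heights change by
  at most one. Height 0 has been deleted, so the sign is kept; \<open>lies_at_unique\<close> matches
  the given height of \<open>x\<close> with the one along the walk.\<close>

lemma positive_part_step:
  assumes v: "v \<in> {\<one>, t}" and a: "adj (delete_verts (ball_graph Cay r v) {\<one>, t}) x y"
    and x: "x \<in> positive_part"
  shows "y \<in> positive_part"
proof -
  have "{x, y} \<in> edges (ball_graph Cay r v)" "y \<notin> {\<one>, t}"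
    using a by (auto simp: adj_def delete_verts_def edges_def verts_def)
  then obtain w i where w: "{x, y} = {w ! i, w ! Suc i}" "closed_walk Cay w" "walk_len w \<le> r" "v \<in> set w"
    "i < walk_len w" and y: "y \<notin> {\<one>, t}"
    unfolding ball_graph_def edges_def by auto
  obtain d where d: "\<And>q. q \<le> walk_len w \<Longrightarrow> lies_at (w ! q) (d q)" "\<And>q. q \<le> walk_len w \<Longrightarrow> 2 * \<bar>d q\<bar> \<le> int r"
    "\<And>q. q < walk_len w \<Longrightarrow> \<bar>d (Suc q) - d q\<bar> \<le> 1"
    using closed_walk_heights[OF w(2,3,4) v] by blast
  obtain h where h: "1 \<le> h" "2 * h \<le> int r" "lies_at x h" using x by (auto simp: positive_part_def)
  obtain k l where kl: "x = w ! k" "y = w ! l" "k \<le> walk_len w" "l \<le> walk_len w" "\<bar>d l - d k\<bar> \<le> 1"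
  proof -
    consider "x = w ! i" "y = w ! Suc i" | "y = w ! i" "x = w ! Suc i" using w(1) by (auto simp: doubleton_eq_iff)
    then show ?thesis
    proof cases
      case 1
      then show ?thesis using that[of i "Suc i"] d(3)[OF w(5)] w(5) by simp
    next
      case 2
      then show ?thesis using that[of "Suc i" i] d(3)[OF w(5)] w(5) by (simp add: abs_minus_commute)
    qed
  qed
  have "h = d k" using lies_at_unique[OF h(3), of "d k"] d(1,2)[OF kl(3)] kl(1) h by simp
  moreover have "d l \<noteq> 0" using d(1)[OF kl(4)] kl(2) y lies_at_zero_iff[of y] by auto
  ultimately have "1 \<le> d l" using kl(5) h(1) by simp
  moreover have "2 * d l \<le> int r" using d(2)[OF kl(4)] by simp
  ultimately show ?thesis using d(1)[OF kl(4)] kl(2) by (auto simp: positive_part_def)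
qed

lemma positive_part_reachable:
  assumes v: "v \<in> {\<one>, t}" and "reachable (delete_verts (ball_graph Cay r v) {\<one>, t}) x y"
    and x: "x \<in> positive_part"
  shows "y \<in> positive_part"
  using assms(2) by (induction rule: reachable_induct) (use x positive_part_step[OF v] in auto)

lemma s_positive: "s \<in> positive_part" and inv_s_not_positive: "inv s \<notin> positive_part"
proof -
  have "lies_at s 1" by (simp add: lies_at_def)
  then show "s \<in> positive_part" using r4 by (auto simp: positive_part_def)
  have "lies_at (inv s) (-1)" using lies_at_inv[OF \<open>lies_at s 1\<close>] by simp
  show "inv s \<notin> positive_part"
  proof
    assume "inv s \<in> positive_part"
    then obtain h where h: "1 \<le> h" "2 * h \<le> int r" "lies_at (inv s) h" by (auto simp: positive_part_def)
    then show False using lies_at_unique[OF h(3) \<open>lies_at (inv s) (-1)\<close>] r4 by simp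
  qed
qed

lemma s_not_center: "s \<notin> {\<one>, t}" "inv s \<notin> {\<one>, t}"
proof -
  have "lies_at s 1" by (simp add: lies_at_def)
  moreover from this have "lies_at (inv s) (-1)" using lies_at_inv by fastforce
  ultimately show "s \<notin> {\<one>, t}" "inv s \<notin> {\<one>, t}"
    using lies_at_unique[of s 1 0] lies_at_unique[of "inv s" "-1" 0] r4 lies_at_zero_iff by auto
qed

text \<open>The neighbours \<open>s\<close> and \<open>inv s\<close> of \<one> have heights 1 and
  -1, and no punctured ball joins them. Whether \<open>{\<one>, t}\<close> has one or two elements
  decides between a cutvertex and a 2-separator.\<close>

theorem local_separator: "has_local_separator_le2 Cay r"
proof (cases "t = \<one>")
  case True
  let ?D = "delete_verts (ball_graph Cay r \<one>) {\<one>}"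
  have mem: "x \<in> verts ?D" if "x \<in> S" "x \<noteq> \<one>" for x
  proof -
    have "adj Cay \<one> x" using that(1) by (simp add: adj_Cay)
    then have "closed_walk Cay [\<one>, x, \<one>]"
      using adj_sym[of Cay \<one> x] by (simp add: closed_walk_def verts_Cay)
    then have "x \<in> verts (ball_graph Cay r \<one>)"
      using r4 unfolding ball_graph_def verts_def fst_conv
      by (intro CollectI exI[of _ "[\<one>, x, \<one>]"]) (auto simp: walk_len_def)
    then show ?thesis using that by (simp add: delete_verts_def verts_def)
  qed
  have "\<not> connected_graph ?D"
  proof
    assume "connected_graph ?D"
    then have "reachable ?D s (inv s)"
      unfolding connected_graph_def using mem s_in s_not_center by auto
    then show False
      using positive_part_reachable[of \<one> s "inv s"] s_positive inv_s_not_positive True by simp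
  qed
  then have "local_cutvertex Cay r \<one>" by (simp add: local_cutvertex_def verts_Cay)
  then show ?thesis by (auto simp: has_local_separator_le2_def)
next
  case False
  let ?C = "connectivity_graph Cay r \<one> t"
  have vC: "verts ?C = nbhd2 Cay \<one> t" by (simp add: connectivity_graph_def verts_def)
  have mem: "x \<in> verts ?C" if "x \<in> S" "x \<notin> {\<one>, t}" for x
  proof -
    have "adj Cay \<one> x" using that(1) by (simp add: adj_Cay)
    then show ?thesis unfolding vC nbhd2_def using that adj_sym[of Cay \<one> x] by (simp add: verts_Cay)
  qed
  have pos: "y \<in> positive_part" if "reachable ?C s y" for y
    using that
  proof (induction rule: reachable_induct)
    case refl
    show ?case by (rule s_positive)
  next
    case (step y z)
    then have "{y, z} \<in> edges ?C" by (simp add: adj_def)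
    then obtain c e v where ce: "{y, z} = {c, e}" "v \<in> {\<one>, t}"
      "reachable (delete_verts (ball_graph Cay r v) {\<one>, t}) c e"
      unfolding connectivity_graph_def edges_def by auto
    then have "reachable (delete_verts (ball_graph Cay r v) {\<one>, t}) y z"
      using reachable_sym[OF ce(3)] by (auto simp: doubleton_eq_iff)
    then show ?case using positive_part_reachable[OF ce(2)] step by blast
  qed
  have "\<not> connected_graph ?C"
  proof
    assume "connected_graph ?C"
    then have "reachable ?C s (inv s)"
      unfolding connected_graph_def using mem s_in s_not_center by auto
    then show False using pos inv_s_not_positive by blast
  qed
  moreover have "\<exists>w. walk Cay w \<and> hd w = \<one> \<and> last w = t \<and> 2 * walk_len w \<le> r"
    using False r4 by (intro exI[of _ "[\<one>, t]"]) (simp add: walk_len_def adj_Cay verts_Cay t_in)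
  ultimately have "local_2_separator Cay r \<one> t"
    using False by (auto simp: local_2_separator_def verts_Cay)
  then show ?thesis by (auto simp: has_local_separator_le2_def)
qed

end

theorem (in group) std_form_imp:
  assumes fin: "finite (carrier G)" and sf: "std_form G s t r" and r: "r \<ge> 4"
  shows "\<exists>S. cayley_gen_set G S \<and> two_ends_separated_le2 (local_covering (cayley_graph G S) r \<one>)
    \<and> has_local_separator_le2 (cayley_graph G S) r"
    and "order G > r"
proof -
  let ?S = "{s, inv s} \<union> ({t} - {\<one>})"
  interpret std_presentation G ?S r s t
    using std_form_gen_set[OF sf] sf r by unfold_locales auto
  show "\<exists>S. cayley_gen_set G S \<and> two_ends_separated_le2 (local_covering (cayley_graph G S) r \<one>)
    \<and> has_local_separator_le2 (cayley_graph G S) r"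
    using gens two_ends local_separator by blast
  have "s [^] ord s = \<one>" "ord s > 0" using pow_ord_eq_1[OF s_closed] ord_ge_1[OF fin s_closed] by auto
  then have "ord s > r" using sf unfolding std_form_def by (meson not_le)
  moreover have "ord s \<le> order G" using ord_dvd_group_order[OF s_closed] fin order_gt_0_iff_finite
    by (simp add: dvd_imp_le)
  ultimately show "order G > r" by simp
qed

section \<open>Small fragments of Cayley graphs\<close>

context cayley_group
begin

definition nbrs :: "'a set \<Rightarrow> 'a set" where
  "nbrs U = {y \<in> carrier G - U. \<exists>x\<in>U. \<exists>s\<in>S. y = x \<otimes> s}"

definition fragment :: "'a set \<Rightarrow> bool" where
  "fragment U \<longleftrightarrow> finite U \<and> U \<noteq> {} \<and> U \<subseteq> carrier G \<and> carrier G - (U \<union> nbrs U) \<noteq> {}"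

lemma nbrs_finite: "finite U \<Longrightarrow> finite (nbrs U)"
proof -
  assume "finite U"
  moreover have "nbrs U \<subseteq> (\<lambda>(x, s). x \<otimes> s) ` (U \<times> S)" by (auto simp: nbrs_def)
  ultimately show ?thesis using gens_finite by (meson finite_SigmaI finite_imageI finite_subset)
qed

lemma nbrs_sub: "nbrs U \<subseteq> carrier G" "nbrs U \<inter> U = {}"
  by (auto simp: nbrs_def)

lemma nbrs_step: "x \<in> U \<Longrightarrow> U \<subseteq> carrier G \<Longrightarrow> s \<in> S \<Longrightarrow> x \<otimes> s \<in> U \<union> nbrs U"
  by (auto simp: nbrs_def)

lemma nbrs_sym:
  assumes "x \<in> carrier G" "s \<in> S" "x \<otimes> s \<in> U" "x \<notin> U"
  shows "x \<in> nbrs U"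
proof -
  have "x = (x \<otimes> s) \<otimes> inv s" using assms by (simp add: m_assoc)
  then show ?thesis using assms gens_inv unfolding nbrs_def by blast
qed

lemma nbrs_rest:
  assumes "U \<subseteq> carrier G"
  shows "nbrs (carrier G - (U \<union> nbrs U)) \<subseteq> nbrs U"
proof
  define W where "W = carrier G - (U \<union> nbrs U)"
  fix y assume "y \<in> nbrs (carrier G - (U \<union> nbrs U))"
  then have "y \<in> carrier G - W" "\<exists>x\<in>W. \<exists>s\<in>S. y = x \<otimes> s"
    unfolding W_def[symmetric] by (simp_all add: nbrs_def)
  then obtain x s where y: "y \<in> U \<union> nbrs U" "y = x \<otimes> s" "s \<in> S"
    "x \<in> carrier G" "x \<notin> U" "x \<notin> nbrs U" by (auto simp: W_def)
  then have "y \<notin> U" using nbrs_sym by blast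
  then show "y \<in> nbrs U" using y by blast
qed

lemma closed_imp_carrier:
  assumes "U \<subseteq> carrier G" "U \<noteq> {}" "\<And>x s. x \<in> U \<Longrightarrow> s \<in> S \<Longrightarrow> x \<otimes> s \<in> U"
  shows "U = carrier G"
proof (rule ccontr)
  assume "U \<noteq> carrier G"
  then have "bd U \<noteq> {}" using arcs.boundary_nonempty assms by blast
  then show False using assms by (auto simp: boundary_def arcs_def)
qed

lemma nbrs_l_coset:
  assumes "x \<in> carrier G" "U \<subseteq> carrier G"
  shows "nbrs (x <# U) = x <# nbrs U"
proof -
  have aux: "x <# nbrs U \<subseteq> nbrs (x <# U)" if "x \<in> carrier G" "U \<subseteq> carrier G" for x U
  proof
    fix y assume "y \<in> x <# nbrs U"
    then obtain u s where y: "y = x \<otimes> (u \<otimes> s)" "u \<in> U" "s \<in> S" "u \<otimes> s \<notin> U" "u \<otimes> s \<in> carrier G"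
      by (auto simp: l_coset_def nbrs_def)
    then have "x \<otimes> u \<in> x <# U" "y = (x \<otimes> u) \<otimes> s" "y \<notin> x <# U" "y \<in> carrier G"
      using that mult_mem_l_coset_iff[of x U "u \<otimes> s"] by (auto simp: l_coset_def m_assoc)
    then show "y \<in> nbrs (x <# U)" using y(3) unfolding nbrs_def by blast
  qed
  have xU: "x <# U \<subseteq> carrier G" using assms by (simp add: l_coset_subset_G)
  have "inv x <# nbrs (x <# U) \<subseteq> nbrs (inv x <# (x <# U))" using aux[of "inv x"] assms xU by simp
  then have "inv x <# nbrs (x <# U) \<subseteq> nbrs U" using l_coset_inv_cancel assms by simp
  then have "nbrs (x <# U) \<subseteq> x <# nbrs U" using inv_l_coset_subset_iff nbrs_sub assms by simp
  then show ?thesis using aux assms by blast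
qed

lemma card_l_coset: "x \<in> carrier G \<Longrightarrow> A \<subseteq> carrier G \<Longrightarrow> card (x <# A) = card A"
  unfolding l_coset_image using inj_on_mult_left by (meson card_image inj_on_subset)

lemma fragment_l_coset:
  assumes "x \<in> carrier G" "fragment U"
  shows "fragment (x <# U)"
proof -
  have U: "finite U" "U \<noteq> {}" "U \<subseteq> carrier G" "carrier G - (U \<union> nbrs U) \<noteq> {}"
    using assms by (auto simp: fragment_def)
  have "x <# (carrier G - (U \<union> nbrs U)) = carrier G - (x <# (U \<union> nbrs U))"
    using assms(1) U nbrs_sub by (simp add: l_coset_Compl)
  moreover have "x <# (U \<union> nbrs U) = (x <# U) \<union> nbrs (x <# U)"
  proof -
    have "x <# (U \<union> nbrs U) = (x <# U) \<union> (x <# nbrs U)" by (auto simp: l_coset_def)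
    then show ?thesis using assms(1) U by (simp add: nbrs_l_coset)
  qed
  moreover have "x <# (carrier G - (U \<union> nbrs U)) \<noteq> {}" "x <# U \<noteq> {}" using U by (auto simp: l_coset_def)
  ultimately show ?thesis
    using U assms(1) unfolding fragment_def by (simp add: finite_l_coset_iff l_coset_subset_G)
qed

text \<open>The neighbourhood is minimised first, then the size. Minimal size forces two atoms that
  meet to coincide, so the translates of an atom are pairwise equal or disjoint.\<close>

definition atom :: "'a set \<Rightarrow> bool" where
  "atom A \<longleftrightarrow> fragment A \<and> (\<forall>U. fragment U \<longrightarrow> card (nbrs A) \<le> card (nbrs U)) \<and>
     (\<forall>U. fragment U \<and> card (nbrs U) \<le> card (nbrs A) \<longrightarrow> card A \<le> card U)"

lemma exists_atom:
  assumes "fragment U"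
  shows "\<exists>A. atom A \<and> card (nbrs A) \<le> card (nbrs U)"
proof -
  define m where "m = (LEAST n. \<exists>U. fragment U \<and> card (nbrs U) = n)"
  have m1: "\<exists>U. fragment U \<and> card (nbrs U) = m"
    unfolding m_def by (rule LeastI[of _ "card (nbrs U)"]) (use assms in blast)
  have m2: "m \<le> card (nbrs U)" if "fragment U" for U
    unfolding m_def by (rule Least_le) (use that in blast)
  define l where "l = (LEAST n. \<exists>U. fragment U \<and> card (nbrs U) = m \<and> card U = n)"
  obtain U0 where U0: "fragment U0 \<and> card (nbrs U0) = m" using m1 by blast
  have "\<exists>U. fragment U \<and> card (nbrs U) = m \<and> card U = l"
    unfolding l_def by (rule LeastI[of _ "card U0"]) (use U0 in blast)
  then obtain A where A: "fragment A" "card (nbrs A) = m" "card A = l" by blast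
  have l2: "l \<le> card U" if "fragment U" "card (nbrs U) = m" for U
    unfolding l_def by (rule Least_le) (use that in blast)
  have "card A \<le> card U" if "fragment U" "card (nbrs U) \<le> card (nbrs A)" for U
    using l2[OF that(1)] m2[OF that(1)] that(2) A by simp
  then show ?thesis using A m2 assms unfolding atom_def by blast
qed

lemma atom_l_coset:
  assumes "x \<in> carrier G" "atom A"
  shows "atom (x <# A)"
proof -
  have A: "A \<subseteq> carrier G" using assms by (auto simp: atom_def fragment_def)
  then have "card (nbrs (x <# A)) = card (nbrs A)" "card (x <# A) = card A"
    using assms(1) nbrs_sub by (simp_all add: nbrs_l_coset card_l_coset)
  then show ?thesis using assms fragment_l_coset unfolding atom_def by simp
qed

lemma nbrs_Int_Un:
  "nbrs (A \<inter> B) \<union> nbrs (A \<union> B) \<subseteq> nbrs A \<union> nbrs B"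
  "nbrs (A \<inter> B) \<inter> nbrs (A \<union> B) \<subseteq> nbrs A \<inter> nbrs B"
  "nbrs (A \<inter> B) \<subseteq> (nbrs A \<inter> B) \<union> (nbrs A \<inter> nbrs B) \<union> (A \<inter> nbrs B)"
  by (auto simp: nbrs_def)

text \<open>\<open>A \<inter> B\<close> is a fragment. If the outer parts \<open>RA\<close> and
  \<open>RB\<close> meet, \<open>A \<union> B\<close> is one too, and submodularity gives
  \<open>A \<inter> B\<close> the minimal neighbourhood, so it is as large as \<open>A\<close>.
  Otherwise \<open>RA\<close> is finite, hence itself a fragment with no larger neighbourhood, so at
  least as large as \<open>A\<close>; counting refutes this.\<close>

lemma atoms_disjoint:
  assumes A: "atom A" and B: "atom B" and AB: "A \<inter> B \<noteq> {}"
  shows "A = B"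
proof -
  have fA: "fragment A" and fB: "fragment B" using A B by (auto simp: atom_def)
  have fin: "finite A" "finite B" "finite (nbrs A)" "finite (nbrs B)" "finite (nbrs (A \<inter> B))" "finite (nbrs (A \<union> B))"
    and sub: "A \<subseteq> carrier G" "B \<subseteq> carrier G"
    using fA fB nbrs_finite by (auto simp: fragment_def)
  define RA where "RA = carrier G - (A \<union> nbrs A)"
  define RB where "RB = carrier G - (B \<union> nbrs B)"
  have RAne: "RA \<noteq> {}" using fA by (simp add: fragment_def RA_def)
  have le: "card (nbrs A) \<le> card (nbrs B)" "card (nbrs B) \<le> card (nbrs A)" using A B fA fB by (auto simp: atom_def)
  have cardAB: "card A \<le> card B" "card B \<le> card A" using A B fA fB le by (auto simp: atom_def)
  have rest: "carrier G - ((A \<inter> B) \<union> nbrs (A \<inter> B)) \<supseteq> RA" using nbrs_Int_Un(3)[of A B] unfolding RA_def by blast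
  have fI: "fragment (A \<inter> B)" unfolding fragment_def using AB fin sub rest RAne by blast
  have kI: "card (nbrs A) \<le> card (nbrs (A \<inter> B))" using A fI by (simp add: atom_def)
  have "RA \<inter> RB \<noteq> {}"
  proof
    assume "RA \<inter> RB = {}"
    then have RAsub: "RA = (B \<inter> RA) \<union> (nbrs B \<inter> RA)" by (auto simp: RA_def RB_def)
    then have finR: "finite RA" using fin by (metis finite_Int finite_UnI)
    have "fragment RA"
    proof -
      have "nbrs RA \<subseteq> nbrs A" using nbrs_rest[OF sub(1)] by (simp add: RA_def)
      then have "A \<subseteq> carrier G - (RA \<union> nbrs RA)" using sub nbrs_sub(2)[of A] by (auto simp: RA_def)
      then show ?thesis using finR RAne AB unfolding fragment_def by (auto simp: RA_def)
    qed
    moreover have "card (nbrs RA) \<le> card (nbrs A)"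
      using nbrs_rest[OF sub(1)] fin by (intro card_mono) (auto simp: RA_def)
    ultimately have "card A \<le> card RA" using A by (simp add: atom_def)
    have "card (nbrs (A \<inter> B)) \<le> card ((nbrs A \<inter> B) \<union> (nbrs A \<inter> nbrs B) \<union> (A \<inter> nbrs B))"
      using nbrs_Int_Un(3) fin by (intro card_mono) auto
    also have "\<dots> \<le> card (nbrs A \<inter> B) + card (nbrs A \<inter> nbrs B) + card (A \<inter> nbrs B)"
      by (meson add_le_mono1 card_Un_le order_trans)
    finally have 1: "card (nbrs (A \<inter> B)) \<le> card (nbrs A \<inter> B) + card (nbrs A \<inter> nbrs B) + card (A \<inter> nbrs B)" .
    have split3: "card C = card (A \<inter> C) + card (nbrs A \<inter> C) + card (RA \<inter> C)" if "finite C" "C \<subseteq> carrier G" for C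
    proof -
      have "C = (A \<inter> C \<union> nbrs A \<inter> C) \<union> (RA \<inter> C)" using that(2) by (auto simp: RA_def)
      then have "card C = card (A \<inter> C \<union> nbrs A \<inter> C) + card (RA \<inter> C)"
        using that(1) card_Un_disjoint[of "A \<inter> C \<union> nbrs A \<inter> C" "RA \<inter> C"] by (auto simp: RA_def)
      moreover have "card (A \<inter> C \<union> nbrs A \<inter> C) = card (A \<inter> C) + card (nbrs A \<inter> C)"
        using that(1) nbrs_sub(2)[of A] by (intro card_Un_disjoint) auto
      ultimately show ?thesis by simp
    qed
    have 2: "card (nbrs B) = card (A \<inter> nbrs B) + card (nbrs A \<inter> nbrs B) + card (RA \<inter> nbrs B)"
      using split3 fin nbrs_sub by simp
    have 3: "card B = card (A \<inter> B) + card (nbrs A \<inter> B) + card (RA \<inter> B)" using split3 fin sub by simp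
    \<comment> \<open>By 1 and 2, \<open>RA \<inter> nbrs B\<close> has at most as many elements as
      \<open>nbrs A \<inter> B\<close>. Inserted in 3 this gives
      \<open>card B \<ge> card (A \<inter> B) + card RA\<close>, which exceeds
      \<open>card A\<close>.\<close>
    have "card RA \<le> card (B \<inter> RA) + card (nbrs B \<inter> RA)"
      using RAsub card_Un_le[of "B \<inter> RA" "nbrs B \<inter> RA"] by simp
    moreover have "card (A \<inter> B) > 0" using AB fin by (simp add: card_gt_0_iff)
    ultimately show False
      using 1 2 3 kI le cardAB \<open>card A \<le> card RA\<close> by (simp add: Int_commute)
  qed
  then have "carrier G - ((A \<union> B) \<union> nbrs (A \<union> B)) \<noteq> {}"
    using nbrs_Int_Un(1)[of A B] unfolding RA_def RB_def by blast
  then have "fragment (A \<union> B)" using fin sub AB unfolding fragment_def by blast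
  then have kU: "card (nbrs A) \<le> card (nbrs (A \<union> B))" using A by (simp add: atom_def)
  have "card (nbrs (A \<inter> B)) + card (nbrs (A \<union> B))
      = card (nbrs (A \<inter> B) \<union> nbrs (A \<union> B)) + card (nbrs (A \<inter> B) \<inter> nbrs (A \<union> B))"
    using fin by (intro card_Un_Int) auto
  also have "\<dots> \<le> card (nbrs A \<union> nbrs B) + card (nbrs A \<inter> nbrs B)"
    using nbrs_Int_Un fin by (intro add_mono card_mono) auto
  also have "\<dots> = card (nbrs A) + card (nbrs B)" using fin card_Un_Int by metis
  finally have "card (nbrs (A \<inter> B)) \<le> card (nbrs A)" using kU le by simp
  then have "card A \<le> card (A \<inter> B)" using A fI by (simp add: atom_def)
  then have "A \<inter> B = A" "A \<inter> B = B"
    using card_seteq[of A "A \<inter> B"] card_seteq[of B "A \<inter> B"] fin cardAB by auto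
  then show ?thesis by blast
qed

text \<open>The atom containing \<open>\<one>\<close> is a subgroup that acts freely on its neighbourhood, so it has at
  most two elements; in the case of two the graph would be the complete graph on four vertices.\<close>

theorem no_small_fragment:
  assumes "\<one> \<notin> S" "card S \<ge> 3" "fragment U"
  shows "card (nbrs U) > 2"
proof (rule ccontr)
  assume "\<not> card (nbrs U) > 2"
  then obtain A0 where A0: "atom A0" "card (nbrs A0) \<le> 2" using exists_atom[OF assms(3)] by fastforce
  then obtain x where x: "x \<in> A0" "x \<in> carrier G" by (auto simp: atom_def fragment_def)
  define A where "A = inv x <# A0"
  have A0G: "A0 \<subseteq> carrier G" using A0 by (auto simp: atom_def fragment_def)
  have A: "atom A" using atom_l_coset A0 x by (simp add: A_def)
  have AG: "A \<subseteq> carrier G" "finite A" "carrier G - (A \<union> nbrs A) \<noteq> {}" using A by (auto simp: atom_def fragment_def)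
  have card2: "card (nbrs A) \<le> 2" using A0 A0G x nbrs_sub by (simp add: A_def nbrs_l_coset card_l_coset)
  have oneA: "\<one> \<in> A" using x A0G by (simp add: A_def mem_l_coset_iff)
  have stab: "h <# A = A" if "h \<in> A" for h
  proof -
    have h: "h \<in> carrier G" using that AG by blast
    have "h \<in> h <# A" using mult_mem_l_coset_iff[of h A \<one>] h AG oneA by simp
    then show ?thesis using atoms_disjoint[OF atom_l_coset[OF h A] A] that by blast
  qed
  have finN: "finite (nbrs A)" using nbrs_finite AG by blast
  obtain z where z: "z \<in> nbrs A"
  proof -
    have "nbrs A \<noteq> {}"
    proof
      assume "nbrs A = {}"
      then have "A = carrier G" using closed_imp_carrier[OF AG(1)] oneA nbrs_step[OF _ AG(1)] by blast
      then show False using AG(3) by blast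
    qed
    then show ?thesis using that by blast
  qed
  have zG: "z \<in> carrier G" using z nbrs_sub by blast
  have orbit: "h \<otimes> z \<in> nbrs A" if h: "h \<in> A" for h
  proof -
    have "h \<otimes> z \<in> h <# nbrs A" using z by (auto simp: l_coset_def)
    then show ?thesis using nbrs_l_coset[of h A] stab[OF h] h AG by auto
  qed
  have inj: "inj_on (\<lambda>h. h \<otimes> z) A" using AG zG by (intro inj_onI) (metis r_cancel subsetD)
  then have cardA: "card A \<le> card (nbrs A)" using orbit finN by (intro card_inj_on_le) auto
  \<comment> \<open>All generators are neighbours of \<one>. As there are at least three and
    \<open>card A \<le> card (nbrs A) \<le> 2\<close>, both sets have two elements and the inclusion
    is an equality.\<close>
  have SA: "S \<subseteq> (A \<union> nbrs A) - {\<one>}"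
    using nbrs_step[OF oneA AG(1)] assms(1) by force
  have "card S \<le> card ((A \<union> nbrs A) - {\<one>})" using SA AG finN by (intro card_mono) auto
  also have cU: "\<dots> = card A + card (nbrs A) - 1"
  proof -
    have "A \<inter> nbrs A = {}" using nbrs_sub(2)[of A] by blast
    then have "card (A \<union> nbrs A) = card A + card (nbrs A)" using AG finN by (intro card_Un_disjoint)
    then show ?thesis using oneA by (simp add: card_Diff_singleton)
  qed
  finally have cS: "card S \<le> card A + card (nbrs A) - 1" .
  then have c2: "card A = 2" "card (nbrs A) = 2" using card2 cardA assms(2) by linarith+
  then have "card (A - {\<one>}) = 1" using oneA by (simp add: card_Diff_singleton)
  then obtain a where a: "A - {\<one>} = {a}" by (auto simp: card_1_singleton_iff)
  then have Aeq: "A = {\<one>, a}" and a1: "a \<noteq> \<one>" and aG: "a \<in> carrier G" using oneA AG by auto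
  have aa: "a \<otimes> a = \<one>"
  proof -
    have "a \<otimes> a \<in> a <# A" using Aeq by (auto simp: l_coset_def)
    then have "a \<otimes> a \<in> {\<one>, a}" using stab[of a] Aeq by simp
    then show ?thesis using a1 aG by auto
  qed
  have "(\<lambda>h. h \<otimes> z) ` A = nbrs A"
    using orbit inj finN c2 by (intro card_subset_eq) (auto simp: card_image)
  then have Neq: "nbrs A = {z, a \<otimes> z}" using Aeq zG by auto
  have zA: "z \<notin> A" using z nbrs_sub by blast
  have "S = (A \<union> nbrs A) - {\<one>}"
  proof (rule card_subset_eq)
    show "card S = card ((A \<union> nbrs A) - {\<one>})"
      using \<open>card S \<le> card ((A \<union> nbrs A) - {\<one>})\<close> cU
        c2 assms(2) by simp
  qed (use SA AG finN in auto)
  also have "(A \<union> nbrs A) - {\<one>} = ({\<one>, a} \<union> {z, a \<otimes> z}) - {\<one>}"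
    by (subst Neq, subst Aeq, rule refl)
  also have "\<dots> = {a, z, a \<otimes> z}"
  proof -
    have "a \<otimes> z \<notin> A" using orbit[of a] Aeq nbrs_sub(2)[of A] by blast
    then have "a \<otimes> z \<noteq> \<one>" "z \<noteq> \<one>" using zA oneA by metis+
    then show ?thesis using a1 by auto
  qed
  finally have Seq: "S = {a, z, a \<otimes> z}" .
  have S_cases: "x = a \<or> x = z \<or> x = a \<otimes> z" if "x \<in> S" for x using that Seq by blast
  have S_mem: "z \<in> S" "a \<otimes> z \<in> S" using Seq by blast+
  have cancel: "a \<otimes> (a \<otimes> y) = y" if "y \<in> carrier G" for y
    using that aa aG by (simp add: m_assoc[symmetric])
  consider "inv z = a" | "inv z = z" | "inv z = a \<otimes> z" using S_cases gens_inv[OF S_mem(1)] by blast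
  \<comment> \<open>The inverse of \<open>z\<close> is one of the three generators. In each possible
    case the relations make \<open>{\<one>, a, z, a \<otimes> z}\<close> closed under
    \<open>S\<close>, so that nothing is left outside \<open>A \<union> nbrs A\<close>.\<close>
  then have rel: "z \<otimes> a = a \<otimes> z \<and> z \<otimes> z \<in> {\<one>, a}"
  proof cases
    case 1
    then have "z = inv a" using zG by (metis inv_inv)
    then have "z = a" using aa aG inv_equality by metis
    then show ?thesis using zA Aeq by blast
  next
    case 2
    then have zz: "z \<otimes> z = \<one>" using zG by (metis l_inv)
    have inva: "inv a = a" using aa aG inv_equality by metis
    have "inv (a \<otimes> z) = z \<otimes> a" using 2 inva aG zG by (simp add: inv_mult_group)
    then have "z \<otimes> a = a \<or> z \<otimes> a = z \<or> z \<otimes> a = a \<otimes> z"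
      using S_cases[OF gens_inv[OF S_mem(2)]] by simp
    moreover have "z \<otimes> a \<noteq> a" using zA Aeq aG zG by auto
    moreover have "z \<otimes> a \<noteq> z" using a1 aG zG by auto
    ultimately show ?thesis using zz by blast
  next
    case 3
    then have "a \<otimes> z \<otimes> z = \<one>" using zG by (metis l_inv)
    then have "a \<otimes> (a \<otimes> (z \<otimes> z)) = a" using aG zG by (simp add: m_assoc)
    then have zz: "z \<otimes> z = a" using cancel zG by simp
    then have "z \<otimes> a = a \<otimes> z" using zG by (metis m_assoc)
    then show ?thesis using zz by blast
  qed
  have "A \<union> nbrs A = carrier G"
  proof (rule closed_imp_carrier)
    show "A \<union> nbrs A \<subseteq> carrier G" "A \<union> nbrs A \<noteq> {}" using AG nbrs_sub oneA by auto
    fix y s assume ys: "y \<in> A \<union> nbrs A" "s \<in> S"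
    show "y \<otimes> s \<in> A \<union> nbrs A"
    proof (cases "y \<in> A")
      case True
      then show ?thesis using nbrs_step AG ys by blast
    next
      case False
      then have y: "y = z \<or> y = a \<otimes> z" using ys Neq by blast
      have 1: "z \<otimes> a = a \<otimes> z" "z \<otimes> z = \<one> \<or> z \<otimes> z = a" using rel by auto
      have 2: "z \<otimes> (a \<otimes> z) = a \<otimes> (z \<otimes> z)" using 1(1) aG zG by (simp add: m_assoc[symmetric])
      have zs: "z \<otimes> s \<in> {\<one>, a, z, a \<otimes> z}"
        using S_cases[OF ys(2)] 1 2 aa aG zG by (elim disjE) simp_all
      moreover have "a \<otimes> q \<in> {\<one>, a, z, a \<otimes> z}" if "q \<in> {\<one>, a, z, a \<otimes> z}" for q
        using that aa aG zG cancel by auto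
      moreover have "(a \<otimes> z) \<otimes> s = a \<otimes> (z \<otimes> s)" using gens_closed[OF ys(2)] aG zG by (simp add: m_assoc)
      ultimately have "y \<otimes> s \<in> {\<one>, a, z, a \<otimes> z}" using y by metis
      moreover have "A \<union> nbrs A = {\<one>, a} \<union> {z, a \<otimes> z}" by (subst Neq, subst Aeq, rule refl)
      ultimately show ?thesis by auto
    qed
  qed
  then show False using AG(3) by blast
qed

end

section \<open>Local separators\<close>

text \<open>Common form of both kinds of local separators: a cutvertex is the case
  \<open>v1 = v0\<close> with \<open>w1\<close> empty. \<open>Q\<close> marks a set of neighbours
  that no punctured ball joins to the others; \<open>a0\<close> and \<open>b0\<close> show that
  neither kind is missing.\<close>

locale local_separation = short_relators G S r for G (structure) and S r +
  fixes v0 v1 and w1 and Q :: "'a \<Rightarrow> bool" and a0 b0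
  assumes v0: "v0 \<in> carrier G" and w1: "set w1 \<subseteq> S" "v1 = v0 \<otimes> word_val w1" "2 * length w1 \<le> r"
    and sep: "v \<in> {v0, v1} \<Longrightarrow> x \<in> nbhd2 (cayley_graph G S) v0 v1 \<Longrightarrow> y \<in> nbhd2 (cayley_graph G S) v0 v1
      \<Longrightarrow> reachable (delete_verts (ball_graph (cayley_graph G S) r v) {v0, v1}) x y \<Longrightarrow> Q x \<longleftrightarrow> Q y"
    and a0: "a0 \<in> nbhd2 (cayley_graph G S) v0 v1" "Q a0"
    and b0: "b0 \<in> nbhd2 (cayley_graph G S) v0 v1" "\<not> Q b0"
begin

section \<open>Lifting the separator to the cover\<close>

definition mv :: "'a list set \<Rightarrow> 'a list \<Rightarrow> 'a list set" where "mv p w = p \<otimes>\<^bsub>H\<^esub> cls w"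

lemma mv_closed [simp]: "p \<in> carrier H \<Longrightarrow> set w \<subseteq> S \<Longrightarrow> mv p w \<in> carrier H"
  by (simp add: mv_def)

lemma mv_Nil [simp]: "p \<in> carrier H \<Longrightarrow> mv p [] = p"
  by (simp add: mv_def one_H[symmetric])

lemma mv_append:
  assumes "p \<in> carrier H" "set u \<subseteq> S" "set v \<subseteq> S"
  shows "mv p (u @ v) = mv (mv p u) v"
  using assms by (simp add: mv_def H.m_assoc)

lemma proj_closed [simp]: "p \<in> carrier H \<Longrightarrow> proj p \<in> carrier G"
  using proj_hom by (auto simp: hom_def)

lemma proj_mv: "p \<in> carrier H \<Longrightarrow> set w \<subseteq> S \<Longrightarrow> proj (mv p w) = proj p \<otimes> word_val w"
  by (auto simp: mv_def elim!: H_cases)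

definition X0 where "X0 = cls (SOME w. set w \<subseteq> S \<and> word_val w = v0)"
definition X1 where "X1 = mv X0 w1"
definition Y where "Y = {X0, X1}"

lemma X0: "X0 \<in> carrier H" "proj X0 = v0"
proof -
  have "set (SOME w. set w \<subseteq> S \<and> word_val w = v0) \<subseteq> S \<and> word_val (SOME w. set w \<subseteq> S \<and> word_val w = v0) = v0"
    by (rule someI_ex[OF proj_surj[OF v0]])
  then show "X0 \<in> carrier H" "proj X0 = v0" by (simp_all add: X0_def)
qed

lemma X1: "X1 \<in> carrier H" "proj X1 = v1"
  using X0 w1 by (simp_all add: X1_def proj_mv)

lemma Y_closed: "p \<in> Y \<Longrightarrow> p \<in> carrier H" and Y_proj: "p \<in> Y \<Longrightarrow> proj p \<in> {v0, v1}"
  using X0 X1 by (auto simp: Y_def)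

lemma Y_short_path:
  assumes "p \<in> Y" "q \<in> Y"
  shows "\<exists>d. set d \<subseteq> S \<and> 2 * length d \<le> r \<and> q = mv p d"
proof -
  have "X0 = mv X1 (inv_word w1)"
  proof -
    have "mv X1 (inv_word w1) = X0 \<otimes>\<^bsub>H\<^esub> (cls w1 \<otimes>\<^bsub>H\<^esub> inv\<^bsub>H\<^esub> cls w1)"
      using X0 w1 by (simp add: X1_def mv_def H.m_assoc)
    also have "\<dots> = X0" using X0 w1 by (simp only: H.r_inv H.r_one cls_in_H)
    finally show ?thesis by simp
  qed
  moreover have "p = mv p []" using Y_closed[OF assms(1)] by simp
  ultimately show ?thesis using assms w1 unfolding Y_def X1_def
    by (elim insertE emptyE) (metis (no_types) inv_word_set length_inv_word empty_subsetI le0 list.set(1) list.size(3) mult_0_right X1_def)+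
qed

text \<open>One of the two parts \<open>c\<close> and \<open>c'\<close> of the loop has length at
  most \<open>r / 2\<close>, and so has the word \<open>d\<close> from \<open>p\<close> to
  \<open>q\<close>. Together they form a relator of length at most \<open>r\<close>. This is where
  the distance bound on the separator is used.\<close>

lemma short_loop_lift:
  assumes p: "p \<in> Y" and q: "q \<in> Y" and c: "set (c @ c') \<subseteq> S" "length (c @ c') \<le> r" "word_val (c @ c') = \<one>"
    and pr: "proj (mv p c) = proj q"
  shows "mv p c = q"
proof -
  have pG: "p \<in> carrier H" using p Y_closed by blast
  have S: "set c \<subseteq> S" "set c' \<subseteq> S" using c by auto
  obtain d where d: "set d \<subseteq> S" "2 * length d \<le> r" "q = mv p d" using Y_short_path p q by blast
  have val: "word_val c = word_val d"
    using pr pG d S by (simp add: proj_mv)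
  have "cls c = cls d"
  proof (cases "2 * length c \<le> r")
    case True
    then show ?thesis using val d S by (intro short_eq) auto
  next
    case False
    have "word_val c \<otimes> word_val c' = \<one>" using c(3) S by simp
    then have inv: "inv (word_val c') = word_val c" using S inv_equality by simp
    have "cls (inv_word c') = cls d"
      using False c(2) val inv d S by (intro short_eq) auto
    moreover have "cls c = cls (inv_word c')"
      using c(2) S inv by (intro short_eq) auto
    ultimately show ?thesis by simp
  qed
  then show ?thesis using d by (simp add: mv_def)
qed

text \<open>Applied to consecutive vertices of a walk only, so adjacency is not part of it. It is
  symmetric, as a walk may traverse these edges in either direction.\<close>

definition F :: "'a list set \<Rightarrow> 'a list set \<Rightarrow> bool" where
  "F p q \<longleftrightarrow> (p \<in> Y \<and> proj q \<notin> {v0, v1} \<and> Q (proj q)) \<or> (q \<in> Y \<and> proj p \<notin> {v0, v1} \<and> Q (proj p))"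

fun parity :: "'a list set \<Rightarrow> 'a list \<Rightarrow> bool" where
  "parity p [] = False"
| "parity p (s # w) = (F p (mv p [s]) \<noteq> parity (mv p [s]) w)"

lemma parity_append:
  "p \<in> carrier H \<Longrightarrow> set u \<subseteq> S \<Longrightarrow> set v \<subseteq> S \<Longrightarrow> parity p (u @ v) = (parity p u \<noteq> parity (mv p u) v)"
proof (induction u arbitrary: p)
  case (Cons s u)
  have "mv p (s # u) = mv (mv p [s]) u" using mv_append[of p "[s]" u] Cons.prems by simp
  then show ?case using Cons by auto
qed simp

lemma take_words: "set W \<subseteq> S \<Longrightarrow> set (take k W) \<subseteq> S" and drop_words: "set W \<subseteq> S \<Longrightarrow> set (drop k W) \<subseteq> S"
  using set_take_subset[of k W] set_drop_subset[of k W] by auto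

lemma mv_take_Suc:
  assumes "p \<in> carrier H" "set W \<subseteq> S" "k < length W"
  shows "mv p (take (Suc k) W) = mv (mv p (take k W)) [W ! k]"
    and "parity p (take (Suc k) W) = (parity p (take k W) \<noteq> F (mv p (take k W)) (mv p (take (Suc k) W)))"
proof -
  have e: "take (Suc k) W = take k W @ [W ! k]" using assms(3) by (rule take_Suc_conv_app_nth)
  have S: "set (take k W) \<subseteq> S" "set [W ! k] \<subseteq> S" using take_words assms by (auto simp: subset_iff)
  show 1: "mv p (take (Suc k) W) = mv (mv p (take k W)) [W ! k]"
    unfolding e using mv_append[OF assms(1) S] .
  show "parity p (take (Suc k) W) = (parity p (take k W) \<noteq> F (mv p (take k W)) (mv p (take (Suc k) W)))"
    unfolding 1 unfolding e using parity_append[OF assms(1) S] by simp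
qed

text \<open>Between two consecutive visits to \<open>Y\<close>, a short closed walk stays within a component of the
  punctured ball; hence it uses both or none of its two outer edges in \<open>F\<close>.\<close>

lemma first_return:
  assumes p: "p \<in> Y" and W: "set W \<subseteq> S" "length W \<le> r" "word_val W = \<one>"
    and n: "1 \<le> n" "n \<le> length W" "mv p (take n W) \<in> Y"
    and first: "\<And>k. 0 < k \<Longrightarrow> k < n \<Longrightarrow> mv p (take k W) \<notin> Y"
  shows "\<not> parity p (take n W)"
proof (cases "n = 1")
  case True
  have pG: "p \<in> carrier H" and len: "0 < length W" using p Y_closed n by auto
  have "\<not> F p (mv p (take (Suc 0) W))" using p n(3) Y_proj True unfolding F_def by auto
  then show ?thesis using mv_take_Suc(2)[OF pG W(1) len] pG True by simp
next
  case False
  have pG: "p \<in> carrier H" using p Y_closed by blast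
  let ?q = "\<lambda>k. mv p (take k W)"
  have qG: "?q k \<in> carrier H" for k using pG W take_words by simp
  have q0: "?q 0 = p" using pG by simp
  let ?v = "proj p" and ?D = "delete_verts (ball_graph Cay r (proj p)) {v0, v1}"
  have v: "?v \<in> {v0, v1}" using Y_proj p by blast
  \<comment> \<open>The walk could pass over \<open>v0\<close> or \<open>v1\<close> in a vertex
    outside \<open>Y\<close>; \<open>short_loop_lift\<close> excludes this. So avoiding
    \<open>Y\<close> in the cover means avoiding the separator in \<open>Cay\<close>.\<close>
  have notv: "proj (?q k) \<notin> {v0, v1}" if k: "0 < k" "k < n" for k
  proof
    assume "proj (?q k) \<in> {v0, v1}"
    then have "proj (?q k) \<in> proj ` Y" unfolding Y_def using X0(2) X1(2) by simp
    then obtain y where y: "y \<in> Y" "proj (?q k) = proj y" by (elim imageE)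
    have "?q k = y" using short_loop_lift[OF p y(1), of "take k W" "drop k W"] y(2) W by simp
    then show False using first[OF k] y(1) by simp
  qed
  have vG: "?v \<in> carrier G" using pG by simp
  have closed: "closed_walk Cay (path ?v W)" "walk_len (path ?v W) \<le> r" "?v \<in> set (path ?v W)"
    using W vG hd_in_set[of "path ?v W"] by (auto simp: closed_walk_def walk_len_def)
  have nth: "path ?v W ! k = proj (?q k)" if "k \<le> length W" for k
    using nth_path[OF vG W(1) that] pG W take_words by (simp add: proj_mv)
  have inball: "proj (?q k) \<in> verts (ball_graph Cay r ?v)" if "k \<le> length W" for k
  proof -
    have "proj (?q k) \<in> set (path ?v W)" using nth[OF that] that nth_mem[of k "path ?v W"] by simp
    then show ?thesis using closed unfolding ball_graph_def verts_def by auto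
  qed
  have inD: "proj (?q k) \<in> verts ?D" if "0 < k" "k < n" for k
    using inball[of k] notv[OF that] that n by (simp add: delete_verts_def verts_def)
  have adjC: "adj Cay (proj (?q k)) (proj (?q (Suc k)))" if "k < length W" for k
  proof -
    have "W ! k \<in> S" using that W by auto
    then show ?thesis
      using mv_take_Suc(1)[OF pG W(1) that] qG[of k] proj_mv[of "?q k" "[W ! k]"] by simp
  qed
  have adjD: "adj ?D (proj (?q k)) (proj (?q (Suc k)))" if k: "0 < k" "Suc k < n" for k
  proof -
    have kl: "k < length W" using k n by simp
    have "{proj (?q k), proj (?q (Suc k))} = {path ?v W ! k, path ?v W ! Suc k}" using nth[of k] nth[of "Suc k"] kl by simp
    then have "{proj (?q k), proj (?q (Suc k))} \<in> edges (ball_graph Cay r ?v)"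
      unfolding ball_graph_def edges_def snd_conv using closed kl
      by (intro CollectI exI[of _ "path ?v W"] exI[of _ k]) (simp add: walk_len_def)
    then have "{proj (?q k), proj (?q (Suc k))} \<in> edges ?D"
      using notv[of k] notv[of "Suc k"] k by (auto simp: delete_verts_def edges_def)
    then show ?thesis using adjC[OF kl] inD[of k] inD[of "Suc k"] k by (simp add: adj_def)
  qed
  have reach: "reachable ?D (proj (?q 1)) (proj (?q k))" if "1 \<le> k" "k < n" for k
    using that
  proof (induction k rule: dec_induct)
    case base
    then show ?case using inD[of 1] by (intro reachable_refl) simp
  next
    case (step k)
    then show ?case using adjD[of k] reachable_step by simp
  qed
  \<comment> \<open>Strictly between the visits no edge has an endpoint in \<open>Y\<close>, so the
    parity set by the first edge is kept up to the last one.\<close>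
  have par: "parity p (take k W) = Q (proj (?q 1))" if "1 \<le> k" "k < n" for k
    using that
  proof (induction k rule: dec_induct)
    case base
    have "F p (?q 1) = Q (proj (?q 1))" using p first[of 1] notv[of 1] base by (auto simp: F_def)
    moreover have "0 < length W" using n(1,2) by linarith
    then have "parity p (take 1 W) = F p (?q 1)" using mv_take_Suc(2)[OF pG W(1), of 0] q0 by simp
    ultimately show ?case by simp
  next
    case (step k)
    have "\<not> F (?q k) (?q (Suc k))" using first[of k] first[of "Suc k"] step by (auto simp: F_def)
    then show ?case using mv_take_Suc(2)[OF pG W(1), of k] step n by simp
  qed
  define l where "l = n - 1"
  have l: "Suc l = n" "1 \<le> l" "l < n" using n False by (auto simp: l_def)
  have nb1: "proj (?q 1) \<in> nbhd2 Cay v0 v1"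
  proof -
    have "0 < length W" using n(1,2) by linarith
    then have "adj Cay ?v (proj (?q 1))" using adjC[of 0] q0 by simp
    then have "adj Cay (proj (?q 1)) ?v" by (rule adj_sym)
    then show ?thesis using notv[of 1] l v qG by (auto simp: nbhd2_def verts_Cay)
  qed
  have nbl: "proj (?q l) \<in> nbhd2 Cay v0 v1"
  proof -
    have "l < length W" using l n(2) by linarith
    then have "adj Cay (proj (?q l)) (proj (?q n))" using adjC[of l] l(1) by simp
    then show ?thesis using notv[of l] l Y_proj[OF n(3)] qG by (auto simp: nbhd2_def verts_Cay)
  qed
  have "Q (proj (?q 1)) = Q (proj (?q l))" using sep[OF v nb1 nbl reach[OF l(2,3)]] .
  moreover have "F (?q l) (?q n) = Q (proj (?q l))"
    using n(3) first[of l] l notv[of l] by (auto simp: F_def)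
  ultimately show ?thesis
    using mv_take_Suc(2)[OF pG W(1), of l] par[OF l(2,3)] l n by simp
qed

lemma rotate_relator:
  assumes "set W \<subseteq> S" "word_val W = \<one>"
  shows "word_val (drop l W @ take l W) = \<one>"
proof -
  have S: "set (take l W) \<subseteq> S" "set (drop l W) \<subseteq> S" using take_words drop_words assms by auto
  have "word_val (take l W) \<otimes> word_val (drop l W) = \<one>"
    using word_val_append[OF S] assms(2) by simp
  then have "word_val (drop l W) = inv (word_val (take l W))"
    using S by (metis inv_equality inv_inv word_val_closed)
  then show ?thesis using S by simp
qed

lemma mv_relator: "p \<in> carrier H \<Longrightarrow> set W \<subseteq> S \<Longrightarrow> length W \<le> r \<Longrightarrow> word_val W = \<one> \<Longrightarrow> mv p W = p"
  using word_eq_relator[of W] cls_eq_iff[of W "[]"] by (simp add: mv_def one_H[symmetric])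

text \<open>Strong induction on the position of the visit. The relator is rotated so as to start at
  the last earlier visit; the rest is then a first return.\<close>

lemma parity_Y:
  assumes p: "p \<in> Y" and W: "set W \<subseteq> S" "length W \<le> r" "word_val W = \<one>"
    and n: "n \<le> length W" "mv p (take n W) \<in> Y"
  shows "\<not> parity p (take n W)"
  using n
proof (induction n rule: less_induct)
  case (less n)
  have pG: "p \<in> carrier H" using p Y_closed by blast
  show ?case
  proof (cases "n = 0")
    case False
    define l where "l = Max {k. k < n \<and> mv p (take k W) \<in> Y}"
    have fin: "finite {k. k < n \<and> mv p (take k W) \<in> Y}" by simp
    have "0 \<in> {k. k < n \<and> mv p (take k W) \<in> Y}" using False p pG by simp
    then have "l \<in> {k. k < n \<and> mv p (take k W) \<in> Y}" unfolding l_def using Max_in[OF fin] by blast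
    then have l: "l < n" "mv p (take l W) \<in> Y" by auto
    have lmax: "k \<le> l" if "k < n" "mv p (take k W) \<in> Y" for k
      unfolding l_def using fin that by (intro Max_ge) auto
    have S: "set (take l W) \<subseteq> S" "set (drop l W) \<subseteq> S" using take_words drop_words W by auto
    define W' where "W' = drop l W @ take l W"
    have W': "set W' \<subseteq> S" "length W' \<le> r" "word_val W' = \<one>"
      using S W rotate_relator[OF W(1,3)] by (auto simp: W'_def)
    have tk: "take (l + k) W = take l W @ take k W'" if "l + k \<le> length W" for k
      using that by (simp add: W'_def take_add)
    have mvk: "mv (mv p (take l W)) (take k W') = mv p (take (l + k) W)" if "l + k \<le> length W" for k
      using mv_append[OF pG S(1) take_words[OF W'(1)]] tk[OF that] by simp
    have "\<not> parity (mv p (take l W)) (take (n - l) W')"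
    proof (rule first_return[OF l(2) W'])
      show "1 \<le> n - l" "n - l \<le> length W'" using l less.prems by (auto simp: W'_def)
      show "mv (mv p (take l W)) (take (n - l) W') \<in> Y" using mvk[of "n - l"] l less.prems by simp
      show "mv (mv p (take l W)) (take k W') \<notin> Y" if "0 < k" "k < n - l" for k
      proof -
        have "l + k < n" "\<not> l + k \<le> l" "l + k \<le> length W" using that less.prems by auto
        then show ?thesis using mvk[of k] lmax[of "l + k"] by metis
      qed
    qed
    moreover have "\<not> parity p (take l W)" using less.IH[OF l(1)] l less.prems by simp
    ultimately show ?thesis
      using parity_append[OF pG S(1) take_words[OF W'(1), of "n - l"]] tk[of "n - l"] l less.prems by simp
  qed simp
qed

text \<open>A walk that meets \<open>Y\<close> is rotated to start there, which only exchanges the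
  two summands of the parity. A walk that misses \<open>Y\<close> has no edge in
  \<open>F\<close>.\<close>

lemma parity_relator:
  assumes pG: "p \<in> carrier H" and W: "set W \<subseteq> S" "length W \<le> r" "word_val W = \<one>"
  shows "\<not> parity p W"
proof (cases "\<exists>l\<le>length W. mv p (take l W) \<in> Y")
  case True
  then obtain l where l: "l \<le> length W" "mv p (take l W) \<in> Y" by blast
  have S: "set (take l W) \<subseteq> S" "set (drop l W) \<subseteq> S" using take_words drop_words W by auto
  let ?p = "mv p (take l W)" and ?W = "drop l W @ take l W"
  have W': "set ?W \<subseteq> S" "length ?W \<le> r" "word_val ?W = \<one>" using S W rotate_relator[OF W(1,3)] by auto
  have pG': "?p \<in> carrier H" using pG S by simp
  have "mv ?p ?W = ?p" using mv_relator[OF pG' W'] .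
  moreover have "take (length ?W) ?W = ?W" by (rule take_all) (rule order_refl)
  ultimately have "\<not> parity ?p ?W" using parity_Y[OF l(2) W' order_refl] l(2) by metis
  moreover have "mv ?p (drop l W) = p"
    using mv_append[OF pG S] mv_relator[OF pG W] by simp
  ultimately have "parity ?p (drop l W) = parity p (take l W)"
    using parity_append[OF pG' S(2,1)] by simp
  then show ?thesis using parity_append[OF pG S] by simp
next
  case False
  have "\<not> parity p (take k W)" if "k \<le> length W" for k
    using that
  proof (induction k)
    case (Suc k)
    then have "\<not> F (mv p (take k W)) (mv p (take (Suc k) W))" using False by (auto simp: F_def)
    then show ?case using Suc mv_take_Suc(2)[OF pG W(1), of k] by simp
  qed simp
  then show ?thesis using take_all[of W "length W"] by (metis order_refl)
qed

text \<open>Inserted relators contribute nothing, so the parity depends on the end vertex only and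
  \<open>side\<close> does not depend on the chosen representative.\<close>

lemma word_eq_parity: "word_eq u v \<Longrightarrow> p \<in> carrier H \<Longrightarrow> parity p u = parity p v"
proof (induction arbitrary: p rule: word_eq.induct)
  case (word_eq_insert a u b)
  have S: "set a \<subseteq> S" "set u \<subseteq> S" "set b \<subseteq> S" using word_eq_insert by auto
  have pa: "mv p a \<in> carrier H" using word_eq_insert.prems S by simp
  have "mv (mv p a) u = mv p a" using mv_relator[OF pa S(2)] word_eq_insert by simp
  moreover have "\<not> parity (mv p a) u" using parity_relator[OF pa S(2)] word_eq_insert by simp
  ultimately show ?case
    using parity_append[of p a b] parity_append[of p a "u @ b"] parity_append[OF pa S(2,3)] S word_eq_insert.prems
    by simp
qed auto

section \<open>The two sides of the lifted separator\<close>

definition side :: "'a list set \<Rightarrow> bool" where "side x = parity X0 (rep (inv\<^bsub>H\<^esub> X0 \<otimes>\<^bsub>H\<^esub> x))"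

lemma side_mv: "set w \<subseteq> S \<Longrightarrow> side (mv X0 w) = parity X0 w"
proof -
  assume w: "set w \<subseteq> S"
  have "inv\<^bsub>H\<^esub> X0 \<otimes>\<^bsub>H\<^esub> mv X0 w = cls w" using w X0 by (simp add: mv_def H.m_assoc[symmetric])
  then show ?thesis using word_eq_parity[OF rep_cls[OF w] X0(1)] by (simp add: side_def)
qed

lemma mv_cases:
  assumes "x \<in> carrier H"
  obtains w where "set w \<subseteq> S" "x = mv X0 w"
proof -
  have "inv\<^bsub>H\<^esub> X0 \<otimes>\<^bsub>H\<^esub> x \<in> carrier H" using assms X0 by simp
  then obtain w where w: "set w \<subseteq> S" "inv\<^bsub>H\<^esub> X0 \<otimes>\<^bsub>H\<^esub> x = cls w" by (rule H_cases)
  have "x = X0 \<otimes>\<^bsub>H\<^esub> (inv\<^bsub>H\<^esub> X0 \<otimes>\<^bsub>H\<^esub> x)" using assms X0 by (simp add: H.m_assoc[symmetric])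
  then show ?thesis using that w by (simp add: mv_def)
qed

lemma side_step:
  assumes "x \<in> carrier H" "s \<in> S"
  shows "side (mv x [s]) = (side x \<noteq> F x (mv x [s]))"
proof -
  obtain w where w: "set w \<subseteq> S" "x = mv X0 w" using mv_cases[OF assms(1)] .
  have "mv x [s] = mv X0 (w @ [s])" using mv_append[OF X0(1) w(1)] assms w by simp
  then show ?thesis using side_mv[of "w @ [s]"] side_mv[OF w(1)] parity_append[OF X0(1) w(1), of "[s]"] w assms
    by simp
qed

lemma side_Y: "y \<in> Y \<Longrightarrow> \<not> side y"
proof -
  have "\<not> parity X0 w1"
  proof -
    \<comment> \<open>The path from \<open>X0\<close> to \<open>X1\<close> is completed by its
      reverse to a relator of length at most \<open>r\<close>, so that \<open>parity_Y\<close>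
      applies to its first half.\<close>
    have "set (w1 @ inv_word w1) \<subseteq> S" "length (w1 @ inv_word w1) \<le> r" "word_val (w1 @ inv_word w1) = \<one>"
      using w1 by auto
    from parity_Y[OF _ this, of X0 "length w1"] show ?thesis by (simp add: Y_def X1_def)
  qed
  then have "\<not> side X1" using side_mv[OF w1(1)] by (simp add: X1_def)
  moreover have "\<not> side X0" using side_mv[of "[]"] X0 by simp
  ultimately show "y \<in> Y \<Longrightarrow> \<not> side y" by (auto simp: Y_def)
qed

lemma nbhd_lift:
  assumes "x \<in> nbhd2 Cay v0 v1"
  shows "\<exists>y\<in>Y. \<exists>s\<in>S. proj (mv y [s]) = x \<and> x \<notin> {v0, v1}"
proof -
  have x: "x \<in> carrier G" "x \<notin> {v0, v1}" "adj Cay x v0 \<or> adj Cay x v1"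
    using assms by (auto simp: nbhd2_def verts_Cay)
  obtain y where y: "y \<in> Y" "adj Cay (proj y) x"
  proof -
    have "adj Cay (proj X0) x \<or> adj Cay (proj X1) x" unfolding X0(2) X1(2) using x(3) adj_sym by metis
    then show ?thesis using that unfolding Y_def by blast
  qed
  let ?s = "inv (proj y) \<otimes> x"
  have s: "?s \<in> S" "proj y \<in> carrier G" using y(2) by (auto simp: adj_Cay)
  have "proj (mv y [?s]) = proj y \<otimes> ?s" using y s Y_closed x(1) by (simp add: proj_mv)
  then have "proj (mv y [?s]) = x" using s x(1) by (simp add: m_assoc[symmetric])
  then show ?thesis using y s x by blast
qed

text \<open>The side changes only across edges in \<open>F\<close>, each of which has an endpoint in
  \<open>Y\<close>, and \<open>Y\<close> itself is on the even side. So a step out of the odd side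
  ends in \<open>Y\<close>. A lift of \<open>a0\<close> next to \<open>Y\<close> is odd, one of
  \<open>b0\<close> is even.\<close>

theorem separated_cover:
  "\<exists>U. U \<subseteq> carrier H \<and> U \<noteq> {} \<and> U \<inter> Y = {} \<and> carrier H - (U \<union> Y) \<noteq> {} \<and>
    (\<forall>x\<in>U. \<forall>t\<in>T. x \<otimes>\<^bsub>H\<^esub> t \<in> U \<union> Y)"
proof -
  define U where "U = {x \<in> carrier H. side x}"
  have "x \<otimes>\<^bsub>H\<^esub> t \<in> U \<union> Y" if x: "x \<in> U" "t \<in> T" for x t
  proof -
    obtain s where s: "s \<in> S" "t = cls [s]" using x by (auto simp: T_def)
    have xG: "x \<in> carrier H" "side x" "x \<notin> Y" using x side_Y by (auto simp: U_def)
    have "side (mv x [s]) \<or> mv x [s] \<in> Y" using side_step[OF xG(1) s(1)] xG by (auto simp: F_def)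
    then show ?thesis using s xG by (auto simp: U_def mv_def)
  qed
  moreover have "U \<noteq> {}"
  proof -
    obtain y s where y: "y \<in> Y" "s \<in> S" "proj (mv y [s]) = a0" "a0 \<notin> {v0, v1}" using nbhd_lift[OF a0(1)] by blast
    then have "F y (mv y [s])" using a0 by (auto simp: F_def)
    then have "mv y [s] \<in> U" using side_step[of y s] side_Y y Y_closed by (simp add: U_def)
    then show ?thesis by blast
  qed
  moreover have "carrier H - (U \<union> Y) \<noteq> {}"
  proof -
    obtain y s where y: "y \<in> Y" "s \<in> S" "proj (mv y [s]) = b0" "b0 \<notin> {v0, v1}" using nbhd_lift[OF b0(1)] by blast
    then have n: "mv y [s] \<notin> Y" using Y_proj by metis
    then have "\<not> F y (mv y [s])" using b0 y by (auto simp: F_def)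
    then have "mv y [s] \<notin> U" using side_step[of y s] side_Y y Y_closed by (simp add: U_def)
    moreover have "mv y [s] \<in> carrier H" using mv_closed[OF Y_closed[OF y(1)], of "[s]"] y(2) by simp
    ultimately show ?thesis using n by blast
  qed
  moreover have "U \<inter> Y = {}" using side_Y by (auto simp: U_def)
  moreover have "U \<subseteq> carrier H" by (auto simp: U_def)
  ultimately show ?thesis by blast
qed

text \<open>The projection to \<open>G\<close> tells the classes of generators apart, so the cover
  has the same degree as \<open>Cay\<close>.\<close>

lemma card_T: "card T = card S" and one_notin_T: "\<one>\<^bsub>H\<^esub> \<notin> T"
proof -
  have "inj_on (\<lambda>s. cls [s]) S"
  proof (rule inj_onI)
    fix s t assume "s \<in> S" "t \<in> S" "cls [s] = cls [t]"
    then have "proj (cls [s]) = proj (cls [t])" "s \<in> S" "t \<in> S" by simp_all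
    then show "s = t" by simp
  qed
  then show "card T = card S" by (simp add: T_def card_image)
  show "\<one>\<^bsub>H\<^esub> \<notin> T"
  proof
    assume "\<one>\<^bsub>H\<^esub> \<in> T"
    then obtain s where "s \<in> S" "cls [] = cls [s]" by (auto simp: T_def one_H)
    then have "proj (cls []) = proj (cls [s])" "s \<in> S" by simp_all
    then show False using one_notin_S by simp
  qed
qed

theorem separated_cut:
  assumes "card S \<ge> 3"
  shows "\<exists>U. cut cover.arcs (carrier H) U \<and> U \<inter> Y = {} \<and> (\<forall>x\<in>U. \<forall>t\<in>T. x \<otimes>\<^bsub>H\<^esub> t \<in> U \<union> Y)"
proof -
  obtain U where U: "U \<subseteq> carrier H" "U \<noteq> {}" "U \<inter> Y = {}" "carrier H - (U \<union> Y) \<noteq> {}"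
    and step: "\<And>x t. x \<in> U \<Longrightarrow> t \<in> T \<Longrightarrow> x \<otimes>\<^bsub>H\<^esub> t \<in> U \<union> Y"
    using separated_cover by blast
  have Y2: "finite Y" "card Y \<le> 2" by (auto simp: Y_def card_insert_if)
  have small: "infinite B" if B: "B \<subseteq> carrier H" "B \<noteq> {}" "B \<inter> Y = {}" "carrier H - (B \<union> Y) \<noteq> {}"
    and stepB: "\<And>x t. x \<in> B \<Longrightarrow> t \<in> T \<Longrightarrow> x \<otimes>\<^bsub>H\<^esub> t \<in> B \<union> Y" for B
  proof
    assume fin: "finite B"
    have nY: "cover.nbrs B \<subseteq> Y" using stepB unfolding cover.nbrs_def by blast
    then have "cover.fragment B" using fin B unfolding cover.fragment_def by blast
    then have "card (cover.nbrs B) > 2"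
      using cover.no_small_fragment one_notin_T card_T assms by simp
    moreover have "card (cover.nbrs B) \<le> card Y" using nY Y2 by (intro card_mono)
    ultimately show False using Y2 by simp
  qed
  have infU: "infinite U" using small[of U] U step by blast
  let ?V = "carrier H - (U \<union> Y)"
  have "infinite ?V"
  proof (rule small)
    show "carrier H - (?V \<union> Y) \<noteq> {}" using U by blast
    show "x \<otimes>\<^bsub>H\<^esub> t \<in> ?V \<union> Y" if x: "x \<in> ?V" "t \<in> T" for x t
    proof -
      have G: "x \<in> carrier H" "t \<in> carrier H" using x T_sub by auto
      have "x \<otimes>\<^bsub>H\<^esub> t \<notin> U"
      proof
        assume "x \<otimes>\<^bsub>H\<^esub> t \<in> U"
        then have "(x \<otimes>\<^bsub>H\<^esub> t) \<otimes>\<^bsub>H\<^esub> inv\<^bsub>H\<^esub> t \<in> U \<union> Y" using step cover.gens_inv x by blast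
        then have "x \<in> U \<union> Y" using G by (simp add: H.m_assoc)
        then show False using x by blast
      qed
      then show ?thesis using G by simp
    qed
  qed (use U in auto)
  then have "infinite (carrier H - U)" by (rule contrapos_nn) (auto intro: finite_subset)
  then have "cut cover.arcs (carrier H) U" using cover.cutI[OF U(1) infU _ Y2(1) step] by blast
  then show ?thesis using U step by blast
qed

end

context short_relators
begin

text \<open>Every vertex of the punctured ball is joined within it to a neighbour of
  \<open>v\<close>, along its own short closed walk. So disconnectedness already shows among the
  neighbours, and \<open>Q\<close> is the component of one of them.\<close>

lemma local_cutvertex_imp:
  assumes "local_cutvertex Cay r v"
  shows "\<exists>Q a0 b0. local_separation G S r v v [] Q a0 b0"
proof -
  let ?D = "delete_verts (ball_graph Cay r v) {v}"
  have v: "v \<in> carrier G" and nc: "\<not> connected_graph ?D"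
    using assms by (auto simp: local_cutvertex_def verts_Cay)
  have to_nbr: "\<exists>a\<in>nbhd2 Cay v v. reachable ?D x a" if x: "x \<in> verts ?D" for x
  proof -
    have "x \<in> verts (ball_graph Cay r v)" "x \<noteq> v" using x by (auto simp: delete_verts_def verts_def)
    then obtain w where w: "closed_walk Cay w" "walk_len w \<le> r" "v \<in> set w" "x \<in> set w"
      unfolding ball_graph_def verts_def by auto
    obtain k l where kl: "k < length w" "w ! k = x" "l < length w" "w ! l = v"
      using w(3,4) unfolding in_set_conv_nth by blast
    have vD: "w ! j \<in> verts ?D" if "j < length w" "w ! j \<noteq> v" for j
      using w nth_mem[OF that(1)] that(2) unfolding ball_graph_def delete_verts_def verts_def by auto
    have adjw: "adj Cay (w ! j) (w ! Suc j)" if "Suc j < length w" for j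
      using w(1) that by (auto simp: closed_walk_def walk_def)
    have adjD: "adj ?D (w ! j) (w ! Suc j)" if "Suc j < length w" "w ! j \<noteq> v" "w ! Suc j \<noteq> v" for j
    proof -
      have "{w ! j, w ! Suc j} \<in> edges (ball_graph Cay r v)"
        unfolding ball_graph_def edges_def snd_conv using w that(1)
        by (intro CollectI exI[of _ w] exI[of _ j]) (simp add: walk_len_def)
      then have "{w ! j, w ! Suc j} \<in> edges ?D" using that by (auto simp: delete_verts_def edges_def)
      then show ?thesis using adjw[OF that(1)] vD[of j] vD[of "Suc j"] that by (simp add: adj_def)
    qed
    have nbr: "w ! j \<in> nbhd2 Cay v v" if "j < length w" "w ! j \<noteq> v" "adj Cay (w ! j) v" for j
      using that by (auto simp: nbhd2_def adj_def)
    have "k \<noteq> l" using kl \<open>x \<noteq> v\<close> by auto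
    then consider "k < l" | "l < k" by linarith
    then show ?thesis
    proof cases
      case 1
      \<comment> \<open>The position of \<open>v\<close> in the list may come after or before that
        of \<open>x\<close>: here the walk is followed forward to the first later visit to
        \<open>v\<close>, in the other case backward to the last earlier one.\<close>
      define n where "n = (LEAST n. k < n \<and> w ! n = v)"
      have n: "k < n" "w ! n = v" "n \<le> l"
        unfolding n_def using LeastI[of "\<lambda>n. k < n \<and> w ! n = v" l] Least_le[of "\<lambda>n. k < n \<and> w ! n = v" l] 1 kl by auto
      have min: "w ! j \<noteq> v" if "k \<le> j" "j < n" for j
        using not_less_Least[of j "\<lambda>n. k < n \<and> w ! n = v"] that kl \<open>x \<noteq> v\<close> unfolding n_def[symmetric]
        by (cases "j = k") auto
      have "reachable ?D x (w ! j)" if "k \<le> j" "j < n" for j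
        using that
      proof (induction j rule: dec_induct)
        case base
        then show ?case using reachable_refl[OF x] kl by simp
      next
        case (step j)
        then show ?case using adjD[of j] min[of j] min[of "Suc j"] n kl reachable_step[of ?D x "w ! j"] by simp
      qed
      from this[of "n - 1"] have "reachable ?D x (w ! (n - 1))" using n by simp
      moreover have "w ! (n - 1) \<in> nbhd2 Cay v v"
        using nbr[of "n - 1"] min[of "n - 1"] adjw[of "n - 1"] n kl by simp
      ultimately show ?thesis by blast
    next
      case 2
      define n where "n = Max {n. n < k \<and> w ! n = v}"
      have fin: "finite {n. n < k \<and> w ! n = v}" by simp
      have "l \<in> {n. n < k \<and> w ! n = v}" using 2 kl by simp
      then have "n \<in> {n. n < k \<and> w ! n = v}" unfolding n_def using Max_in[OF fin] by blast
      then have n: "n < k" "w ! n = v" by auto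
      have max: "w ! j \<noteq> v" if "n < j" "j \<le> k" for j
        using Max_ge[OF fin, of j] that kl \<open>x \<noteq> v\<close> unfolding n_def[symmetric] by (cases "j = k") auto
      have "reachable ?D (w ! j) x" if "j \<le> k" "n < j" for j
        using that
      proof (induction j rule: inc_induct)
        case base
        then show ?case using reachable_refl[OF x] kl by simp
      next
        case (step j)
        have "reachable ?D (w ! Suc j) x" using step by simp
        moreover have "adj ?D (w ! Suc j) (w ! j)"
          using adj_sym[OF adjD[of j]] max[of j] max[of "Suc j"] step kl by simp
        ultimately show ?case using reachable_step reachable_sym by metis
      qed
      from this[of "Suc n"] have "reachable ?D x (w ! Suc n)" using n reachable_sym by simp
      moreover have "w ! Suc n \<in> nbhd2 Cay v v"
        using nbr[of "Suc n"] max[of "Suc n"] adj_sym[OF adjw[of n]] n kl by simp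
      ultimately show ?thesis by blast
    qed
  qed
  obtain x y where xy: "x \<in> verts ?D" "y \<in> verts ?D" "\<not> reachable ?D x y"
    using nc by (auto simp: connected_graph_def)
  obtain a where a: "a \<in> nbhd2 Cay v v" "reachable ?D x a" using to_nbr[OF xy(1)] by blast
  obtain b where b: "b \<in> nbhd2 Cay v v" "reachable ?D y b" using to_nbr[OF xy(2)] by blast
  have "reachable ?D a a" using conjunct2[OF reachable_verts[OF a(2)]] by (rule reachable_refl)
  moreover have "\<not> reachable ?D a b" using xy(3) a(2) b(2) reachable_trans reachable_sym by metis
  moreover have "reachable ?D a x' \<longleftrightarrow> reachable ?D a y'" if "reachable ?D x' y'" for x' y'
    using that reachable_trans reachable_sym by metis
  ultimately have "local_separation G S r v v [] (\<lambda>x. reachable ?D a x) a b"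
    using a(1) b(1) v by unfold_locales auto
  then show ?thesis by blast
qed

lemma local_2_separator_imp:
  assumes "local_2_separator Cay r v0 v1"
  shows "\<exists>w Q a0 b0. local_separation G S r v0 v1 w Q a0 b0"
proof -
  let ?C = "connectivity_graph Cay r v0 v1"
  have v: "v0 \<in> carrier G" "v1 \<in> carrier G" and nc: "\<not> connected_graph ?C"
    using assms by (auto simp: local_2_separator_def verts_Cay)
  obtain W where W: "walk Cay W" "hd W = v0" "last W = v1" "2 * walk_len W \<le> r"
    using assms by (auto simp: local_2_separator_def)
  have vC: "verts ?C = nbhd2 Cay v0 v1" by (simp add: connectivity_graph_def verts_def)
  obtain a b where ab: "a \<in> nbhd2 Cay v0 v1" "b \<in> nbhd2 Cay v0 v1" "\<not> reachable ?C a b"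
    using nc vC by (auto simp: connected_graph_def)
  have aa: "reachable ?C a a" using ab vC reachable_refl by metis
  have Q: "reachable ?C a x = reachable ?C a y"
    if "u \<in> {v0, v1}" "x \<in> nbhd2 Cay v0 v1" "y \<in> nbhd2 Cay v0 v1"
      "reachable (delete_verts (ball_graph Cay r u) {v0, v1}) x y" for u x y
  proof (cases "x = y")
    case False
    then have "{x, y} \<in> edges ?C" unfolding connectivity_graph_def edges_def snd_conv using that by blast
    then have "adj ?C x y" using False that vC by (simp add: adj_def)
    then show ?thesis using reachable_step adj_sym by metis
  qed simp
  have "v1 = v0 \<otimes> word_val (word_of W)" "2 * length (word_of W) \<le> r"
    using last_eq_word_of[OF W(1)] W by (simp_all add: length_word_of walk_len_def)
  then have "local_separation G S r v0 v1 (word_of W) (\<lambda>x. reachable ?C a x) a b"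
    using ab aa Q v word_of_set[OF W(1)] by unfold_locales auto
  then show ?thesis by blast
qed

end

section \<open>Cayley graphs of degree at most two\<close>

lemma (in group) int_pow_mod_order:
  assumes "p \<in> carrier G" "p [^] (N::nat) = \<one>" "N > 0"
  shows "\<exists>i<N. p [^] (j::int) = p [^] i"
proof (intro exI conjI)
  have "p [^] j = p [^] (int N * (j div int N) + j mod int N)" by simp
  also have "\<dots> = p [^] (int N * (j div int N)) \<otimes> p [^] (j mod int N)" using assms(1) by (simp only: int_pow_mult)
  also have "p [^] (int N * (j div int N)) = \<one>"
    using assms by (simp add: int_pow_pow[symmetric] int_pow_int)
  finally show "p [^] j = p [^] nat (j mod int N)"
    using assms int_pow_int[of G p "nat (j mod int N)"] by simp
  show "nat (j mod int N) < N" using assms(3) by (simp add: nat_less_iff)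
qed

text \<open>The group is dihedral. Conjugation by \<open>s\<close> inverts the rotation
  \<open>p = s \<otimes> t\<close>, so each further commutation with \<open>s\<close> doubles its
  exponent. Nilpotency bounds the order of \<open>p\<close> by \<open>2 ^ (k + 1)\<close>, and the
  reflections double this.\<close>

lemma (in short_relators) two_involutions_order:
  assumes nil: "nilpotent_class_le G (Suc k)" and S: "S = {s, t}" and ss: "s \<otimes> s = \<one>" and tt: "t \<otimes> t = \<one>"
  shows "order G \<le> 2 ^ (k + 2)"
proof -
  have st: "s \<in> S" "t \<in> S" using S by auto
  have G [simp]: "s \<in> carrier G" "t \<in> carrier G" using S_closed[OF st(1)] S_closed[OF st(2)] .
  have invs: "inv s = s" "inv t = t" using ss tt inv_equality by auto
  define p where "p = s \<otimes> t"
  have p [simp]: "p \<in> carrier G" by (simp add: p_def)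
  have sp: "s \<otimes> inv p \<otimes> s = p" using ss by (simp add: p_def inv_mult_group invs m_assoc)
  have ssc: "s \<otimes> (s \<otimes> x) = x" if "x \<in> carrier G" for x using that ss by (simp add: m_assoc[symmetric])
  have flip: "s \<otimes> inv (p [^] (m::nat)) \<otimes> s = p [^] m" for m
  proof (induction m)
    case 0
    then show ?case using ss by simp
  next
    case (Suc m)
    have "s \<otimes> inv (p [^] Suc m) \<otimes> s = s \<otimes> (inv p \<otimes> inv (p [^] m)) \<otimes> s" by (simp add: inv_mult_group)
    also have "\<dots> = (s \<otimes> inv p \<otimes> s) \<otimes> (s \<otimes> inv (p [^] m) \<otimes> s)" by (simp add: m_assoc ssc)
    also have "\<dots> = p [^] Suc m" unfolding sp Suc using nat_pow_Suc2[of p m] by simp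
    finally show ?case .
  qed
  have "iter_comm G (Suc j) s t = p [^] ((2::nat) ^ Suc j)" for j
  proof (induction j)
    case 0
    then show ?case by (simp add: invs p_def m_assoc numeral_2_eq_2)
  next
    case (Suc j)
    have "iter_comm G (Suc (Suc j)) s t = p [^] ((2::nat) ^ Suc j) \<otimes> p [^] ((2::nat) ^ Suc j)"
      using Suc flip[of "2 ^ Suc j"] by (simp add: invs del: power_Suc)
    then show ?case by (simp add: nat_pow_mult mult_2)
  qed
  then have pN: "p [^] ((2::nat) ^ Suc k) = \<one>" using iter_comm_trivial[OF nil, of s t] by simp
  let ?N = "2 ^ Suc k :: nat"
  have mod: "\<exists>i<?N. p [^] (j::int) = p [^] i" for j using int_pow_mod_order[OF p pN] by simp
  have int_flip: "s \<otimes> p [^] (j::int) = p [^] (- j) \<otimes> s" for j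
  proof -
    obtain i where i: "p [^] (- j) = p [^] (i::nat)" using mod[of "- j"] by blast
    have "p [^] j = inv (p [^] (- j))" by (simp add: int_pow_neg)
    then have "s \<otimes> p [^] j \<otimes> s = p [^] (- j)" using flip[of i] i by simp
    then have "s \<otimes> p [^] j \<otimes> s \<otimes> s = p [^] (- j) \<otimes> s" by simp
    then show ?thesis using ss by (simp add: m_assoc)
  qed
  have t_eq: "t = s \<otimes> p [^] (1::int)" by (simp add: p_def ssc)
  have all: "\<exists>j::int. x = p [^] j \<or> x = p [^] j \<otimes> s" if "x \<in> carrier G" for x
    using that
  proof (induction x rule: base.generate_induct_left)
    case one
    show ?case by (rule exI[of _ 0]) simp
  next
    case (mult y x)
    then obtain j where j: "x = p [^] (j::int) \<or> x = p [^] j \<otimes> s" by (elim exE)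
    have s_case: "\<exists>l::int. s \<otimes> z = p [^] l \<or> s \<otimes> z = p [^] l \<otimes> s"
      if z: "z = p [^] (i::int) \<or> z = p [^] i \<otimes> s" for z i
      using z
    proof
      assume "z = p [^] i"
      then show ?thesis using int_flip[of i] by (intro exI[of _ "- i"]) simp
    next
      assume "z = p [^] i \<otimes> s"
      then have "s \<otimes> z = p [^] (- i) \<otimes> s \<otimes> s" using int_flip[of i] by (simp add: m_assoc[symmetric])
      then show ?thesis using ss by (intro exI[of _ "- i"]) (simp add: m_assoc)
    qed
    have "y = s \<or> y = t" using mult(1) S by blast
    then show ?case
    proof
      assume "y = s"
      then show ?thesis using s_case[OF j] by simp
    next
      assume "y = t"
      have "p [^] (1::int) \<otimes> x = p [^] (1 + j) \<or> p [^] (1::int) \<otimes> x = p [^] (1 + j) \<otimes> s"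
        using j by (elim disjE) (simp_all only: int_pow_mult p, simp_all add: m_assoc)
      from s_case[OF this] show ?thesis using \<open>y = t\<close> t_eq mult(2) by (simp add: m_assoc)
    qed
  qed
  have "carrier G \<subseteq> (\<lambda>i. p [^] i) ` {..<?N} \<union> (\<lambda>i. p [^] i \<otimes> s) ` {..<?N}"
  proof
    fix x assume "x \<in> carrier G"
    then obtain j where j: "x = p [^] (j::int) \<or> x = p [^] j \<otimes> s" using all by blast
    obtain i where "i < ?N" "p [^] j = p [^] i" using mod by blast
    then show "x \<in> (\<lambda>i. p [^] i) ` {..<?N} \<union> (\<lambda>i. p [^] i \<otimes> s) ` {..<?N}" using j by auto
  qed
  then have "order G \<le> card ((\<lambda>i. p [^] i) ` {..<?N} \<union> (\<lambda>i. p [^] i \<otimes> s) ` {..<?N})"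
    unfolding order_def by (intro card_mono) auto
  also have "\<dots> \<le> card ((\<lambda>i. p [^] i) ` {..<?N}) + card ((\<lambda>i. p [^] i \<otimes> s) ` {..<?N})" by (rule card_Un_le)
  also have "\<dots> \<le> card {..<?N} + card {..<?N}" by (intro add_mono card_image_le) auto
  also have "\<dots> = 2 ^ (k + 2)" by simp
  finally show ?thesis .
qed

lemma (in short_relators) cyclic_std_form:
  assumes s: "s \<in> carrier G" and S: "S \<subseteq> {s, inv s}" and ord: "order G > r"
  shows "\<exists>s t. std_form G s t r"
proof -
  have all: "\<exists>j::int. x = s [^] j" if "x \<in> carrier G" for x
    using that
  proof (induction x rule: base.generate_induct_left)
    case one
    show ?case by (rule exI[of _ 0]) simp
  next
    case (mult y x)
    then obtain j where j: "x = s [^] (j::int)" by (elim exE)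
    have "y = s [^] (1::int) \<or> y = s [^] (- 1::int)" using mult(1) S s by (auto simp: int_pow_neg)
    then show ?case using j s int_pow_mult by metis
  qed
  have "s [^] m \<noteq> \<one>" if m: "0 < m" "m \<le> r" for m :: nat
  proof
    assume e: "s [^] m = \<one>"
    have "carrier G \<subseteq> (\<lambda>i. s [^] i) ` {..<m}"
    proof
      fix x assume "x \<in> carrier G"
      then obtain j where "x = s [^] (j::int)" using all by blast
      then show "x \<in> (\<lambda>i. s [^] i) ` {..<m}" using int_pow_mod_order[OF s e m(1), of j] by auto
    qed
    then have "order G \<le> card ((\<lambda>i. s [^] i) ` {..<m})" unfolding order_def by (intro card_mono) auto
    also have "\<dots> \<le> m" using card_image_le[of "{..<m}"] by simp
    finally show False using ord m by simp
  qed
  then show ?thesis using std_form_of_involution[of s \<one> r] s all by auto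
qed

text \<open>For degree at least three the separator lifts to a cut. For smaller degree the group is
  cyclic, or generated by two involutions and then of order at most \<open>2 ^ (k + 2)\<close>,
  which is at most \<open>r\<close>.\<close>

theorem (in short_relators) local_separator_imp_std_form:
  assumes nil: "nilpotent_class_le G (Suc k)" and r: "r \<ge> 4 ^ (k + 2)"
    and sep: "has_local_separator_le2 Cay r" and ord: "order G > r"
  shows "\<exists>s t. std_form G s t r"
proof (cases "card S \<ge> 3")
  case True
  have "\<exists>v0 v1 w Q a0 b0. local_separation G S r v0 v1 w Q a0 b0"
    using sep local_cutvertex_imp local_2_separator_imp unfolding has_local_separator_le2_def by metis
  then obtain v0 v1 w Q a0 b0 where "local_separation G S r v0 v1 w Q a0 b0" by (elim exE)
  then interpret L: local_separation G S r v0 v1 w Q a0 b0 .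
  obtain U where U: "cut cover.arcs (carrier H) U" "U \<inter> L.Y = {}" "\<forall>x\<in>U. \<forall>t\<in>T. x \<otimes>\<^bsub>H\<^esub> t \<in> U \<union> L.Y"
    using L.separated_cut[OF True] by (elim exE conjE)
  have "finite L.Y" "card L.Y \<le> 2" by (auto simp: L.Y_def card_insert_if)
  then show ?thesis using cut_imp_std_form[OF nil r U(1) _ U(2)] U(3) by blast
next
  case False
  have r1: "r \<ge> 2 ^ (k + 2)"
  proof -
    have "(2::nat) ^ (k + 2) \<le> 4 ^ (k + 2)" by (intro power_mono) auto
    then show ?thesis using r by linarith
  qed
  show ?thesis
  proof (cases "\<exists>s\<in>carrier G. S \<subseteq> {s, inv s}")
    case True
    then show ?thesis using cyclic_std_form ord by blast
  next
    case noncyclic: False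
    then obtain s where s: "s \<in> S" by fastforce
    then obtain t where t: "t \<in> S" "t \<noteq> s" "t \<noteq> inv s" using noncyclic S_closed by blast
    have "card {s, t} = 2" using t by simp
    moreover have "{s, t} \<subseteq> S" using s t by simp
    ultimately have S: "S = {s, t}" using False gens_fin card_seteq[of S "{s, t}"] by simp
    have "inv s \<in> {s, t}" "inv t \<in> {s, t}" using S_inv[OF s] S_inv[OF t(1)] S by blast+
    then have "inv s = s" "inv t = t" using t s S_closed inv_inv by (metis insertE singletonD)+
    then have "s \<otimes> s = \<one>" "t \<otimes> t = \<one>" using s t S_closed r_inv by metis+
    then have "order G \<le> 2 ^ (k + 2)" using two_involutions_order[OF nil S] by blast
    then show ?thesis using r1 ord by linarith
  qed
qed

theorem theorem1:
  fixes \<Gamma> :: "'a monoid" and n r :: nat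
  assumes "group \<Gamma>" and "finite (carrier \<Gamma>)"
    and "n \<ge> 1" and "nilpotent_class_le \<Gamma> n"
    and "r \<ge> max (4 ^ (n + 1)) 20"
  shows "((\<exists>S. cayley_gen_set \<Gamma> S \<and>
              two_ends_separated_le2 (local_covering (cayley_graph \<Gamma> S) r \<one>\<^bsub>\<Gamma>\<^esub>))
          \<longleftrightarrow> ((\<exists>S. cayley_gen_set \<Gamma> S \<and> has_local_separator_le2 (cayley_graph \<Gamma> S) r)
               \<and> order \<Gamma> > r))
       \<and> (((\<exists>S. cayley_gen_set \<Gamma> S \<and> has_local_separator_le2 (cayley_graph \<Gamma> S) r)
               \<and> order \<Gamma> > r)
          \<longleftrightarrow> (\<exists>i j. i > r \<and> j \<in> {1, 2} \<and>
                 \<Gamma> \<cong> DirProd (integer_mod_group i) (integer_mod_group j)))"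
proof -
  interpret group \<Gamma> by (rule assms(1))
  obtain k where n: "n = Suc k" using assms(3) by (cases n) auto
  have nil: "nilpotent_class_le \<Gamma> (Suc k)" and r: "r \<ge> 4 ^ (k + 2)" and r20: "r \<ge> 20"
    using assms(4,5) n by auto
  \<comment> \<open>Internal version of (iii), with which (i) and (ii) are compared
    separately.\<close>
  define std where "std = (\<exists>s t. std_form \<Gamma> s t r)"
  have pres: "short_relators \<Gamma> S r" if "cayley_gen_set \<Gamma> S" for S
    using that r20 assms(2) by unfold_locales (auto simp: cayley_gen_set_def intro: finite_subset)
  have iso: "std \<longleftrightarrow> (\<exists>i j. i > r \<and> j \<in> {1, 2} \<and> \<Gamma> \<cong> DirProd (integer_mod_group i) (integer_mod_group j))"
    unfolding std_def using std_form_iso[OF assms(2)] iso_std_form r20 by (meson le_trans one_le_numeral)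
  have ends: std if S: "cayley_gen_set \<Gamma> S" "two_ends_separated_le2 (local_covering (cayley_graph \<Gamma> S) r \<one>\<^bsub>\<Gamma>\<^esub>)" for S
  proof -
    interpret short_relators \<Gamma> S r by (rule pres[OF S(1)])
    show ?thesis unfolding std_def using two_ends_imp_cut[OF S(2)] cut_imp_std_form[OF nil r] by metis
  qed
  have seps: std if S: "cayley_gen_set \<Gamma> S" "has_local_separator_le2 (cayley_graph \<Gamma> S) r" "order \<Gamma> > r" for S
  proof -
    interpret short_relators \<Gamma> S r by (rule pres[OF S(1)])
    show ?thesis unfolding std_def using local_separator_imp_std_form[OF nil r S(2,3)] .
  qed
  \<comment> \<open>One and the same Cayley graph, the cycle or the prism, witnesses (i) and
    (ii).\<close>
  have conv: "(\<exists>S. cayley_gen_set \<Gamma> S \<and> two_ends_separated_le2 (local_covering (cayley_graph \<Gamma> S) r \<one>\<^bsub>\<Gamma>\<^esub>)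
      \<and> has_local_separator_le2 (cayley_graph \<Gamma> S) r) \<and> order \<Gamma> > r" if "std"
    using that std_form_imp[OF assms(2)] r20 unfolding std_def by (metis le_trans numeral_le_iff semiring_norm(68,71,69))
  show ?thesis unfolding iso[symmetric] using ends seps conv by blast
qed

end
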